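(* ${\cal G}_4={\cal H}_4$, where ${\cal G}_4$ is the set of all graphs $G$ such that $\nu_4(F)=\tau_4(F)$ for every induced subgraph $F$ of $G$, and ${\cal H}_4$ is the set of all graphs $G$ such that every non-trivial block $B$ of $G$ satisfies one of the following conditions: (i) $B=Sub_2(H)$ for some bipartite multigraph $H$, and every cutvertex of $G$ that belongs to $B$ is a vertex of $H$; or (ii) $B=K_4$ is an endblock of $G$; or (iii) $B=T(2)$ is an endblock of $G$, and, if $B$ contains a cutvertex $x$ of $G$, then $x$ has degree $2$ in $B$; or (iv) $B=T(p)$ for some positive integer $p$, at most two cutvertices of $G$ belong to $B$, every cutvertex of $G$ that belongs to $B$ has degree $p+1$ in $B$, and, if $B$ contains two cutvertices of $G$, then there is one cutvertex $x$ of $G$ in $B$ such that every vertex in $N_G(x)\setminus V(B)$ has degree $1$ in $G$.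
   Context: Graphs are finite, simple, and undirected. Multigraphs are finite and undirected and may contain loops and parallel edges (a bipartite multigraph has no loops but may have parallel edges). A $4$-path in a graph $G$ is a (not necessarily induced) path in $G$ with exactly $4$ vertices. $\nu_4(G)$ is the maximum cardinality of a set of pairwise vertex-disjoint $4$-paths in $G$, and $\tau_4(G)$ is the minimum cardinality of a set of vertices of $G$ intersecting every $4$-path in $G$. A cutvertex of $G$ is a vertex $x$ of $G$ such that $G-x$ has more components than $G$. A block of $G$ is a maximal connected subgraph $B$ of $G$ such that $B$ itself has no cutvertex. An endblock of $G$ is a block of $G$ that contains at most one cutvertex of $G$. A block is trivial if it is either $K_1$ or $K_2$. $N_G(x)$ is the set of neighbors of $x$ in $G$. Equalities such as $B=K_4$ or $B=T(p)$ are meant up to isomorphism. For a positive integer $p$, the graph $T(p)$ arises from the complete bipartite graph $K_{2,p}$ by adding an edge between the two vertices in a partite set of order $2$. (So $T(1)$ is a triangle, and $T(2)$ is $K_4$ minus an edge.) For a positive integer $k$ and a multigraph $H$, the $k$-subdivision $Sub_k(H)$ arises from $H$ by subdividing every edge exactly $k-1$ times, that is, every edge between distinct vertices $u$ and $v$ is replaced by a path with $k+1$ vertices between $u$ and $v$ whose internal vertices have degree $2$, and every loop incident with a vertex $u$ is replaced by a cycle with $k$ vertices containing $u$ and $k-1$ further vertices of degree $2$. In particular $V(H)\subseteq V(Sub_k(H))$, and when $B=Sub_k(H)$ the vertices of $H$ are regarded as vertices of $B$. *)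

theory Defs
  imports Main
begin

record 'a ugraph =
  verts :: "'a set"
  edges :: "'a set set"

text \<open>The graph without vertices is admitted; it has no components and no blocks.\<close>

definition simple_graph :: "'a ugraph \<Rightarrow> bool" where
  "simple_graph G \<longleftrightarrow> finite (verts G) \<and>
     (\<forall>e\<in>edges G. \<exists>u\<in>verts G. \<exists>v\<in>verts G. u \<noteq> v \<and> e = {u, v})"

definition neighbors :: "'a ugraph \<Rightarrow> 'a \<Rightarrow> 'a set" where
  "neighbors G x = {y. {x, y} \<in> edges G}"

definition deg :: "'a ugraph \<Rightarrow> 'a \<Rightarrow> nat" where
  "deg G x = card (neighbors G x)"

definition subgraph :: "'a ugraph \<Rightarrow> 'a ugraph \<Rightarrow> bool" where
  "subgraph F G \<longleftrightarrow> simple_graph F \<and> verts F \<subseteq> verts G \<and> edges F \<subseteq> edges G"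

definition induced :: "'a ugraph \<Rightarrow> 'a set \<Rightarrow> 'a ugraph" where
  "induced G S = \<lparr>verts = verts G \<inter> S, edges = {e \<in> edges G. e \<subseteq> S}\<rparr>"

definition induced_subgraph :: "'a ugraph \<Rightarrow> 'a ugraph \<Rightarrow> bool" where
  "induced_subgraph F G \<longleftrightarrow> (\<exists>S\<subseteq>verts G. F = induced G S)"

definition iso_via :: "('a \<Rightarrow> 'b) \<Rightarrow> 'a ugraph \<Rightarrow> 'b ugraph \<Rightarrow> bool" where
  "iso_via f G H \<longleftrightarrow> bij_betw f (verts G) (verts H) \<and>
     (\<forall>u\<in>verts G. \<forall>v\<in>verts G. {u, v} \<in> edges G \<longleftrightarrow> {f u, f v} \<in> edges H)"

definition isomorphic :: "'a ugraph \<Rightarrow> 'b ugraph \<Rightarrow> bool" where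
  "isomorphic G H \<longleftrightarrow> (\<exists>f. iso_via f G H)"

text \<open>A path is given by the list of its vertices in order. A path and its reversal are
  two lists, but they share their vertices, so this does not affect packings of disjoint paths.\<close>

definition kpath :: "nat \<Rightarrow> 'a ugraph \<Rightarrow> 'a list \<Rightarrow> bool" where
  "kpath k G xs \<longleftrightarrow> length xs = k \<and> distinct xs \<and> set xs \<subseteq> verts G \<and>
     successively (\<lambda>u v. {u, v} \<in> edges G) xs"

definition path_packing :: "nat \<Rightarrow> 'a ugraph \<Rightarrow> 'a list set \<Rightarrow> bool" where
  "path_packing k G P \<longleftrightarrow> (\<forall>p\<in>P. kpath k G p) \<and>
     pairwise (\<lambda>p q. disjnt (set p) (set q)) P"

definition path_transversal :: "nat \<Rightarrow> 'a ugraph \<Rightarrow> 'a set \<Rightarrow> bool" where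
  "path_transversal k G X \<longleftrightarrow> X \<subseteq> verts G \<and> (\<forall>p. kpath k G p \<longrightarrow> set p \<inter> X \<noteq> {})"

definition path_nu :: "nat \<Rightarrow> 'a ugraph \<Rightarrow> nat" where
  "path_nu k G = Max {card P | P. path_packing k G P}"

definition path_tau :: "nat \<Rightarrow> 'a ugraph \<Rightarrow> nat" where
  "path_tau k G = Min {card X | X. path_transversal k G X}"

definition connected_graph :: "'a ugraph \<Rightarrow> bool" where
  "connected_graph G \<longleftrightarrow> verts G \<noteq> {} \<and>
     (\<forall>u\<in>verts G. \<forall>v\<in>verts G. (u, v) \<in> {(x, y). {x, y} \<in> edges G}\<^sup>*)"

definition components :: "'a ugraph \<Rightarrow> 'a ugraph set" where
  "components G = {C. subgraph C G \<and> connected_graph C \<and>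
     (\<forall>D. subgraph D G \<and> connected_graph D \<and> subgraph C D \<longrightarrow> D = C)}"

definition cutvertex :: "'a ugraph \<Rightarrow> 'a \<Rightarrow> bool" where
  "cutvertex G x \<longleftrightarrow> x \<in> verts G \<and>
     card (components (induced G (verts G - {x}))) > card (components G)"

definition block :: "'a ugraph \<Rightarrow> 'a ugraph \<Rightarrow> bool" where
  "block G B \<longleftrightarrow> subgraph B G \<and> connected_graph B \<and> (\<nexists>x. cutvertex B x) \<and>
     (\<forall>D. subgraph D G \<and> connected_graph D \<and> (\<nexists>x. cutvertex D x) \<and> subgraph B D \<longrightarrow> D = B)"

definition cutvertices_in :: "'a ugraph \<Rightarrow> 'a ugraph \<Rightarrow> 'a set" where
  "cutvertices_in G B = {x \<in> verts B. cutvertex G x}"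

definition endblock :: "'a ugraph \<Rightarrow> 'a ugraph \<Rightarrow> bool" where
  "endblock G B \<longleftrightarrow> block G B \<and> card (cutvertices_in G B) \<le> 1"

definition complete_graph :: "nat \<Rightarrow> nat ugraph" where
  "complete_graph n = \<lparr>verts = {..<n}, edges = {{i, j} | i j. i < n \<and> j < n \<and> i \<noteq> j}\<rparr>"

definition complete_bipartite :: "nat \<Rightarrow> nat \<Rightarrow> (nat + nat) ugraph" where
  "complete_bipartite m n = \<lparr>verts = {..<m} <+> {..<n},
     edges = {{Inl i, Inr j} | i j. i < m \<and> j < n}\<rparr>"

definition T_graph :: "nat \<Rightarrow> (nat + nat) ugraph" where
  "T_graph p = \<lparr>verts = verts (complete_bipartite 2 p),
     edges = insert {Inl 0, Inl 1} (edges (complete_bipartite 2 p))\<rparr>"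

definition trivial_graph :: "'a ugraph \<Rightarrow> bool" where
  "trivial_graph B \<longleftrightarrow> isomorphic B (complete_graph 1) \<or> isomorphic B (complete_graph 2)"

text \<open>The two ends of an edge are listed in an arbitrary order, which carries no meaning;
  a loop has equal ends.\<close>

record ('v, 'e) multigraph =
  mverts :: "'v set"
  medges :: "'e set"
  mends :: "'e \<Rightarrow> 'v \<times> 'v"

definition finite_multigraph :: "('v, 'e) multigraph \<Rightarrow> bool" where
  "finite_multigraph H \<longleftrightarrow> finite (mverts H) \<and> finite (medges H) \<and>
     (\<forall>e\<in>medges H. mends H e \<in> mverts H \<times> mverts H)"

definition bipartite_multigraph :: "('v, 'e) multigraph \<Rightarrow> bool" where
  "bipartite_multigraph H \<longleftrightarrow> finite_multigraph H \<and>
     (\<exists>X Y. X \<union> Y = mverts H \<and> X \<inter> Y = {} \<and>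
        (\<forall>e\<in>medges H. mends H e \<in> X \<times> Y \<union> Y \<times> X))"

datatype ('v, 'e) sub_vertex = Orig 'v | Inner 'e nat

text \<open>The vertex at distance \<open>i\<close> from the first end along the path replacing the edge \<open>e\<close>.\<close>

definition sub_pos :: "nat \<Rightarrow> ('v, 'e) multigraph \<Rightarrow> 'e \<Rightarrow> nat \<Rightarrow> ('v, 'e) sub_vertex" where
  "sub_pos k H e i =
     (if i = 0 then Orig (fst (mends H e))
      else if i = k then Orig (snd (mends H e))
      else Inner e i)"

text \<open>This is the subdivision whenever the latter is a simple graph, that is, for
  \<open>k \<ge> 3\<close>, for \<open>k = 2\<close> and \<open>H\<close> without loops, and for \<open>k = 1\<close> and \<open>H\<close> simple.\<close>

definition Sub :: "nat \<Rightarrow> ('v, 'e) multigraph \<Rightarrow> ('v, 'e) sub_vertex ugraph" where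
  "Sub k H = \<lparr>
     verts = Orig ` mverts H \<union> {Inner e i | e i. e \<in> medges H \<and> 0 < i \<and> i < k},
     edges = {{sub_pos k H e i, sub_pos k H e (Suc i)} | e i. e \<in> medges H \<and> i < k}\<rparr>"

definition G4 :: "'a ugraph set" where
  "G4 = {G. simple_graph G \<and> (\<forall>F. induced_subgraph F G \<longrightarrow> path_nu 4 F = path_tau 4 F)}"

text \<open>Every finite multigraph is isomorphic to one whose vertices and edges are natural numbers,
  hence the type of \<open>H\<close>. The image of \<open>Orig ` mverts H\<close> under the isomorphism is the set of
  vertices of \<open>H\<close> regarded as vertices of the block.\<close>

definition block_type_i :: "'a ugraph \<Rightarrow> 'a ugraph \<Rightarrow> bool" where
  "block_type_i G B \<longleftrightarrow> (\<exists>(H :: (nat, nat) multigraph) f.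
     bipartite_multigraph H \<and> iso_via f (Sub 2 H) B \<and>
     cutvertices_in G B \<subseteq> f ` Orig ` mverts H)"

definition block_type_ii :: "'a ugraph \<Rightarrow> 'a ugraph \<Rightarrow> bool" where
  "block_type_ii G B \<longleftrightarrow> isomorphic B (complete_graph 4) \<and> endblock G B"

definition block_type_iii :: "'a ugraph \<Rightarrow> 'a ugraph \<Rightarrow> bool" where
  "block_type_iii G B \<longleftrightarrow> isomorphic B (T_graph 2) \<and> endblock G B \<and>
     (\<forall>x\<in>cutvertices_in G B. deg B x = 2)"

definition block_type_iv :: "'a ugraph \<Rightarrow> 'a ugraph \<Rightarrow> bool" where
  "block_type_iv G B \<longleftrightarrow> (\<exists>p\<ge>1. isomorphic B (T_graph p) \<and>
     card (cutvertices_in G B) \<le> 2 \<and>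
     (\<forall>x\<in>cutvertices_in G B. deg B x = p + 1) \<and>
     (card (cutvertices_in G B) = 2 \<longrightarrow>
        (\<exists>x\<in>cutvertices_in G B. \<forall>y\<in>neighbors G x - verts B. deg G y = 1)))"

definition H4 :: "'a ugraph set" where
  "H4 = {G. simple_graph G \<and> (\<forall>B. block G B \<and> \<not> trivial_graph B \<longrightarrow>
     block_type_i G B \<or> block_type_ii G B \<or> block_type_iii G B \<or> block_type_iv G B)}"

end

theory Submission
  imports Defs
begin

text \<open>
  Write \<nu>, \<tau> for the packing and the transversal number of 4-paths, and call a vertex set
  Koenig if they agree on the subgraph it induces.

  Necessity. A cycle of length n, induced or not, has \<nu> \<le> n/4 \<le> \<tau> on its own vertices, so cycles
  have length 3 or a multiple of 4, and the same counting with two extra vertices shows that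
  vertices at odd distance on a triangle-free cycle cannot both have degree at least 3. Growing a
  triangle-free block by shortest ears therefore keeps a colouring that exhibits it as
  \<open>Sub 2 H\<close> with \<open>H\<close> bipartite. Blocks with a triangle are handled by short ears and a few
  graphs with at most 7 vertices.

  Sufficiency is by induction on the number of vertices. If deleting a vertex x leaves a union U of
  components without 4-path such that U + x has a 4-path, then x can be put into the transversal.
  Otherwise take x and U with U + x containing a 4-path and U minimal, and a block through x
  that meets U: everything hanging off the block at its other vertices is free of 4-paths. The only
  case that is not solved by a single vertex is \<open>Sub 2 H\<close>. There Koenig's theorem for the simple
  bipartite graph underlying \<open>H\<close> gives the transversal, and Hall's theorem extends the matching
  to disjoint 4-paths, as all degrees in \<open>H\<close> are at least 2.
\<close>

subsection \<open>Koenig's and Hall's theorems\<close>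

text \<open>All graphs in question are induced subgraphs of one graph, so the argument fixes an
  adjacency relation and varies only the vertex set. The constants come from one count: n vertices
  hold at most n/4 disjoint 4-paths, while a transversal meets any four consecutive vertices of a
  cycle. A Koenig set with at most seven vertices has all its 4-paths through one vertex, which
  excludes the small graphs. A cycle of length n with two further vertices still has at most n/4
  disjoint paths, so its transversal is every fourth cycle vertex, and an edge leaving the cycle
  determines the parity of these positions. In the sufficiency proof the obstacle is the vertex x
  joining a bipartite block to the rest R: packings of R and of the block that both use x are not
  disjoint, and transversals chosen independently can miss paths running from R through x into the
  block. Matching and cover are therefore chosen relative to x. Parallel edges of H matter only
  through degrees: a vertex may be a leaf of the underlying simple graph and still has a second
  subdivision neighbour, which can serve as the fourth vertex of a path over a matching
  edge.\<close>

definition covers :: "('a \<times> 'b) set \<Rightarrow> 'a set \<Rightarrow> 'b set \<Rightarrow> bool" where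
  "covers F A B \<longleftrightarrow> finite A \<and> finite B \<and> (\<forall>(u, v)\<in>F. u \<in> A \<or> v \<in> B)"

text \<open>If neither cover already covers F, the first misses \<open>a\<close> and
  \<open>b\<close> and so covers the other edge by \<open>c\<close>; symmetrically \<open>b\<close>
  lies in \<open>B2\<close>. Then both recombinations cover F, and their sizes add up to at most 2k
  + 1, so one of them has size at most k.\<close>

lemma covers_uncross:
  assumes 1: "covers (F - {(a, b)}) A1 B1" "card A1 + card B1 \<le> k"
    and 2: "covers (F - {(a, c)}) A2 B2" "card A2 + card B2 \<le> k"
    and F: "(a, b) \<in> F" "(a, c) \<in> F" "b \<noteq> c"
  shows "\<exists>A B. covers F A B \<and> card A + card B \<le> k"
proof (cases "covers F A1 B1 \<or> covers F A2 B2")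
  case True
  with 1 2 show ?thesis by blast
next
  case False
  have fin: "finite A1" "finite A2" "finite B1" "finite B2"
    using 1 2 by (auto simp: covers_def)
  have n: "a \<notin> A1" "b \<notin> B1" "a \<notin> A2" "c \<notin> B2"
    using False 1 2 by (auto simp: covers_def)
  have m: "c \<in> B1" "b \<in> B2"
    using 1 2 F n by (auto simp: covers_def)
  have I: "covers F (insert a (A1 \<union> A2)) (B1 \<inter> B2)"
    using 1 2 by (auto simp: covers_def)
  have II: "covers F (A1 \<inter> A2) (B1 \<union> B2)"
    using 1 2 m by (auto simp: covers_def)
  have "card (insert a (A1 \<union> A2)) = Suc (card (A1 \<union> A2))"
    using n fin by simp
  moreover have "card (A1 \<union> A2) + card (A1 \<inter> A2) = card A1 + card A2"
    "card (B1 \<union> B2) + card (B1 \<inter> B2) = card B1 + card B2"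
    using card_Un_Int[OF fin(1,2)] card_Un_Int[OF fin(3,4)] by auto
  ultimately have "card (insert a (A1 \<union> A2)) + card (B1 \<inter> B2) \<le> k \<or>
      card (A1 \<inter> A2) + card (B1 \<union> B2) \<le> k"
    using 1 2 by linarith
  with I II show ?thesis by blast
qed

lemma covers_swap: "covers (prod.swap ` F) B A \<longleftrightarrow> covers F A B"
  by (auto simp: covers_def)

lemma swap_image_Diff: "prod.swap ` (F - {(a, b)}) = prod.swap ` F - {(b, a)}"
  by (auto simp: image_iff)

text \<open>Lovasz's argument: in an edge-minimal counterexample two edges with a common end have
  covers of the rest whose unions and intersections recombine to a smaller cover.\<close>

theorem bipartite_konig:
  fixes F :: "('a \<times> 'b) set"
  assumes "finite F"
  shows "\<exists>M A B. M \<subseteq> F \<and> inj_on fst M \<and> inj_on snd M \<and> covers F A B \<and> card A + card B \<le> card M"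
  using assms
proof (induction "card F" arbitrary: F rule: less_induct)
  case less
  define Q where "Q k \<longleftrightarrow> (\<exists>A B. covers F A B \<and> card A + card B \<le> k)" for k
  have fF: "finite F" by fact
  have "covers F (fst ` F) {}" using fF by (force simp: covers_def)
  then have Q1: "Q (card (fst ` F))" unfolding Q_def by force
  define t where "t = (LEAST k. Q k)"
  have Qt: "Q t" unfolding t_def by (rule LeastI[of Q, OF Q1])
  have tmin: "t \<le> k" if "Q k" for k unfolding t_def by (rule Least_le[of Q, OF that])
  show ?case
  proof (cases "inj_on fst F \<and> inj_on snd F")
    case True
    have "covers F (fst ` F) {}" by fact
    moreover have "card (fst ` F) + card ({}::'b set) \<le> card F" using True by (simp add: card_image)
    ultimately show ?thesis using True by blast
  next
    case False
    have "\<exists>e\<in>F. \<forall>A B. covers (F - {e}) A B \<longrightarrow> t \<le> card A + card B"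
    proof (rule ccontr)
      assume "\<not> ?thesis"
      \<comment> \<open>The strict bound is carried as \<open>t - 1\<close> together with
        \<open>t > 0\<close>, because for \<open>t = 0\<close> the truncated \<open>t - 1\<close>
        would not contradict minimality.\<close>
      then have cov: "\<exists>A B. covers (F - {e}) A B \<and> card A + card B \<le> t - 1 \<and> t > 0" if "e \<in> F" for e
        using that by fastforce
      from False have "\<not> inj_on fst F \<or> \<not> inj_on snd F" by blast
      then have "t > 0 \<and> Q (t - 1)"
      proof
        assume "\<not> inj_on fst F" 
        then obtain a b c where e: "(a, b) \<in> F" "(a, c) \<in> F" "b \<noteq> c"
          unfolding inj_on_def by force
        show ?thesis
          using cov[OF e(1)] cov[OF e(2)] covers_uncross[of F a b _ _ "t - 1" c, OF _ _ _ _ e]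
          unfolding Q_def by blast
      next
        assume "\<not> inj_on snd F" 
        then obtain a b c where e: "(b, a) \<in> F" "(c, a) \<in> F" "b \<noteq> c"
          unfolding inj_on_def by force
        then have e': "(a, b) \<in> prod.swap ` F" "(a, c) \<in> prod.swap ` F" by force+
        obtain A1 B1 A2 B2 where 1: "covers (F - {(b, a)}) A1 B1" "card A1 + card B1 \<le> t - 1" "t > 0"
          and 2: "covers (F - {(c, a)}) A2 B2" "card A2 + card B2 \<le> t - 1"
          using cov[OF e(1)] cov[OF e(2)] by blast
        have "\<exists>B A. covers (prod.swap ` F) B A \<and> card B + card A \<le> t - 1"
          by (rule covers_uncross[of _ a b B1 A1 _ c B2 A2])
            (use e e' 1 2 in \<open>simp_all add: swap_image_Diff[symmetric] covers_swap add.commute\<close>)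
        then show ?thesis
          unfolding Q_def covers_swap using 1(3) by (auto simp: add.commute)
      qed
      then have "t \<le> t - 1" "t > 0" using tmin by auto
      then show False by linarith
    qed
    \<comment> \<open>Removing e does not lower the cover number t, so the matching that the
      induction hypothesis yields for F without e has at least t edges.\<close>
    then obtain e where e: "e \<in> F" "\<And>A B. covers (F - {e}) A B \<Longrightarrow> t \<le> card A + card B" by blast
    have "card (F - {e}) < card F" using e fF by (meson card_Diff1_less)
    then obtain M A B where M: "M \<subseteq> F - {e}" "inj_on fst M" "inj_on snd M"
      "covers (F - {e}) A B" "card A + card B \<le> card M"
      using less.hyps[of "F - {e}"] fF by blast
    then have "t \<le> card M" using e(2) by fastforce
    with Qt M show ?thesis unfolding Q_def by (meson Diff_subset order_trans)
  qed
qed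

text \<open>An element n of N outside the cover part A has all of \<open>I n\<close> in B, so Hall's
  condition gives |N - A| \<le> |B|. Hence |N| \<le> |A| + |B| \<le> |M|, and the matching M meets
  every element of N.\<close>

lemma hall:
  fixes I :: "'n \<Rightarrow> 'i set"
  assumes N: "finite N" "\<And>n. n \<in> N \<Longrightarrow> finite (I n)"
    and hall: "\<And>N'. N' \<subseteq> N \<Longrightarrow> card N' \<le> card (\<Union>(I ` N'))"
  shows "\<exists>g. inj_on g N \<and> (\<forall>n\<in>N. g n \<in> I n)"
proof -
  have fS: "finite (Sigma N I)" using N by (intro finite_SigmaI)
  obtain M A B where M: "M \<subseteq> Sigma N I" "inj_on fst M" "inj_on snd M"
    and cov: "covers (Sigma N I) A B" and c: "card A + card B \<le> card M"
    using bipartite_konig[OF fS] by blast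
  have fin: "finite A" "finite B" using cov by (auto simp: covers_def)
  have "\<Union>(I ` (N - A)) \<subseteq> B" using cov by (auto simp: covers_def)
  then have "card (N - A) \<le> card B"
    using hall[of "N - A"] card_mono[OF fin(2)] by (meson Diff_subset le_trans)
  moreover have "card N \<le> card (N - A) + card A"
  proof -
    have "card N \<le> card ((N - A) \<union> A)" using fin N by (intro card_mono) auto
    then show ?thesis using card_Un_le[of "N - A" A] by linarith
  qed
  ultimately have "card N \<le> card (fst ` M)" using c M by (simp add: card_image)
  moreover have "fst ` M \<subseteq> N" using M by auto
  ultimately have N_eq: "fst ` M = N" using card_seteq[OF N(1)] by blast
  define g where "g n = (SOME i. (n, i) \<in> M)" for n
  have g: "(n, g n) \<in> M" if "n \<in> N" for n
  proof -
    have "\<exists>i. (n, i) \<in> M" using that N_eq by force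
    then show ?thesis unfolding g_def by (rule someI_ex)
  qed
  have "inj_on g N"
  proof (rule inj_onI)
    fix n m assume "n \<in> N" "m \<in> N" "g n = g m"
    then have "(n, g n) = (m, g m)" using inj_onD[OF M(3)] g by (metis snd_conv)
    then show "n = m" by simp
  qed
  moreover have "\<forall>n\<in>N. g n \<in> I n" using g M by blast
  ultimately show ?thesis by blast
qed

text \<open>Hall's condition by double counting: a subfamily \<open>N'\<close> owns at least 2|N'|
  incidences of D, and each item takes part in at most two. In the application the items are
  subdivision vertices, which have degree two, and the members of N are disjoint vertex sets that
  each ask for one of them.\<close>

lemma hall_double_count:
  fixes D :: "('v \<times> 'i) set"
  assumes fin: "finite N" "finite D"
    and disj: "\<And>n n'. n \<in> N \<Longrightarrow> n' \<in> N \<Longrightarrow> n \<noteq> n' \<Longrightarrow> n \<inter> n' = {}"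
    and ge: "\<And>n. n \<in> N \<Longrightarrow> 2 \<le> card {p \<in> D. fst p \<in> n}"
    and le: "\<And>i. card {p \<in> D. snd p = i} \<le> 2"
  shows "\<exists>g. inj_on g N \<and> (\<forall>n\<in>N. \<exists>v\<in>n. (v, g n) \<in> D)"
proof -
  define I where "I n = snd ` {p \<in> D. fst p \<in> n}" for n
  have "card N' \<le> card (\<Union>(I ` N'))" if N': "N' \<subseteq> N" for N'
  proof -
    have fN': "finite N'" using N' fin(1) finite_subset by blast
    have fI: "finite (\<Union>(I ` N'))" using fN' fin(2) by (auto simp: I_def)
    have "2 * card N' = (\<Sum>n\<in>N'. 2)" by simp
    also have "\<dots> \<le> (\<Sum>n\<in>N'. card {p \<in> D. fst p \<in> n})"
      using ge N' by (intro sum_mono) blast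
    also have "\<dots> = card (\<Union>n\<in>N'. {p \<in> D. fst p \<in> n})"
    proof (rule card_UN_disjoint[symmetric])
      show "\<forall>i\<in>N'. \<forall>j\<in>N'. i \<noteq> j \<longrightarrow> {p \<in> D. fst p \<in> i} \<inter> {p \<in> D. fst p \<in> j} = {}"
        using disj N' by blast
    qed (use fN' fin in auto)
    also have "\<dots> \<le> card (\<Union>i\<in>\<Union>(I ` N'). {p \<in> D. snd p = i})"
    proof (rule card_mono)
      show "finite (\<Union>i\<in>\<Union>(I ` N'). {p \<in> D. snd p = i})"
        by (intro finite_UN_I fI) (use fin(2) in auto)
    qed (auto simp: I_def)
    also have "\<dots> \<le> (\<Sum>i\<in>\<Union>(I ` N'). card {p \<in> D. snd p = i})"
      by (rule card_UN_le[OF fI])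
    also have "\<dots> \<le> (\<Sum>i\<in>\<Union>(I ` N'). 2)"
      by (rule sum_mono) (rule le)
    finally show ?thesis by simp
  qed
  then have "\<exists>g. inj_on g N \<and> (\<forall>n\<in>N. g n \<in> I n)"
    by (intro hall[OF fin(1)]) (auto simp: I_def fin(2))
  then obtain g where g: "inj_on g N" "\<forall>n\<in>N. g n \<in> I n" by blast
  have "\<exists>v\<in>n. (v, g n) \<in> D" if "n \<in> N" for n
    using g(2) that by (force simp: I_def)
  with g(1) show ?thesis by blast
qed

text \<open>If deleting x does not lower the matching number, a maximum matching avoiding x goes
  with any minimum cover. If it does, a minimum cover of the rest together with x is a minimum
  cover.\<close>

lemma bipartite_konig_rooted:
  fixes F :: "('a \<times> 'a) set"
  assumes "finite F" "F \<subseteq> X \<times> Y" "X \<inter> Y = {}"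
  shows "\<exists>M K. M \<subseteq> F \<and> inj_on fst M \<and> inj_on snd M \<and> finite K \<and> (\<forall>(u, v)\<in>F. u \<in> K \<or> v \<in> K) \<and>
     card K \<le> card M \<and> (x \<in> K \<or> x \<notin> fst ` M \<union> snd ` M)"
proof -
  have *: "\<exists>M K. M \<subseteq> F' \<and> inj_on fst M \<and> inj_on snd M \<and> finite K \<and> (\<forall>(u, v)\<in>F'. u \<in> K \<or> v \<in> K) \<and>
     card K \<le> card M" if F': "F' \<subseteq> F" for F'
  proof -
    obtain M A B where M: "M \<subseteq> F'" "inj_on fst M" "inj_on snd M" "covers F' A B"
      "card A + card B \<le> card M"
      using bipartite_konig[of F'] finite_subset[OF F' assms(1)] by blast
    moreover have "card (A \<union> B) \<le> card M"
      using M card_Un_le[of A B] by simp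
    moreover have "finite (A \<union> B)" "\<forall>(u, v)\<in>F'. u \<in> A \<union> B \<or> v \<in> A \<union> B"
      using M(4) by (auto simp: covers_def)
    ultimately show ?thesis by blast
  qed
  let ?F' = "{(u, v) \<in> F. u \<noteq> x \<and> v \<noteq> x}"
  obtain M0 K0 where 0: "M0 \<subseteq> F" "inj_on fst M0" "inj_on snd M0" "finite K0"
    "\<forall>(u, v)\<in>F. u \<in> K0 \<or> v \<in> K0" "card K0 \<le> card M0"
    using *[of F] by blast
  obtain M1 K1 where 1: "M1 \<subseteq> ?F'" "inj_on fst M1" "inj_on snd M1" "finite K1"
    "\<forall>(u, v)\<in>?F'. u \<in> K1 \<or> v \<in> K1" "card K1 \<le> card M1"
    using *[of ?F'] by blast
  show ?thesis
  proof (cases "card M0 \<le> card M1")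
    case True
    have "x \<notin> fst ` M1 \<union> snd ` M1" using 1(1) by auto
    moreover have "M1 \<subseteq> F" using 1(1) by auto
    moreover have "card K0 \<le> card M1" using True 0 by simp
    ultimately show ?thesis using 0 1 by (intro exI[of _ M1] exI[of _ K0]) auto
  next
    case False
    have "card (insert x K1) \<le> card M0"
      using False 1(4,6) by (simp add: card_insert_if)
    moreover have "\<forall>(u, v)\<in>F. u \<in> insert x K1 \<or> v \<in> insert x K1" using 1(5) by auto
    ultimately show ?thesis using 0 1 by (intro exI[of _ M0] exI[of _ "insert x K1"]) auto
  qed
qed

subsection \<open>Connectivity, maximal 2-connected sets and ears\<close>

locale graph =
  fixes adj :: "'a \<Rightarrow> 'a \<Rightarrow> bool"
  assumes adj_sym: "adj u v \<Longrightarrow> adj v u"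
    and adj_irrefl: "\<not> adj u u"
begin

inductive reach :: "'a set \<Rightarrow> 'a \<Rightarrow> 'a \<Rightarrow> bool" for A u where
  reach_refl: "u \<in> A \<Longrightarrow> reach A u u"
| reach_step: "reach A u v \<Longrightarrow> adj v w \<Longrightarrow> w \<in> A \<Longrightarrow> reach A u w"

lemma reach_in: "reach A u v \<Longrightarrow> u \<in> A \<and> v \<in> A"
  by (induction rule: reach.induct) auto

lemma reach_trans: "reach A v w \<Longrightarrow> reach A u v \<Longrightarrow> reach A u w"
  by (induction rule: reach.induct) (auto intro: reach_step)

lemma reach_edge: "u \<in> A \<Longrightarrow> v \<in> A \<Longrightarrow> adj u v \<Longrightarrow> reach A u v"
  by (meson reach_refl reach_step)

lemma reach_sym: "reach A u v \<Longrightarrow> reach A v u"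
proof (induction rule: reach.induct)
  case (reach_step v w)
  then have "reach A w v"
    using adj_sym reach_edge reach_in by meson
  with reach_step.IH show ?case
    using reach_trans by blast
qed (rule reach_refl)

lemma reach_mono: "reach A u v \<Longrightarrow> A \<subseteq> A' \<Longrightarrow> reach A' u v"
  by (induction rule: reach.induct) (auto intro: reach_refl reach_step)

text \<open>For U contained in A this says that U is a union of components of the graph induced by
  A.\<close>

definition sealed :: "'a set \<Rightarrow> 'a set \<Rightarrow> bool" where
  "sealed A U \<longleftrightarrow> (\<forall>u\<in>U. \<forall>v\<in>A. adj u v \<longrightarrow> v \<in> U)"

lemma reach_sealed: "reach A u v \<Longrightarrow> sealed A U \<Longrightarrow> u \<in> U \<Longrightarrow> v \<in> U"
  by (induction rule: reach.induct) (auto simp: sealed_def)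

lemma reach_first_hit:
  assumes "reach A u v" "u \<notin> W" "v \<in> W"
  shows "\<exists>w t. reach (A - W) u w \<and> adj w t \<and> t \<in> W \<and> t \<in> A"
proof (rule ccontr)
  assume no: "\<not> ?thesis"
  have "u \<in> A" using assms reach_in by blast
  with assms have "reach (A - W) u u" by (auto intro: reach_refl)
  moreover have "sealed A {w. reach (A - W) u w}"
    unfolding sealed_def using no by (auto intro: reach_step)
  ultimately have "reach (A - W) u v"
    using reach_sealed[OF assms(1)] by blast
  with assms reach_in show False by blast
qed

definition path :: "'a set \<Rightarrow> 'a list \<Rightarrow> bool" where
  "path A p \<longleftrightarrow> p \<noteq> [] \<and> distinct p \<and> set p \<subseteq> A \<and> successively adj p"

lemma successively_reach:
  "successively adj p \<Longrightarrow> p \<noteq> [] \<Longrightarrow> set p \<subseteq> A \<Longrightarrow> reach A (hd p) (last p)"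
proof (induction p rule: rev_induct)
  case (snoc x xs)
  show ?case
  proof (cases "xs = []")
    case True
    with snoc.prems show ?thesis by (auto intro: reach_refl)
  next
    case False
    with snoc show ?thesis
      by (auto simp: successively_append_iff intro: reach_step)
  qed
qed simp

lemma reach_path: "reach A u v \<Longrightarrow> \<exists>p. path A p \<and> hd p = u \<and> last p = v"
proof (induction rule: reach.induct)
  case reach_refl
  then have "path A [u]" by (simp add: path_def)
  then show ?case by force
next
  case (reach_step v w)
  then obtain p where p: "path A p" "hd p = u" "last p = v" by blast
  show ?case
  proof (cases "w \<in> set p")
    case True
    then obtain ys zs where pe: "p = ys @ w # zs" by (meson split_list)
    have "path A (ys @ [w])"
      using p(1) unfolding path_def pe by (auto simp: successively_append_iff)
    moreover have "hd (ys @ [w]) = u" using p(2) pe by (cases ys) auto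
    ultimately show ?thesis by (metis last_snoc)
  next
    case False
    have "path A (p @ [w])"
      using p reach_step False unfolding path_def
      by (auto simp: successively_append_iff)
    moreover have "hd (p @ [w]) = u" using p unfolding path_def by simp
    ultimately show ?thesis by (metis last_snoc)
  qed
qed

definition conn :: "'a set \<Rightarrow> bool" where
  "conn A \<longleftrightarrow> A \<noteq> {} \<and> (\<forall>u\<in>A. \<forall>v\<in>A. reach A u v)"

text \<open>Single vertices and single edges count as biconnected, as they do for blocks; hence the
  exception for an empty rest.\<close>

definition biconn :: "'a set \<Rightarrow> bool" where
  "biconn A \<longleftrightarrow> conn A \<and> (\<forall>x\<in>A. A - {x} = {} \<or> conn (A - {x}))"

text \<open>The vertex sets of the blocks of the graph induced by T.\<close>

definition max_biconn :: "'a set \<Rightarrow> 'a set \<Rightarrow> bool" where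
  "max_biconn T S \<longleftrightarrow> S \<subseteq> T \<and> biconn S \<and> (\<forall>S'. S \<subseteq> S' \<and> S' \<subseteq> T \<and> biconn S' \<longrightarrow> S' = S)"

lemma conn_attach:
  assumes "conn S" "S \<subseteq> A" "\<And>v. v \<in> A \<Longrightarrow> \<exists>s\<in>S. reach A v s"
  shows "conn A"
  unfolding conn_def
proof (intro conjI ballI)
  show "A \<noteq> {}" using assms(1,2) by (auto simp: conn_def)
  fix u v assume "u \<in> A" "v \<in> A"
  then obtain s t where "s \<in> S" "t \<in> S" "reach A u s" "reach A v t"
    using assms(3) by blast
  moreover have "reach A s t"
    using assms(1,2) calculation reach_mono unfolding conn_def by blast
  ultimately show "reach A u v"
    using reach_sym reach_trans by blast
qed

lemma conn_hub:
  assumes "h \<in> A" "\<And>v. v \<in> A \<Longrightarrow> v = h \<or> adj v h"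
  shows "conn A"
proof (rule conn_attach)
  show "conn {h}" by (auto simp: conn_def intro: reach_refl)
  show "\<exists>s\<in>{h}. reach A v s" if "v \<in> A" for v
    using assms that by (metis reach_edge reach_refl singletonI)
qed (use assms in auto)

lemma biconn_edge: "adj u v \<Longrightarrow> biconn {u, v}"
proof -
  assume a: "adj u v"
  have "conn {u, v}" by (rule conn_hub[of u]) (use a adj_sym in auto)
  moreover have "conn {w}" for w by (rule conn_hub[of w]) auto
  moreover have "{u, v} - {u} = {v}" "{u, v} - {v} = {u}" using a adj_irrefl by auto
  ultimately show ?thesis unfolding biconn_def by auto
qed

lemma biconn_minus: "biconn S \<Longrightarrow> y \<in> S \<Longrightarrow> y \<noteq> z \<Longrightarrow> conn (S - {z})"
  unfolding biconn_def by (cases "z \<in> S") auto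

text \<open>Whatever vertex z is removed, each remaining vertex of the path can follow it in one of
  the two directions to an end in S - {z}, and S - {z} is connected. That the ends differ matters:
  one of them may be z.\<close>

lemma biconn_add_path:
  assumes S: "biconn S" "y \<in> S" "y' \<in> S" "y \<noteq> y'"
    and p: "path A p" "set p \<inter> S = {}" "adj y (hd p)" "adj (last p) y'"
  shows "biconn (S \<union> set p)"
proof -
  have bk: "\<exists>s\<in>S - {z}. reach (S \<union> set p - {z}) v s" if v: "v \<in> S \<union> set p - {z}" for v z
  proof (cases "v \<in> S")
    case True
    then show ?thesis using v by (auto intro: reach_refl)
  next
    case False
    with v have "v \<in> set p" by blast
    then obtain xs ys where pe: "p = xs @ v # ys" by (meson split_list)
    have succ: "successively adj (xs @ [v])" "successively adj (v # ys)"
      using p(1) by (auto simp: pe path_def successively_append_iff)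
    show ?thesis
    proof (cases "z = y \<or> z \<in> set xs")
      case True
      then have z: "z \<noteq> y'" "z \<notin> set (v # ys)"
        using S p v by (auto simp: path_def pe)
      then have "set (v # ys) \<subseteq> S \<union> set p - {z}" by (auto simp: pe)
      then have "reach (S \<union> set p - {z}) v (last (v # ys))"
        using successively_reach[OF succ(2)] by (metis list.distinct(1) list.sel(1))
      moreover have "last (v # ys) = last p" by (simp add: pe)
      ultimately have "reach (S \<union> set p - {z}) v y'"
        using reach_step p(4) z S by (metis DiffI UnI1 singletonD)
      then show ?thesis using S z by blast
    next
      case z: False
      then have "set (xs @ [v]) \<subseteq> S \<union> set p - {z}" using v by (auto simp: pe)
      then have "reach (S \<union> set p - {z}) (hd (xs @ [v])) v"
        using successively_reach[OF succ(1)] by (metis Nil_is_append_conv last_snoc list.distinct(1))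
      moreover have "hd (xs @ [v]) = hd p" by (cases xs) (auto simp: pe)
      ultimately have "reach (S \<union> set p - {z}) v (hd p)"
        using reach_sym by metis
      then have "reach (S \<union> set p - {z}) v y"
        using reach_step p(3) z S adj_sym by (metis DiffI UnI1 singletonD)
      then show ?thesis using S z by blast
    qed
  qed
  have "conn (S \<union> set p - {z})" for z
  proof (rule conn_attach[OF _ _ bk])
    show "conn (S - {z})" using biconn_minus S by metis
  qed auto
  moreover have "conn (S \<union> set p)"
  proof (cases "\<exists>z. z \<notin> S \<union> set p")
    case True
    then obtain z where "z \<notin> S \<union> set p" by blast
    then have "S \<union> set p - {z} = S \<union> set p" by blast
    with calculation show ?thesis by metis
  next
    case False
    have "conn S" using S by (simp add: biconn_def)
    then show ?thesis
    proof (rule conn_attach)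
      fix v assume v: "v \<in> S \<union> set p"
      show "\<exists>s\<in>S. reach (S \<union> set p) v s"
      proof (cases "v = y")
        case True
        then show ?thesis using S by (auto intro: reach_refl)
      next
        case False
        with v bk[of v y] show ?thesis using reach_mono[of "S \<union> set p - {y}" v _ "S \<union> set p"] by blast
      qed
    qed auto
  qed
  ultimately show ?thesis unfolding biconn_def by blast
qed

text \<open>A path outside S between two different vertices of S would be an ear, and adding it
  would contradict maximality. Consequently each component of T - S is attached to S at one vertex
  at most.\<close>

lemma max_biconn_no_ear:
  assumes S: "max_biconn T S" and "y \<in> S" "y' \<in> S"
    and r: "reach (T - S) k k'" and a: "adj y k" "adj k' y'"
  shows "y = y'"
proof (rule ccontr)
  assume ne: "y \<noteq> y'"
  obtain p where p: "path (T - S) p" "hd p = k" "last p = k'"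
    using reach_path[OF r] by blast
  then have "set p \<inter> S = {}" "set p \<subseteq> T" "p \<noteq> []" by (auto simp: path_def)
  moreover from this have "biconn (S \<union> set p)"
    using biconn_add_path[of S y y' "T - S" p] S assms ne p by (auto simp: max_biconn_def)
  ultimately have "S \<union> set p = S"
    using S unfolding max_biconn_def by blast
  with \<open>set p \<inter> S = {}\<close> \<open>p \<noteq> []\<close> show False by (metis Int_commute le_iff_sup set_empty Un_commute inf.absorb2)
qed

lemma biconn_extend:
  assumes "finite T" "biconn A" "A \<subseteq> T"
  shows "\<exists>S. A \<subseteq> S \<and> max_biconn T S"
proof -
  let ?F = "{S. A \<subseteq> S \<and> S \<subseteq> T \<and> biconn S}"
  have f: "finite ?F" by (rule finite_subset[of _ "Pow T"]) (use assms in auto)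
  have m: "A \<in> ?F" using assms by auto
  obtain S where S: "S \<in> ?F" "\<forall>S'\<in>?F. S \<subseteq> S' \<longrightarrow> S = S'"
    using finite_has_maximal2[OF f m] by auto
  have "S' = S" if "S \<subseteq> S'" "S' \<subseteq> T" "biconn S'" for S'
    using S that by auto
  with S(1) show ?thesis unfolding max_biconn_def by auto
qed

text \<open>After the removal of any z other than v the rest is connected and still has another
  vertex, so v keeps a neighbour. Taking z to be a first neighbour yields a second one.\<close>

lemma biconn_two_nbrs:
  assumes S: "biconn S" "finite S" "card S \<ge> 3" "v \<in> S"
  shows "\<exists>a\<in>S. \<exists>b\<in>S. a \<noteq> b \<and> adj v a \<and> adj v b"
proof -
  have nb: "\<exists>a\<in>S - {z}. adj v a" if z: "z \<noteq> v" for z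
  proof -
    have "card (S - {z, v}) > 0"
      using S card_Diff_subset[of "{z, v}" S] diff_card_le_card_Diff[of "{z, v}" S] z by auto
    then obtain w where w: "w \<in> S - {z, v}" by (metis card_gt_0_iff ex_in_conv)
    have "conn (S - {z})" using biconn_minus S w by blast
    then have "reach (S - {z}) w v" using w S z unfolding conn_def by blast
    then show ?thesis
    proof cases
      case (reach_step u)
      then show ?thesis using reach_in adj_sym by blast
    qed (use w in auto)
  qed
  have "card (S - {v}) > 0" using S by (simp add: card_Diff_singleton)
  then obtain z where "z \<in> S" "z \<noteq> v" by (metis DiffE card_gt_0_iff ex_in_conv singletonI)
  then obtain a where a: "a \<in> S" "adj v a" using nb by blast
  then obtain b where "b \<in> S - {a}" "adj v b" using nb adj_irrefl by metis
  with a show ?thesis by blast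
qed

text \<open>From a vertex z outside W walk until W is first met, at s. With s removed the set is
  still connected, so a walk continuing from the last vertex before s first meets W at some t other
  than s.\<close>

lemma ear_exists:
  assumes S: "biconn S" and W: "W \<subseteq> S" "W \<noteq> S" and ab: "a \<in> W" "b \<in> W" "a \<noteq> b"
  shows "\<exists>p s t. path (S - W) p \<and> s \<in> W \<and> t \<in> W \<and> s \<noteq> t \<and> adj s (hd p) \<and> adj (last p) t"
proof -
  obtain z where z: "z \<in> S" "z \<notin> W" using W by blast
  have "reach S z a" using S z W ab unfolding biconn_def conn_def by blast
  then obtain w s where w: "reach (S - W) z w" "adj w s" "s \<in> W"
    using reach_first_hit z ab by meson
  then have wS: "w \<in> S" "w \<notin> W" using reach_in by auto
  obtain c where c: "c \<in> W" "c \<noteq> s" using ab by blast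
  have "conn (S - {s})" using biconn_minus[OF S, of c s] c W by blast
  then have "reach (S - {s}) w c" using wS w c W unfolding conn_def by blast
  then obtain u t where u: "reach (S - {s} - W) w u" "adj u t" "t \<in> W" "t \<in> S - {s}"
    using reach_first_hit wS c by meson
  then have "reach (S - W) w u" using reach_mono by blast
  then obtain p where "path (S - W) p" "hd p = w" "last p = u" using reach_path by blast
  moreover have "adj s w" using w adj_sym by blast
  ultimately show ?thesis using u w by blast
qed

text \<open>For a block S with at least two vertices these are its cutvertices, by
  \<open>max_biconn_cut\<close>.\<close>

definition attach :: "'a set \<Rightarrow> 'a set \<Rightarrow> 'a set" where
  "attach T S = {x \<in> S. \<exists>y\<in>T - S. adj x y}"

subsection \<open>Packings and transversals of 4-paths\<close>

definition p4 :: "'a \<Rightarrow> 'a \<Rightarrow> 'a \<Rightarrow> 'a \<Rightarrow> bool" where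
  "p4 a b c d \<longleftrightarrow> adj a b \<and> adj b c \<and> adj c d \<and> a \<noteq> c \<and> a \<noteq> d \<and> b \<noteq> d"

definition has_p4 :: "'a set \<Rightarrow> bool" where
  "has_p4 A \<longleftrightarrow> (\<exists>a b c d. p4 a b c d \<and> {a, b, c, d} \<subseteq> A)"

text \<open>A 4-path enters only through its vertex set, which identifies a path with its
  reversal.\<close>

definition packing :: "'a set \<Rightarrow> 'a set set \<Rightarrow> bool" where
  "packing T P \<longleftrightarrow> finite P \<and> (\<forall>A\<in>P. A \<subseteq> T \<and> (\<exists>a b c d. A = {a, b, c, d} \<and> p4 a b c d)) \<and>
     pairwise disjnt P"

definition hits :: "'a set \<Rightarrow> 'a set \<Rightarrow> bool" where
  "hits T X \<longleftrightarrow> finite X \<and> (\<forall>a b c d. p4 a b c d \<longrightarrow> {a, b, c, d} \<subseteq> T \<longrightarrow> {a, b, c, d} \<inter> X \<noteq> {})"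

text \<open>By weak duality such a pair forces equality of the packing and the transversal number.
  Asking only for its existence keeps maxima and minima out of the argument.\<close>

definition konig :: "'a set \<Rightarrow> bool" where
  "konig T \<longleftrightarrow> (\<exists>P X. packing T P \<and> hits T X \<and> card X \<le> card P)"

lemma p4_rev: "p4 a b c d \<Longrightarrow> p4 d c b a"
  using adj_sym by (auto simp: p4_def)

lemma has_p4I: "p4 a b c d \<Longrightarrow> {a, b, c, d} \<subseteq> A \<Longrightarrow> has_p4 A"
  unfolding has_p4_def by (intro exI conjI)

lemma has_p4_mono: "has_p4 A \<Longrightarrow> A \<subseteq> B \<Longrightarrow> has_p4 B"
  unfolding has_p4_def by (meson subset_trans)

lemma p4_sealed:
  assumes "p4 a b c d" "{a, b, c, d} \<subseteq> A" "sealed A U" "{a, b, c, d} \<inter> U \<noteq> {}"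
  shows "{a, b, c, d} \<subseteq> U"
proof -
  have ad: "adj a b" "adj b c" "adj c d" "adj b a" "adj c b" "adj d c"
    using assms(1) adj_sym by (auto simp: p4_def)
  then have "a \<in> U \<longleftrightarrow> b \<in> U" "b \<in> U \<longleftrightarrow> c \<in> U" "c \<in> U \<longleftrightarrow> d \<in> U"
    using assms(2,3) by (auto simp: sealed_def)
  with assms(4) show ?thesis by auto
qed

lemma packing_mono: "packing T P \<Longrightarrow> T \<subseteq> T' \<Longrightarrow> packing T' P"
  unfolding packing_def by blast

lemma packingI:
  assumes "finite P" "\<And>A. A \<in> P \<Longrightarrow> A \<subseteq> T \<and> (\<exists>a b c d. A = {a, b, c, d} \<and> p4 a b c d)"
    "\<And>A B. A \<in> P \<Longrightarrow> B \<in> P \<Longrightarrow> A \<noteq> B \<Longrightarrow> A \<inter> B = {}"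
  shows "packing T P"
  using assms by (simp add: packing_def pairwise_def disjnt_def)

lemma packingD:
  assumes "packing T P"
  shows "finite P" "A \<in> P \<Longrightarrow> A \<subseteq> T" "A \<in> P \<Longrightarrow> \<exists>a b c d. A = {a, b, c, d} \<and> p4 a b c d"
    "A \<in> P \<Longrightarrow> B \<in> P \<Longrightarrow> A \<noteq> B \<Longrightarrow> A \<inter> B = {}"
  using assms by (simp_all add: packing_def pairwise_def disjnt_def)

lemma packing_nonempty: "packing T P \<Longrightarrow> A \<in> P \<Longrightarrow> A \<noteq> {}"
  using packingD(3) by fastforce

lemma packing_Un:
  assumes "packing T1 P1" "packing T2 P2" "T1 \<inter> T2 = {}"
  shows "packing (T1 \<union> T2) (P1 \<union> P2) \<and> card (P1 \<union> P2) = card P1 + card P2"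
proof -
  have cross: "A \<inter> B = {}" if "A \<in> P1" "B \<in> P2" for A B
    using packingD(2)[OF assms(1) that(1)] packingD(2)[OF assms(2) that(2)] assms(3) by blast
  have "packing (T1 \<union> T2) (P1 \<union> P2)"
  proof (rule packingI)
    show "finite (P1 \<union> P2)" using assms packingD(1) by simp
    fix A assume "A \<in> P1 \<union> P2"
    then show "A \<subseteq> T1 \<union> T2 \<and> (\<exists>a b c d. A = {a, b, c, d} \<and> p4 a b c d)"
      using packingD(2,3)[OF assms(1)] packingD(2,3)[OF assms(2)] by (metis UnE le_supI1 le_supI2)
    fix B assume "B \<in> P1 \<union> P2" "A \<noteq> B"
    with \<open>A \<in> P1 \<union> P2\<close> show "A \<inter> B = {}"
      using packingD(4)[OF assms(1)] packingD(4)[OF assms(2)] cross by (metis UnE inf_commute)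
  qed
  moreover have "P1 \<inter> P2 = {}"
  proof (rule ccontr)
    assume "P1 \<inter> P2 \<noteq> {}"
    then obtain A where A: "A \<in> P1" "A \<in> P2" by blast
    then have "A \<subseteq> T1" "A \<subseteq> T2" "A \<noteq> {}"
      using assms packingD(2) packing_nonempty by metis+
    with assms(3) show False by blast
  qed
  ultimately show ?thesis
    using assms by (auto simp: packing_def intro: card_Un_disjoint)
qed

lemma packing_image:
  assumes I: "finite I" and f: "\<And>i. i \<in> I \<Longrightarrow> f i \<subseteq> T \<and> (\<exists>a b c d. f i = {a, b, c, d} \<and> p4 a b c d)"
    and disj: "\<And>i j. i \<in> I \<Longrightarrow> j \<in> I \<Longrightarrow> i \<noteq> j \<Longrightarrow> f i \<inter> f j = {}"
  shows "packing T (f ` I) \<and> card (f ` I) = card I"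
proof
  show "packing T (f ` I)"
  proof (rule packingI)
    fix A B assume "A \<in> f ` I" "B \<in> f ` I" "A \<noteq> B"
    then obtain i j where "i \<in> I" "j \<in> I" "A = f i" "B = f j" "i \<noteq> j" by blast
    then show "A \<inter> B = {}" using disj by simp
  qed (use I f in auto)
  have ne: "f i \<noteq> {}" if "i \<in> I" for i
    using f[OF that] by fastforce
  have "inj_on f I"
  proof (rule inj_onI, rule ccontr)
    fix i j assume ij: "i \<in> I" "j \<in> I" "f i = f j" "i \<noteq> j"
    then have "f i = {}" using disj[of i j] by simp
    with ne ij show False by blast
  qed
  then show "card (f ` I) = card I" by (rule card_image)
qed

lemma hitsI:
  assumes "finite X" "\<And>a b c d. p4 a b c d \<Longrightarrow> {a, b, c, d} \<subseteq> T \<Longrightarrow> {a, b, c, d} \<inter> X = {} \<Longrightarrow> False"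
  shows "hits T X"
  using assms unfolding hits_def by meson

lemma hitsD:
  "hits T X \<Longrightarrow> p4 a b c d \<Longrightarrow> {a, b, c, d} \<subseteq> T \<Longrightarrow> {a, b, c, d} \<inter> X = {} \<Longrightarrow> False"
  unfolding hits_def by meson

lemma konig_no_p4:
  assumes "\<not> has_p4 T"
  shows "konig T"
proof -
  have "hits T {}" using assms has_p4I by (intro hitsI) blast+
  moreover have "packing T {}" by (rule packingI) auto
  ultimately show ?thesis unfolding konig_def by fastforce
qed

text \<open>A 4-path of T - {x} that meets U stays in U, which has none. Hence the given packing
  avoids U and can be enlarged by a 4-path in U + x, while x joins the transversal.\<close>

lemma konig_extend:
  assumes k: "konig (T - {x})" and x: "x \<in> T"
    and U: "U \<subseteq> T - {x}" "sealed (T - {x}) U" "\<not> has_p4 U" "has_p4 (insert x U)"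
  shows "konig T"
proof -
  obtain P X where P: "packing (T - {x}) P" and X: "hits (T - {x}) X" and c: "card X \<le> card P"
    using k by (auto simp: konig_def)
  have "A \<subseteq> T - {x} - U" if AP: "A \<in> P" for A
  proof -
    obtain a b c d where A: "A = {a, b, c, d}" "p4 a b c d" "A \<subseteq> T - {x}"
      using packingD(2,3)[OF P AP] by blast
    then have "\<not> A \<subseteq> U" using U(3) has_p4I by metis
    then have "A \<inter> U = {}" using p4_sealed[OF A(2) _ U(2)] A by metis
    with A show ?thesis by blast
  qed
  then have P': "packing (T - {x} - U) P" using packingD[OF P(1)] by (intro packingI) simp_all
  obtain a b c d where q: "p4 a b c d" "{a, b, c, d} \<subseteq> insert x U"
    using U(4) unfolding has_p4_def by blast
  then have Q: "packing (insert x U) {{a, b, c, d}}" by (intro packingI) auto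
  have "(T - {x} - U) \<inter> insert x U = {}" by blast
  from packing_Un[OF P' Q this]
  have "packing T (P \<union> {{a, b, c, d}})" "card (P \<union> {{a, b, c, d}}) = card P + 1"
    using packing_mono[of "(T - {x} - U) \<union> insert x U" _ T] x U(1) by auto
  moreover have "hits T (insert x X)"
    using X unfolding hits_def by fastforce
  moreover have "card (insert x X) \<le> card P + 1"
    using c card_insert_le_m1[of "card P + 1" X x] by simp
  ultimately show ?thesis unfolding konig_def by metis
qed


text \<open>Here \<open>E\<close> are the subdivision vertices of the block, \<open>X\<close> and \<open>Y\<close> the classes of \<open>H\<close>,
  \<open>W y\<close> is what hangs off the block at \<open>y\<close>, and \<open>R\<close> is the rest of the graph, attached at
  \<open>x\<close>. A vertex \<open>y\<close> with a path \<open>y z w\<close> into \<open>W y\<close> (set \<open>Bs\<close>) must be taken; the other vertices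
  are treated by a matching \<open>M\<close> and a cover \<open>K\<close> of \<open>H - Bs\<close>. Hall's theorem gives each member of
  \<open>Bs\<close> and \<open>M\<close> its own further subdivision vertex. If \<open>x\<close> is not in \<open>K\<close>, then \<open>M\<close> misses \<open>x\<close>,
  which gets a pendant subdivision vertex as well, and the induction hypothesis is applied to
  \<open>R\<close> with this pendant edge.\<close>

lemma konig_bipartite_block:
  assumes fin: "finite T"
    and IH: "\<And>T'. T' \<subset> T \<Longrightarrow> konig T'"
    and S: "S \<subseteq> T" "S = X \<union> Y \<union> E" "X \<inter> Y = {}" "X \<inter> E = {}" "Y \<inter> E = {}"
    and edges: "\<And>u v. u \<in> S \<Longrightarrow> v \<in> S \<Longrightarrow> adj u v \<Longrightarrow> u \<in> E \<longleftrightarrow> v \<notin> E"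
    and E: "\<And>e. e \<in> E \<Longrightarrow> \<exists>u\<in>X. \<exists>v\<in>Y. {w \<in> T. adj e w} = {u, v}"
    and deg: "\<And>v. v \<in> X \<union> Y \<Longrightarrow> \<exists>e\<in>E. \<exists>e'\<in>E. e \<noteq> e' \<and> adj v e \<and> adj v e'"
    and x: "x \<in> X \<union> Y"
    and W: "\<And>y. y \<in> X \<union> Y - {x} \<Longrightarrow> W y \<subseteq> T - S"
    and W_disj: "\<And>y y'. y \<in> X \<union> Y - {x} \<Longrightarrow> y' \<in> X \<union> Y - {x} \<Longrightarrow> y \<noteq> y' \<Longrightarrow> W y \<inter> W y' = {}"
    and W_nbr: "\<And>y v w. y \<in> X \<union> Y - {x} \<Longrightarrow> v \<in> W y \<Longrightarrow> w \<in> T \<Longrightarrow> adj v w \<Longrightarrow> w \<in> W y \<or> w = y"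
    and W_free: "\<And>y. y \<in> X \<union> Y - {x} \<Longrightarrow> \<not> has_p4 (insert y (W y))"
    and R: "R = T - S - (\<Union>y\<in>X \<union> Y - {x}. W y)"
    and R_nbr: "\<And>r s. r \<in> R \<Longrightarrow> s \<in> T - R \<Longrightarrow> adj r s \<Longrightarrow> s = x"
  shows "konig T"
proof -
  define Bs where "Bs = {y \<in> X \<union> Y - {x}. \<exists>z\<in>W y. \<exists>w\<in>W y. adj y z \<and> adj z w}"
  define F where "F = {(u, v). u \<in> X - Bs \<and> v \<in> Y - Bs \<and> (\<exists>e\<in>E. adj e u \<and> adj e v)}"
  have finS: "finite X" "finite Y" "finite E" "finite Bs"
    using fin S finite_subset[of S T] by (auto simp: Bs_def)
  have ET: "E \<subseteq> T" "X \<subseteq> T" "Y \<subseteq> T" using S by auto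
  have Bs: "Bs \<subseteq> X \<union> Y" "x \<notin> Bs" by (auto simp: Bs_def)
  have F: "F \<subseteq> X \<times> Y" by (auto simp: F_def)
  then have "finite F" using finS finite_subset by blast
  from bipartite_konig_rooted[OF this F S(3)]
  obtain M K where M: "M \<subseteq> F" "inj_on fst M" "inj_on snd M" and K: "finite K" "card K \<le> card M"
    and cov: "\<And>u v. (u, v) \<in> F \<Longrightarrow> u \<in> K \<or> v \<in> K" and xM: "x \<in> K \<or> x \<notin> fst ` M \<union> snd ` M"
    by (metis (no_types, lifting) case_prodD)
  have finM: "finite M" using M(1) \<open>finite F\<close> finite_subset by blast
  have MXY: "fst m \<in> X - Bs" "snd m \<in> Y - Bs" if "m \<in> M" for m
    using that M(1) by (auto simp: F_def)
  have Enb: "p = u \<or> p = v" if "e \<in> E" "adj e u" "adj e v" "u \<in> X" "v \<in> Y" "adj e p" "p \<in> T" for e u v p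
  proof -
    obtain u' v' where uv: "u' \<in> X" "v' \<in> Y" "{w \<in> T. adj e w} = {u', v'}" using E[OF \<open>e \<in> E\<close>] by blast
    have "u \<in> {w \<in> T. adj e w}" "v \<in> {w \<in> T. adj e w}" "p \<in> {w \<in> T. adj e w}" using that ET by auto
    then show ?thesis using uv S(3) that(4,5) by auto
  qed
  \<comment> \<open>Among possibly parallel edges of H one is chosen for each pair of the
    matching.\<close>
  define em where "em m = (SOME e. e \<in> E \<and> adj e (fst m) \<and> adj e (snd m))" for m
  have em: "em m \<in> E" "adj (em m) (fst m)" "adj (em m) (snd m)" if "m \<in> M" for m
  proof -
    have "(fst m, snd m) \<in> F" using that M(1) by auto
    then have "\<exists>e. e \<in> E \<and> adj e (fst m) \<and> adj e (snd m)" unfolding F_def by blast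
    from someI_ex[OF this] show "em m \<in> E" "adj (em m) (fst m)" "adj (em m) (snd m)"
      by (auto simp: em_def)
  qed
  have em_end: "v = fst m \<or> v = snd m" if "m \<in> M" "adj v (em m)" "v \<in> T" for v m
  proof -
    have "fst m \<in> X" "snd m \<in> Y" using MXY[OF that(1)] by auto
    then show ?thesis using Enb[OF em[OF that(1)] _ _ adj_sym[OF that(2)] that(3)] by blast
  qed
  have em_fst: "m = m'" if "m \<in> M" "m' \<in> M" "adj (fst m) (em m')" for m m'
  proof -
    have "fst m \<in> X" "snd m' \<in> Y" using MXY that(1,2) by auto
    moreover from this have "fst m \<in> T" "fst m \<noteq> snd m'" using ET S(3) by auto
    ultimately have "fst m = fst m'" using em_end[OF that(2,3)] by metis
    then show ?thesis using M(2) that by (simp add: inj_on_def)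
  qed
  have em_snd: "m = m'" if "m \<in> M" "m' \<in> M" "adj (snd m) (em m')" for m m'
  proof -
    have "snd m \<in> Y" "fst m' \<in> X" using MXY that(1,2) by auto
    moreover from this have "snd m \<in> T" "snd m \<noteq> fst m'" using ET S(3) by auto
    ultimately have "snd m = snd m'" using em_end[OF that(2,3)] by metis
    then show ?thesis using M(3) that by (simp add: inj_on_def)
  qed
  have em_inj: "m = m'" if "m \<in> M" "m' \<in> M" "em m = em m'" for m m'
    using em_fst[OF that(1,2)] em(2)[OF that(1)] adj_sym that(3) by metis
  \<comment> \<open>The units that each ask for one further subdivision vertex; x is a unit of its
    own if it is outside the cover. D records which subdivision vertices are still free for which
    vertices.\<close>
  define N where "N = (\<lambda>y. {y}) ` Bs \<union> (\<lambda>m. {fst m, snd m}) ` M \<union> (if x \<in> K then {} else {{x}})"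
  define D where "D = {(v, e). v \<in> X \<union> Y \<and> e \<in> E - em ` M \<and> adj v e}"
  have finN: "finite N" using finS finM by (simp add: N_def)
  have finD: "finite D" by (rule finite_subset[of _ "(X \<union> Y) \<times> E"]) (use finS in \<open>auto simp: D_def\<close>)
  have N_cases: "(\<exists>y\<in>Bs. n = {y}) \<or> (\<exists>m\<in>M. n = {fst m, snd m}) \<or> (n = {x} \<and> x \<notin> K)" if "n \<in> N" for n
    using that by (auto simp: N_def split: if_splits)
  \<comment> \<open>A subdivision vertex \<open>em m\<close> is adjacent only to the ends of m. So
    an unmatched vertex finds two free subdivision neighbours, and a matched pair finds a free one
    at each end.\<close>
  have single: "2 \<le> card {p \<in> D. fst p \<in> {y}}" if y: "y \<in> X \<union> Y" "y \<notin> fst ` M \<union> snd ` M" for y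
  proof -
    obtain e e' where e: "e \<in> E" "e' \<in> E" "e \<noteq> e'" "adj y e" "adj y e'" using deg[OF y(1)] by blast
    have "e \<notin> em ` M" "e' \<notin> em ` M" using em_end e(4,5) y ET by blast+
    then have "{(y, e), (y, e')} \<subseteq> {p \<in> D. fst p \<in> {y}}" using e y by (auto simp: D_def)
    then have "card {(y, e), (y, e')} \<le> card {p \<in> D. fst p \<in> {y}}" by (intro card_mono) (use finD in auto)
    then show ?thesis using e by simp
  qed
  have double: "2 \<le> card {p \<in> D. fst p \<in> {fst m, snd m}}" if m: "m \<in> M" for m
  proof -
    have mm: "fst m \<in> X" "snd m \<in> Y" using MXY m by auto
    have "\<exists>e\<in>E. e \<noteq> em m \<and> adj (fst m) e" using deg[of "fst m"] mm by (metis UnI1)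
    then obtain e where e: "e \<in> E" "e \<noteq> em m" "adj (fst m) e" by blast
    have "\<exists>e\<in>E. e \<noteq> em m \<and> adj (snd m) e" using deg[of "snd m"] mm by (metis UnI2)
    then obtain e' where e': "e' \<in> E" "e' \<noteq> em m" "adj (snd m) e'" by blast
    have "e \<notin> em ` M" "e' \<notin> em ` M" using em_fst[OF m] em_snd[OF m] e e' by blast+
    then have "{(fst m, e), (snd m, e')} \<subseteq> {p \<in> D. fst p \<in> {fst m, snd m}}" using e e' mm by (auto simp: D_def)
    then have "card {(fst m, e), (snd m, e')} \<le> card {p \<in> D. fst p \<in> {fst m, snd m}}"
      by (intro card_mono) (use finD in auto)
    moreover have "fst m \<noteq> snd m" using mm S(3) by auto
    ultimately show ?thesis by simp
  qed
  have "\<exists>g. inj_on g N \<and> (\<forall>n\<in>N. \<exists>v\<in>n. (v, g n) \<in> D)"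
  proof (rule hall_double_count[OF finN finD])
    fix n n' assume n: "n \<in> N" "n' \<in> N" "n \<noteq> n'"
    have MB: "{fst m, snd m} \<inter> Bs = {}" if "m \<in> M" for m using MXY[OF that] by auto
    have MM: "{fst m, snd m} \<inter> {fst m', snd m'} = {}" if "m \<in> M" "m' \<in> M" "m \<noteq> m'" for m m'
    proof -
      have "fst m \<noteq> fst m'" "snd m \<noteq> snd m'"
        using that M(2,3) by (auto dest: inj_onD)
      moreover have "fst m \<noteq> snd m'" "snd m \<noteq> fst m'"
        using MXY that(1,2) S(3) by (metis DiffD1 disjoint_iff)+
      ultimately show ?thesis by auto
    qed
    have Mx: "{fst m, snd m} \<inter> {x} = {}" if "m \<in> M" "x \<notin> K" for m
      using xM that by force
    show "n \<inter> n' = {}"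
      using N_cases[OF n(1)]
    proof (elim disjE bexE conjE)
      fix y assume y: "y \<in> Bs" "n = {y}"
      show ?thesis using N_cases[OF n(2)]
      proof (elim disjE bexE conjE)
        fix m' assume "m' \<in> M" "n' = {fst m', snd m'}"
        with MB[of m'] y show ?thesis by blast
      qed (use n(3) y Bs(2) in auto)
    next
      fix m assume m: "m \<in> M" "n = {fst m, snd m}"
      show ?thesis using N_cases[OF n(2)]
      proof (elim disjE bexE conjE)
        fix m' assume m': "m' \<in> M" "n' = {fst m', snd m'}"
        with m n(3) have "m \<noteq> m'" by blast
        with MM m m' show ?thesis by simp
      qed (use m MB[OF m(1)] Mx[OF m(1)] in auto)
    next
      assume x': "n = {x}" "x \<notin> K"
      show ?thesis using N_cases[OF n(2)]
      proof (elim disjE bexE conjE)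
        fix m' assume "m' \<in> M" "n' = {fst m', snd m'}"
        with Mx[of m'] x' show ?thesis by blast
      qed (use x' n(3) Bs(2) in auto)
    qed
  next
    fix n assume "n \<in> N"
    from N_cases[OF this] show "2 \<le> card {p \<in> D. fst p \<in> n}"
    proof (elim disjE bexE conjE)
      fix y assume "y \<in> Bs" "n = {y}"
      moreover have "y \<notin> fst ` M \<union> snd ` M" using MXY \<open>y \<in> Bs\<close> by auto
      ultimately show ?thesis using single Bs(1) by blast
    next
      fix m assume "m \<in> M" "n = {fst m, snd m}"
      then show ?thesis using double by simp
    next
      assume "n = {x}" "x \<notin> K"
      then show ?thesis using single x xM by simp
    qed
  next
    fix e
    show "card {p \<in> D. snd p = e} \<le> 2"
    proof (cases "e \<in> E")
      case True
      then obtain u v where uv: "{w \<in> T. adj e w} = {u, v}" using E by blast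
      have "{p \<in> D. snd p = e} \<subseteq> {(u, e), (v, e)}"
      proof
        fix p assume "p \<in> {p \<in> D. snd p = e}"
        then have "fst p \<in> T" "adj (fst p) e" "snd p = e" using ET by (auto simp: D_def)
        moreover have "fst p \<in> {w \<in> T. adj e w}" using calculation adj_sym by auto
        ultimately show "p \<in> {(u, e), (v, e)}" using uv by (cases p) auto
      qed
      then have "card {p \<in> D. snd p = e} \<le> card {(u, e), (v, e)}" by (intro card_mono) auto
      then show ?thesis by (simp add: card_insert_if split: if_splits)
    next
      case False
      then have "{p \<in> D. snd p = e} = {}" by (auto simp: D_def)
      then show ?thesis by (metis card.empty le0)
    qed
  qed
  then obtain g where g_inj: "inj_on g N" and g: "\<And>n. n \<in> N \<Longrightarrow> \<exists>v\<in>n. (v, g n) \<in> D" by blast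
  have NB: "{y} \<in> N" if "y \<in> Bs" for y using that by (auto simp: N_def)
  have NM: "{fst m, snd m} \<in> N" if "m \<in> M" for m using that by (auto simp: N_def)
  have WE: "W y \<inter> (X \<union> Y \<union> E) = {}" if "y \<in> Bs" for y using W[of y] that S(2) by (auto simp: Bs_def)

  define gB where "gB y = g {y}" for y
  define gM where "gM m = g {fst m, snd m}" for m
  have gB: "gB y \<in> E" "gB y \<notin> em ` M" "adj y (gB y)" if "y \<in> Bs" for y
    using g[OF NB[OF that]] by (auto simp: gB_def D_def)
  have gM: "gM m \<in> E" "gM m \<notin> em ` M" "adj (fst m) (gM m) \<or> adj (snd m) (gM m)" if "m \<in> M" for m
    using g[OF NM[OF that]] by (auto simp: gM_def D_def)
  have gBB: "gB y \<noteq> gB y'" if "y \<in> Bs" "y' \<in> Bs" "y \<noteq> y'" for y y'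
    using inj_onD[OF g_inj _ NB[OF that(1)] NB[OF that(2)]] that(3) unfolding gB_def by blast
  have gMM: "gM m \<noteq> gM m'" if "m \<in> M" "m' \<in> M" "m \<noteq> m'" for m m'
  proof
    assume "gM m = gM m'"
    then have "{fst m, snd m} = {fst m', snd m'}"
      using inj_onD[OF g_inj _ NM[OF that(1)] NM[OF that(2)]] unfolding gM_def by blast
    moreover have "fst m \<in> X" "fst m' \<in> X" "snd m \<in> Y" "snd m' \<in> Y" using MXY that by auto
    ultimately have "fst m = fst m'" using S(3) by (auto simp: doubleton_eq_iff)
    then show False using M(2) that by (auto dest: inj_onD)
  qed
  have gBM: "gB y \<noteq> gM m" if "y \<in> Bs" "m \<in> M" for y m
  proof
    assume "gB y = gM m"
    then have "{y} = {fst m, snd m}"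
      using inj_onD[OF g_inj _ NB[OF that(1)] NM[OF that(2)]] unfolding gB_def gM_def by blast
    then show False using MXY[OF that(2)] that(1) by auto
  qed

  have im: "fst ` M \<subseteq> X - Bs" "snd ` M \<subseteq> Y - Bs" "em ` M \<subseteq> E" "gM ` M \<subseteq> E" "gB ` Bs \<subseteq> E"
    using MXY em(1) gM(1) gB(1) by (simp_all add: image_subset_iff)
  have WB: "W y \<subseteq> T - S" "W y \<inter> R = {}" "y \<in> X \<union> Y" "y \<noteq> x" if "y \<in> Bs" for y
    using W[of y] that R by (auto simp: Bs_def)
  \<comment> \<open>\<open>T1\<close>, \<open>T2\<close> and later \<open>T3\<close> are the
    disjoint regions in which the three packings live.\<close>
  define T1 where "T1 = (\<Union>y\<in>Bs. insert y (W y)) \<union> gB ` Bs"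
  define T2 where "T2 = fst ` M \<union> snd ` M \<union> em ` M \<union> gM ` M"
  have "\<exists>P1. packing T1 P1 \<and> card P1 = card Bs"
  proof -
    define z where "z y = (SOME z. z \<in> W y \<and> adj y z \<and> (\<exists>w\<in>W y. adj z w))" for y
    define w where "w y = (SOME w. w \<in> W y \<and> adj (z y) w)" for y
    have z: "z y \<in> W y" "adj y (z y)" "\<exists>w\<in>W y. adj (z y) w" if "y \<in> Bs" for y
    proof -
      have "\<exists>z. z \<in> W y \<and> adj y z \<and> (\<exists>w\<in>W y. adj z w)" using that by (auto simp: Bs_def)
      from someI_ex[OF this] show "z y \<in> W y" "adj y (z y)" "\<exists>w\<in>W y. adj (z y) w"
        by (auto simp: z_def)
    qed
    have w: "w y \<in> W y" "adj (z y) (w y)" if "y \<in> Bs" for y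
    proof -
      have "\<exists>w. w \<in> W y \<and> adj (z y) w" using z[OF that] by auto
      from someI_ex[OF this] show "w y \<in> W y" "adj (z y) (w y)" by (auto simp: w_def)
    qed
    \<comment> \<open>The vertices w, z, y come from the definition of \<open>Bs\<close>; the fourth
      is the subdivision vertex assigned to y.\<close>
    define f where "f y = {w y, z y, y, gB y}" for y
    have "packing T1 (f ` Bs) \<and> card (f ` Bs) = card Bs"
    proof (rule packing_image[OF finS(4)])
      fix y assume y: "y \<in> Bs"
      have "y \<notin> W y" "gB y \<notin> W y" "y \<notin> E" using WE[OF y] Bs(1) y gB(1)[OF y] S by auto
      then have "p4 (w y) (z y) y (gB y)"
        using z[OF y] w[OF y] gB[OF y] adj_sym unfolding p4_def by metis
      moreover have "f y \<subseteq> T1" using z(1)[OF y] w(1)[OF y] y by (auto simp: f_def T1_def)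
      ultimately show "f y \<subseteq> T1 \<and> (\<exists>a b c d. f y = {a, b, c, d} \<and> p4 a b c d)"
        unfolding f_def by blast
    next
      fix y y' assume y: "y \<in> Bs" "y' \<in> Bs" "y \<noteq> y'"
      have fy: "f v \<subseteq> W v \<union> {v, gB v}" if "v \<in> Bs" for v using z(1) w(1) that by (auto simp: f_def)
      have "W y \<inter> W y' = {}" using W_disj[of y y'] y by (auto simp: Bs_def)
      moreover have "y \<notin> E" "y' \<notin> E" using y Bs(1) S by auto
      ultimately have "(W y \<union> {y, gB y}) \<inter> (W y' \<union> {y', gB y'}) = {}"
        using WE[OF y(1)] WE[OF y(2)] gB(1)[OF y(1)] gB(1)[OF y(2)] gBB[OF y] y Bs(1) by auto
      then show "f y \<inter> f y' = {}" using fy[OF y(1)] fy[OF y(2)] by blast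
    qed
    then show ?thesis by blast
  qed
  then obtain P1 where P1: "packing T1 P1" "card P1 = card Bs" by blast
  have "\<exists>P2. packing T2 P2 \<and> card P2 = card M"
  proof -
    \<comment> \<open>The matching edge of H contributes a path of three vertices, which
      \<open>gM m\<close> extends at whichever end it is adjacent to.\<close>
    define f where "f m = {fst m, snd m, em m, gM m}" for m
    have "packing T2 (f ` M) \<and> card (f ` M) = card M"
    proof (rule packing_image[OF finM])
      fix m assume m: "m \<in> M"
      have mm: "fst m \<in> X" "snd m \<in> Y" "fst m \<noteq> snd m" "fst m \<notin> E" "snd m \<notin> E" using MXY[OF m] S by auto
      have ne: "em m \<noteq> gM m" using gM(2)[OF m] imageI[OF m, of em] by metis
      have "\<exists>a b c d. f m = {a, b, c, d} \<and> p4 a b c d"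
        using gM(3)[OF m]
      proof
        assume "adj (fst m) (gM m)"
        then have "p4 (gM m) (fst m) (em m) (snd m)"
          using em[OF m] gM(1)[OF m] mm ne adj_sym unfolding p4_def by metis
        moreover have "f m = {gM m, fst m, em m, snd m}" by (auto simp: f_def)
        ultimately show ?thesis by blast
      next
        assume "adj (snd m) (gM m)"
        then have "p4 (gM m) (snd m) (em m) (fst m)"
          using em[OF m] gM(1)[OF m] mm ne adj_sym unfolding p4_def by metis
        moreover have "f m = {gM m, snd m, em m, fst m}" by (auto simp: f_def)
        ultimately show ?thesis by blast
      qed
      moreover have "f m \<subseteq> T2" using m by (auto simp: f_def T2_def)
      ultimately show "f m \<subseteq> T2 \<and> (\<exists>a b c d. f m = {a, b, c, d} \<and> p4 a b c d)" by blast
    next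
      fix m m' assume m: "m \<in> M" "m' \<in> M" "m \<noteq> m'"
      have "fst m \<noteq> fst m'" "snd m \<noteq> snd m'" using m M(2,3) by (auto dest: inj_onD)
      moreover have "fst m \<in> X" "snd m \<in> Y" "fst m' \<in> X" "snd m' \<in> Y" using MXY m by auto
      moreover have "em m \<in> E" "em m' \<in> E" "gM m \<in> E" "gM m' \<in> E" using em gM m by auto
      moreover have "em m \<noteq> em m'" "gM m \<noteq> gM m'" using em_inj[OF m(1,2)] gMM[OF m] m(3) by blast+
      moreover have "em m \<noteq> gM m'" "gM m \<noteq> em m'"
        using gM(2)[OF m(1)] gM(2)[OF m(2)] m(1,2) by (metis imageI)+
      ultimately show "f m \<inter> f m' = {}" using S(3-5) unfolding f_def by auto
    qed
    then show ?thesis by blast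
  qed
  then obtain P2 where P2: "packing T2 P2" "card P2 = card M" by blast

  have RS: "R \<inter> (X \<union> Y \<union> E) = {}" "R \<subseteq> T" using R S(2) by auto
  have T2_sub: "T2 \<subseteq> (X - Bs) \<union> (Y - Bs) \<union> E" using im by (auto simp: T2_def)
  have RT1: "R \<inter> T1 = {}" using RS WB im(5) by (fastforce simp: T1_def)
  have RT2: "R \<inter> T2 = {}" using RS(1) T2_sub by blast
  have xT: "x \<in> T" "x \<notin> R" "x \<notin> E" using x ET S RS by auto
  \<comment> \<open>Both cases are put into one statement. If x is in K, the transversal
    \<open>X3\<close> has to deal with R alone. Otherwise it must also hit the paths using x,
    including those that end with a step from x into the block.\<close>
  have "\<exists>P3 X3 T3. packing T3 P3 \<and> finite X3 \<and> card X3 \<le> card P3 \<and> T3 \<subseteq> T \<and> T3 \<inter> T1 = {} \<and> T3 \<inter> T2 = {} \<and>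
     (x \<in> K \<longrightarrow> hits R X3) \<and> (x \<notin> K \<longrightarrow> hits (insert x R) X3 \<and>
        (\<forall>a b e. p4 a b x e \<longrightarrow> a \<in> R \<longrightarrow> b \<in> R \<longrightarrow> e \<in> E \<longrightarrow> {a, b, x, e} \<inter> X3 \<noteq> {}))"
    (is "\<exists>P3 X3 T3. ?Q P3 X3 T3")
  proof (cases "x \<in> K")
    case True
    have "R \<subset> T" using xT RS by blast
    from IH[OF this] obtain P3 X3 where 3: "packing R P3" "hits R X3" "card X3 \<le> card P3" by (auto simp: konig_def)
    from 3 RT1 RT2 True show ?thesis using RS(2) by (intro exI[of _ P3] exI[of _ X3] exI[of _ R]) (auto simp: hits_def)
  next
    case False
    have xN: "{x} \<in> N" using False by (auto simp: N_def)
    define h where "h = g {x}"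
    have h: "h \<in> E" "h \<notin> em ` M" "adj x h" using g[OF xN] by (auto simp: h_def D_def)
    have hB: "h \<noteq> gB y" if "y \<in> Bs" for y
      using inj_onD[OF g_inj _ xN NB[OF that]] Bs(2) that unfolding h_def gB_def by blast
    have hM: "h \<noteq> gM m" if "m \<in> M" for m
      using inj_onD[OF g_inj _ xN NM[OF that]] xM False that unfolding h_def gM_def by blast
    define T3 where "T3 = insert x (insert h R)"
    \<comment> \<open>A second subdivision neighbour of x lies outside \<open>T3\<close>, so
      \<open>T3\<close> is smaller than T and the induction hypothesis applies.\<close>
    obtain e where "e \<in> E" "e \<noteq> h" using deg[OF x] by metis
    then have "e \<in> T - T3" using ET RS xT by (auto simp: T3_def)
    then have "T3 \<subset> T" using xT h ET RS by (auto simp: T3_def)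
    from IH[OF this] obtain P3 X0 where 3: "packing T3 P3" "hits T3 X0" "card X0 \<le> card P3" by (auto simp: konig_def)
    \<comment> \<open>The pendant vertex h stands for all subdivision neighbours of x at once:
      exchanging it for x makes \<open>X3\<close> hit every path a b x e, because a b x h was hit by
      \<open>X0\<close>.\<close>
    define X3 where "X3 = (if h \<in> X0 then insert x (X0 - {h}) else X0)"
    have finX0: "finite X0" using 3 by (simp add: hits_def)
    have "card (insert x (X0 - {h})) \<le> card X0" if "h \<in> X0"
    proof (rule card_insert_le_m1)
      show "0 < card X0" using finX0 that card_gt_0_iff by blast
    qed (use that in \<open>simp add: card_Diff_singleton\<close>)
    then have X3: "finite X3" "card X3 \<le> card P3"
      using finX0 3(3) by (auto simp: X3_def)
    have sw: "{a, b, x, d} \<inter> X3 \<noteq> {}" if "{a, b, x, h} \<inter> X0 \<noteq> {}" "a \<noteq> h" "b \<noteq> h" for a b d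
      using that by (auto simp: X3_def)
    have "hits (insert x R) X3"
    proof (rule hitsI[OF X3(1)])
      fix a b c d assume p: "p4 a b c d" "{a, b, c, d} \<subseteq> insert x R" "{a, b, c, d} \<inter> X3 = {}"
      have "h \<notin> {a, b, c, d}" using p(2) h(1) RS xT by auto
      then have "{a, b, c, d} \<inter> X0 = {}" using p(3) by (auto simp: X3_def split: if_splits)
      moreover have "{a, b, c, d} \<subseteq> T3" using p(2) by (auto simp: T3_def)
      ultimately show False using hitsD[OF 3(2) p(1)] by blast
    qed
    moreover have "{a, b, x, e} \<inter> X3 \<noteq> {}" if p: "p4 a b x e" "a \<in> R" "b \<in> R" "e \<in> E" for a b e
    proof -
      have hne: "a \<noteq> h" "b \<noteq> h" using p h(1) RS by auto
      then have "p4 a b x h" using p(1) h(3) by (auto simp: p4_def)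
      then have "{a, b, x, h} \<inter> X0 \<noteq> {}" using hitsD[OF 3(2)] p by (auto simp: T3_def)
      then show ?thesis using sw hne by blast
    qed
    moreover have "T3 \<inter> T1 = {}"
    proof -
      have "x \<notin> T1" using WB im(5) xT(3) x S(2) by (fastforce simp: T1_def)
      moreover have "h \<notin> T1" using hB h(1) WB S(2,4,5) by (fastforce simp: T1_def)
      moreover note RT1
      ultimately show ?thesis by (auto simp: T3_def)
    qed
    moreover have "T3 \<inter> T2 = {}"
    proof -
      have "x \<notin> T2" using xM False xT(3) im(3,4) unfolding T2_def by blast
      moreover have "h \<notin> gM ` M" using hM by (metis imageE)
      then have "h \<notin> T2" using h im(1,2) S(4,5) unfolding T2_def by blast
      moreover note RT2
      ultimately show ?thesis by (auto simp: T3_def)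
    qed
    ultimately show ?thesis using False 3(1) X3 \<open>T3 \<subset> T\<close>
      by (intro exI[of _ P3] exI[of _ X3] exI[of _ T3]) auto
  qed
  then obtain P3 X3 T3 where Q: "?Q P3 X3 T3" by (elim exE)
  then have P3: "packing T3 P3" and X3: "finite X3" "card X3 \<le> card P3"
    and T3: "T3 \<subseteq> T" "T3 \<inter> T1 = {}" "T3 \<inter> T2 = {}"
    and hit1: "x \<in> K \<Longrightarrow> hits R X3" and hit2: "x \<notin> K \<Longrightarrow> hits (insert x R) X3"
    by simp_all
  have hit3: "{a, b, x, e} \<inter> X3 \<noteq> {}" if "x \<notin> K" "p4 a b x e" "a \<in> R" "b \<in> R" "e \<in> E" for a b e
    using Q that by meson

  have T12: "T1 \<inter> T2 = {}"
  proof -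
    have "v \<notin> T2" if "y \<in> Bs" "v \<in> insert y (W y)" for v y
      using that(2) WB[OF that(1)] that(1) T2_sub S(2,4,5) by auto
    moreover have "gB y \<notin> T2" if "y \<in> Bs" for y
    proof -
      have "gB y \<notin> gM ` M" using gBM[OF that] by (metis imageE)
      then show ?thesis using gB(1,2)[OF that] im(1,2) S(4,5) unfolding T2_def by blast
    qed
    ultimately show ?thesis by (auto simp: T1_def)
  qed
  have "insert y (W y) \<subseteq> T" if "y \<in> Bs" for y using WB[OF that] ET by blast
  moreover have "gB ` Bs \<subseteq> T" using im(5) ET(1) by (rule subset_trans)
  ultimately have T12T: "T1 \<subseteq> T" "T2 \<subseteq> T"
    unfolding T1_def by (simp add: UN_least) (use T2_sub ET in blast)
  have P12: "packing (T1 \<union> T2) (P1 \<union> P2)" "card (P1 \<union> P2) = card Bs + card M"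
    using packing_Un[OF P1(1) P2(1) T12] P1(2) P2(2) by auto
  have "(T1 \<union> T2) \<inter> T3 = {}" using T3 by blast
  from packing_Un[OF P12(1) P3 this] P12(2)
  have P: "packing (T1 \<union> T2 \<union> T3) (P1 \<union> P2 \<union> P3)" "card (P1 \<union> P2 \<union> P3) = card Bs + card M + card P3"
    by auto
  define Z where "Z = Bs \<union> K \<union> X3"
  have "hits T Z"
  proof (rule hitsI)
    show "finite Z" using finS K X3 by (simp add: Z_def)
    fix a b c d assume p0: "p4 a b c d" "{a, b, c, d} \<subseteq> T" "{a, b, c, d} \<inter> Z = {}"
    \<comment> \<open>A path with a subdivision vertex in its interior passes over an edge of H.
      That edge has an end in \<open>Bs\<close> or, belonging to F, in K.\<close>
    have Eend: False if "e \<in> E" "adj p e" "adj e q" "p \<noteq> q" "p \<in> T - Z" "q \<in> T - Z" for p q e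
    proof -
      obtain u v where uv: "u \<in> X" "v \<in> Y" "{w \<in> T. adj e w} = {u, v}" using E[OF \<open>e \<in> E\<close>] by blast
      have "{p, q} \<subseteq> {w \<in> T. adj e w}" using that(2,3,5,6) adj_sym[OF that(2)] by simp
      then have "p = u \<and> q = v \<or> p = v \<and> q = u" using uv(3) that(4) by auto
      then have "u \<notin> Z" "v \<notin> Z" using that(5,6) by auto
      have "u \<in> {w \<in> T. adj e w}" "v \<in> {w \<in> T. adj e w}" unfolding uv(3) by auto
      then have "adj e u" "adj e v" by auto
      then have "(u, v) \<in> F"
        using uv(1,2) that(1) \<open>u \<notin> Z\<close> \<open>v \<notin> Z\<close> by (auto simp: F_def Z_def)
      then show False using cov \<open>u \<notin> Z\<close> \<open>v \<notin> Z\<close> by (auto simp: Z_def)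
    qed
    \<comment> \<open>Either the path stays in W y + y, which is free of 4-paths, or its third
      vertex is y and its first two lie in W y, and then y belongs to \<open>Bs\<close>.\<close>
    have inW: False if p: "p4 a b c d" "{a, b, c, d} \<subseteq> T" "{a, b, c, d} \<inter> Z = {}"
      and y: "y \<in> X \<union> Y - {x}" "b \<in> W y" for a b c d y
    proof -
      have ad: "adj b a" "adj b c" "adj c d" "adj a b" "a \<noteq> c" using p(1) adj_sym by (auto simp: p4_def)
      have "a \<in> insert y (W y)" "c \<in> insert y (W y)" using W_nbr[OF y] p(2) ad by auto
      consider "c \<in> W y" | "c = y" using \<open>c \<in> insert y (W y)\<close> by blast
      then show False
      proof cases
        case 1
        then have "d \<in> insert y (W y)" using W_nbr[OF y(1)] ad(3) p(2) by auto
        then have "{a, b, c, d} \<subseteq> insert y (W y)" using \<open>a \<in> insert y (W y)\<close> 1 y(2) by auto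
        then show False using W_free[OF y(1)] has_p4I[OF p(1)] by blast
      next
        case 2
        then have "a \<in> W y" using \<open>a \<in> insert y (W y)\<close> ad(5) by auto
        then have "y \<in> Bs" using y ad 2 adj_sym unfolding Bs_def by blast
        then show False using p(3) 2 by (auto simp: Z_def)
      qed
    qed
    \<comment> \<open>The only way out of R + x is a path a b x d with d in the block; d is then a
      subdivision vertex and \<open>hit3\<close> applies.\<close>
    have inR: False if p: "p4 a b c d" "{a, b, c, d} \<subseteq> T" "{a, b, c, d} \<inter> Z = {}"
      and b: "b \<in> R" for a b c d
    proof -
      have ad: "adj b a" "adj b c" "adj c d" "adj a b" "a \<noteq> c" "a \<noteq> d" "b \<noteq> d" using p(1) adj_sym by (auto simp: p4_def)
      have "a \<in> T" "c \<in> T" using p(2) by auto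
      then have a: "a \<in> insert x R" "c \<in> insert x R"
        using R_nbr[OF b, of a] R_nbr[OF b, of c] ad(1,2) by blast+
      have pX3: "{a, b, c, d} \<inter> X3 = {}" using p(3) by (auto simp: Z_def)
      have xK: "x \<notin> K" if "x \<in> {a, b, c, d}" using p(3) that by (auto simp: Z_def)
      have all: False if "{a, b, c, d} \<subseteq> insert x R"
      proof (cases "x \<in> {a, b, c, d}")
        case True
        show False by (rule hitsD[OF hit2[OF xK[OF True]] p(1) that pX3])
      next
        case False
        then have "{a, b, c, d} \<subseteq> R" using that by auto
        then show False using hitsD[OF hit1 p(1) _ pX3] hitsD[OF hit2 p(1) that pX3] by blast
      qed
      show False
      proof (cases "c \<in> R")
        case True
        then have "d \<in> insert x R" using R_nbr[OF True] ad(3) p(2) by auto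
        then show False using all a b by auto
      next
        case False
        then have c: "c = x" using a by auto
        then have aR: "a \<in> R" using a ad by auto
        show False
        proof (cases "d \<in> R")
          case True
          then show False using all a b by auto
        next
          case dR: False
          have dT: "d \<in> T" using p(2) by auto
          have "d \<notin> W y" if "y \<in> X \<union> Y - {x}" for y
            using W_nbr[OF that, of d x] W[OF that] ad(3) adj_sym c that xT x S(2) by blast
          then have "d \<in> S" using dR dT R by auto
          then have "d \<in> E" using edges[of x d] x xT ad(3) c S(2) by auto
          then show False using hit3[of a b d] xK p(1) c aR b pX3 by auto
        qed
      qed
    qed
    have mid: "b \<notin> E \<and> b \<notin> R \<and> (\<forall>y\<in>X \<union> Y - {x}. b \<notin> W y)"
      if p: "p4 a b c d" "{a, b, c, d} \<subseteq> T" "{a, b, c, d} \<inter> Z = {}" for a b c d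
    proof -
      have "b \<notin> E" using Eend[of b a c] p by (auto simp: p4_def)
      then show ?thesis using inR[OF p] inW[OF p] by blast
    qed
    \<comment> \<open>Reversal gives the same information about the third vertex. Both inner
      vertices would be vertices of H, but these are pairwise non-adjacent.\<close>
    have q0: "p4 d c b a" "{d, c, b, a} \<subseteq> T" "{d, c, b, a} \<inter> Z = {}" using p4_rev p0 by auto
    have "b \<in> X \<union> Y" "c \<in> X \<union> Y" using mid[OF p0] mid[OF q0] p0(2) R S(2) by auto
    then show False using edges[of b c] p0(1) S by (auto simp: p4_def)
  qed
  moreover have "card Z \<le> card Bs + card M + card P3"
    unfolding Z_def using card_Un_le[of "Bs \<union> K" X3] card_Un_le[of Bs K] K(2) X3(2) by linarith
  moreover have "packing T (P1 \<union> P2 \<union> P3)"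
    by (rule packing_mono[OF P(1)]) (use T12T T3 in auto)
  ultimately show ?thesis using P(2) unfolding konig_def by metis
qed

subsection \<open>The admissible blocks\<close>

text \<open>That \<open>{w \<in> T. adj e w}\<close> ranges over all of \<open>T\<close> encodes that no subdivision vertex is
  a cutvertex.\<close>

definition subdiv_block :: "'a set \<Rightarrow> 'a set \<Rightarrow> bool" where
  "subdiv_block T S \<longleftrightarrow> (\<exists>X Y E. S = X \<union> Y \<union> E \<and> X \<inter> Y = {} \<and> X \<inter> E = {} \<and> Y \<inter> E = {} \<and>
     (\<forall>u\<in>S. \<forall>v\<in>S. adj u v \<longrightarrow> (u \<in> E \<longleftrightarrow> v \<notin> E)) \<and>
     (\<forall>e\<in>E. \<exists>u\<in>X. \<exists>v\<in>Y. {w \<in> T. adj e w} = {u, v}))"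

text \<open>Any vertex of the clique may be named a, so the last condition says that S contains at
  most one cutvertex, which is the endblock condition.\<close>

definition K4_block :: "'a set \<Rightarrow> 'a set \<Rightarrow> bool" where
  "K4_block T S \<longleftrightarrow> (\<exists>a b c d. S = {a, b, c, d} \<and> distinct [a, b, c, d] \<and>
     (\<forall>u\<in>S. \<forall>v\<in>S. u \<noteq> v \<longrightarrow> adj u v) \<and> attach T S \<subseteq> {a})"

text \<open>The two vertices of degree two are q and r; by symmetry the possible cutvertex is the
  one named q.\<close>

definition T2_block :: "'a set \<Rightarrow> 'a set \<Rightarrow> bool" where
  "T2_block T S \<longleftrightarrow> (\<exists>a b q r. S = {a, b, q, r} \<and> distinct [a, b, q, r] \<and>
     adj a b \<and> adj a q \<and> adj a r \<and> adj b q \<and> adj b r \<and> \<not> adj q r \<and> attach T S \<subseteq> {q})"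

text \<open>The last condition is vacuous if \<open>b\<close> is not attached to anything outside \<open>S\<close>, so it also
  covers blocks with fewer than two cutvertices.\<close>

definition T_block :: "'a set \<Rightarrow> 'a set \<Rightarrow> bool" where
  "T_block T S \<longleftrightarrow> (\<exists>a b Q. S = insert a (insert b Q) \<and> a \<notin> Q \<and> b \<notin> Q \<and> Q \<noteq> {} \<and> adj a b \<and>
     (\<forall>q\<in>Q. adj a q \<and> adj b q) \<and> (\<forall>q\<in>Q. \<forall>r\<in>Q. \<not> adj q r) \<and> attach T S \<subseteq> {a, b} \<and>
     (\<forall>y\<in>T - S. adj b y \<longrightarrow> (\<forall>w\<in>T. adj y w \<longrightarrow> w = b)))"

definition admissible :: "'a set \<Rightarrow> bool" where
  "admissible T \<longleftrightarrow> (\<forall>S. max_biconn T S \<longrightarrow> 3 \<le> card S \<longrightarrow> subdiv_block T S \<or> K4_block T S \<or> T2_block T S \<or> T_block T S)"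

lemma subdiv_blockE:
  assumes "subdiv_block T S"
  obtains X Y E where "S = X \<union> Y \<union> E" "X \<inter> Y = {}" "X \<inter> E = {}" "Y \<inter> E = {}"
    "\<And>u v. u \<in> S \<Longrightarrow> v \<in> S \<Longrightarrow> adj u v \<Longrightarrow> u \<in> E \<longleftrightarrow> v \<notin> E"
    "\<And>e. e \<in> E \<Longrightarrow> \<exists>u\<in>X. \<exists>v\<in>Y. {w \<in> T. adj e w} = {u, v}"
proof -
  from assms obtain X Y E where "S = X \<union> Y \<union> E" "X \<inter> Y = {}" "X \<inter> E = {}" "Y \<inter> E = {}"
    and *: "\<forall>u\<in>S. \<forall>v\<in>S. adj u v \<longrightarrow> (u \<in> E \<longleftrightarrow> v \<notin> E)"
    "\<forall>e\<in>E. \<exists>u\<in>X. \<exists>v\<in>Y. {w \<in> T. adj e w} = {u, v}"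
    unfolding subdiv_block_def by (elim exE conjE) (rule that)
  show thesis
  proof (rule that)
    show "u \<in> E \<longleftrightarrow> v \<notin> E" if "u \<in> S" "v \<in> S" "adj u v" for u v
      using bspec[OF bspec[OF *(1) that(1)] that(2)] that(3) by (rule mp)
    show "\<exists>u\<in>X. \<exists>v\<in>Y. {w \<in> T. adj e w} = {u, v}" if "e \<in> E" for e
      using *(2) that by (rule bspec)
  qed fact+
qed

lemma subdiv_blockI:
  assumes "S = X \<union> Y \<union> E" "X \<inter> Y = {}" "X \<inter> E = {}" "Y \<inter> E = {}"
    "\<And>u v. u \<in> S \<Longrightarrow> v \<in> S \<Longrightarrow> adj u v \<Longrightarrow> u \<in> E \<longleftrightarrow> v \<notin> E"
    "\<And>e. e \<in> E \<Longrightarrow> \<exists>u\<in>X. \<exists>v\<in>Y. {w \<in> T. adj e w} = {u, v}"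
  shows "subdiv_block T S"
  unfolding subdiv_block_def using assms
  by (intro exI[of _ X] exI[of _ Y] exI[of _ E] conjI ballI impI) assumption+

lemma K4_blockE:
  assumes "K4_block T S"
  obtains a b c d where "S = {a, b, c, d}" "distinct [a, b, c, d]"
    "\<And>u v. u \<in> S \<Longrightarrow> v \<in> S \<Longrightarrow> u \<noteq> v \<Longrightarrow> adj u v" "attach T S \<subseteq> {a}"
proof -
  from assms obtain a b c d where *: "S = {a, b, c, d}" "distinct [a, b, c, d]" "attach T S \<subseteq> {a}"
    "\<forall>u\<in>S. \<forall>v\<in>S. u \<noteq> v \<longrightarrow> adj u v"
    unfolding K4_block_def by (elim exE conjE) (rule that)
  show thesis
  proof (rule that[OF *(1,2) _ *(3)])
    show "adj u v" if "u \<in> S" "v \<in> S" "u \<noteq> v" for u v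
      using bspec[OF bspec[OF *(4) that(1)] that(2)] that(3) by (rule mp)
  qed
qed

lemma K4_blockI:
  assumes "S = {a, b, c, d}" "distinct [a, b, c, d]"
    "\<And>u v. u \<in> S \<Longrightarrow> v \<in> S \<Longrightarrow> u \<noteq> v \<Longrightarrow> adj u v" "attach T S \<subseteq> {a}"
  shows "K4_block T S"
  unfolding K4_block_def using assms
  by (intro exI[of _ a] exI[of _ b] exI[of _ c] exI[of _ d] conjI ballI impI) assumption+

lemma T2_blockE:
  assumes "T2_block T S"
  obtains a b q r where "S = {a, b, q, r}" "distinct [a, b, q, r]"
    "adj a b" "adj a q" "adj a r" "adj b q" "adj b r" "\<not> adj q r" "attach T S \<subseteq> {q}"
  using assms unfolding T2_block_def by (elim exE conjE) (rule that)

lemma T2_blockI: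
  assumes "S = {a, b, q, r}" "distinct [a, b, q, r]"
    "adj a b" "adj a q" "adj a r" "adj b q" "adj b r" "\<not> adj q r" "attach T S \<subseteq> {q}"
  shows "T2_block T S"
  unfolding T2_block_def using assms
  by (intro exI[of _ a] exI[of _ b] exI[of _ q] exI[of _ r] conjI)

lemma T_blockE:
  assumes "T_block T S"
  obtains a b Q where "S = insert a (insert b Q)" "a \<notin> Q" "b \<notin> Q" "Q \<noteq> {}" "adj a b"
    "\<And>q. q \<in> Q \<Longrightarrow> adj a q" "\<And>q. q \<in> Q \<Longrightarrow> adj b q"
    "\<And>q r. q \<in> Q \<Longrightarrow> r \<in> Q \<Longrightarrow> \<not> adj q r" "attach T S \<subseteq> {a, b}"
    "\<And>y w. y \<in> T - S \<Longrightarrow> adj b y \<Longrightarrow> w \<in> T \<Longrightarrow> adj y w \<Longrightarrow> w = b"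
proof -
  from assms obtain a b Q where *: "S = insert a (insert b Q)" "a \<notin> Q" "b \<notin> Q" "Q \<noteq> {}" "adj a b"
    "attach T S \<subseteq> {a, b}" "\<forall>q\<in>Q. adj a q \<and> adj b q" "\<forall>q\<in>Q. \<forall>r\<in>Q. \<not> adj q r"
    "\<forall>y\<in>T - S. adj b y \<longrightarrow> (\<forall>w\<in>T. adj y w \<longrightarrow> w = b)"
    unfolding T_block_def by (elim exE conjE) (rule that)
  show thesis
    by (rule that[OF *(1-5) _ _ _ *(6)]) (use *(7-9) in simp_all)
qed

lemma T_blockI:
  assumes "S = insert a (insert b Q)" "a \<notin> Q" "b \<notin> Q" "Q \<noteq> {}" "adj a b"
    "\<And>q. q \<in> Q \<Longrightarrow> adj a q" "\<And>q. q \<in> Q \<Longrightarrow> adj b q"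
    "\<And>q r. q \<in> Q \<Longrightarrow> r \<in> Q \<Longrightarrow> \<not> adj q r" "attach T S \<subseteq> {a, b}"
    "\<And>y w. y \<in> T - S \<Longrightarrow> adj b y \<Longrightarrow> w \<in> T \<Longrightarrow> adj y w \<Longrightarrow> w = b"
  shows "T_block T S"
  unfolding T_block_def using assms
  by (intro exI[of _ a] exI[of _ b] exI[of _ Q] conjI ballI impI) assumption+

lemma max_biconnD:
  assumes "max_biconn T S"
  shows "S \<subseteq> T" "biconn S" "S \<subseteq> S' \<Longrightarrow> S' \<subseteq> T \<Longrightarrow> biconn S' \<Longrightarrow> S' = S"
  using assms unfolding max_biconn_def by simp_all

section \<open>Restriction of blocks and of admissibility to induced subgraphs\<close>

lemma biconn_hubs:
  assumes "h \<in> A" "k \<in> A" "h \<noteq> k" "\<And>v. v \<in> A \<Longrightarrow> v = h \<or> adj v h" "\<And>v. v \<in> A \<Longrightarrow> v = k \<or> adj v k"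
  shows "biconn A"
proof -
  have "conn (A - {x})" for x
  proof (cases "x = h")
    case True
    then show ?thesis using assms by (intro conn_hub[of k]) auto
  next
    case False
    then show ?thesis using assms by (intro conn_hub[of h]) auto
  qed
  moreover have "conn A" using assms by (intro conn_hub[of h]) auto
  ultimately show ?thesis by (simp add: biconn_def)
qed

text \<open>If the trace of the old block is still biconnected, maximality of \<open>S'\<close>
  makes it the new block. Vertices of \<open>T'\<close> outside the new block were outside the old
  one, so no attachment vertices arise.\<close>

lemma max_biconn_restrict:
  assumes "max_biconn T S" "T' \<subseteq> T" "max_biconn T' S'" "S' \<subseteq> S" "biconn (S \<inter> T')"
  shows "S' = S \<inter> T'" "attach T' S' \<subseteq> attach T S"
proof -
  show 1: "S' = S \<inter> T'"
    using max_biconnD(1)[OF assms(3)] assms(4) max_biconnD(3)[OF assms(3) _ _ assms(5)] by simp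
  show "attach T' S' \<subseteq> attach T S" using assms(2) unfolding attach_def 1 by auto
qed

lemma attach_sub: "attach T S \<subseteq> S"
  by (auto simp: attach_def)

lemma attachI: "x \<in> S \<Longrightarrow> y \<in> T \<Longrightarrow> y \<notin> S \<Longrightarrow> adj x y \<Longrightarrow> x \<in> attach T S"
  by (auto simp: attach_def)

text \<open>A subdivision vertex in \<open>S'\<close> has two neighbours in \<open>S'\<close> and
  only two in T. So both its ends survive, and the three classes are simply intersected with
  \<open>S'\<close>.\<close>

lemma subdiv_block_restrict:
  assumes t: "subdiv_block T S" and T: "finite T" "T' \<subseteq> T" and S: "max_biconn T' S'" "S' \<subseteq> S" "3 \<le> card S'"
  shows "subdiv_block T' S'"
proof -
  obtain X Y E where S_eq: "S = X \<union> Y \<union> E" and d: "X \<inter> Y = {}" "X \<inter> E = {}" "Y \<inter> E = {}"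
    and ed: "\<And>u v. u \<in> S \<Longrightarrow> v \<in> S \<Longrightarrow> adj u v \<Longrightarrow> u \<in> E \<longleftrightarrow> v \<notin> E"
    and E: "\<And>e. e \<in> E \<Longrightarrow> \<exists>u\<in>X. \<exists>v\<in>Y. {w \<in> T. adj e w} = {u, v}"
    using t by (rule subdiv_blockE) (rule that)
  have bi: "biconn S'" "finite S'" "S' \<subseteq> T'"
    using S T finite_subset unfolding max_biconn_def by (auto intro: finite_subset)
  have "\<exists>u\<in>X \<inter> S'. \<exists>v\<in>Y \<inter> S'. {w \<in> T'. adj e w} = {u, v}" if e: "e \<in> E \<inter> S'" for e
  proof -
    obtain u v where uv: "u \<in> X" "v \<in> Y" "{w \<in> T. adj e w} = {u, v}" using E e by blast
    obtain p q where pq: "p \<in> S'" "q \<in> S'" "p \<noteq> q" "adj e p" "adj e q"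
      using biconn_two_nbrs[OF bi(1,2) S(3)] e by blast
    then have "p \<in> {w \<in> T. adj e w}" "q \<in> {w \<in> T. adj e w}" using bi T by auto
    then have "u \<in> S'" "v \<in> S'" using uv(3) pq by auto
    moreover have "{w \<in> T'. adj e w} = {u, v}"
    proof
      show "{w \<in> T'. adj e w} \<subseteq> {u, v}" using uv(3) T(2) by blast
      have "adj e u" "adj e v" using uv(3) by blast+
      then show "{u, v} \<subseteq> {w \<in> T'. adj e w}" using \<open>u \<in> S'\<close> \<open>v \<in> S'\<close> bi by auto
    qed
    ultimately show ?thesis using uv by blast
  qed
  moreover have "S' = X \<inter> S' \<union> Y \<inter> S' \<union> E \<inter> S'" using S_eq S(2) by blast
  moreover have "u \<in> E \<inter> S' \<longleftrightarrow> v \<notin> E \<inter> S'" if "u \<in> S'" "v \<in> S'" "adj u v" for u v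
    using ed[of u v] S(2) that by blast
  moreover have "(X \<inter> S') \<inter> (Y \<inter> S') = {}" "(X \<inter> S') \<inter> (E \<inter> S') = {}" "(Y \<inter> S') \<inter> (E \<inter> S') = {}"
    using d by blast+
  ultimately show ?thesis by (intro subdiv_blockI)
qed

text \<open>This is T(1): b has no neighbour outside S, so the condition on its outside neighbours
  is vacuous.\<close>

lemma T_block_triangle:
  assumes "S = {a, b, q}" "adj a b" "adj a q" "adj b q" "attach T S \<subseteq> {a}"
  shows "T_block T S"
proof -
  have "b \<notin> attach T S" using assms adj_irrefl by auto
  then have "\<not> adj b y" if "y \<in> T - S" for y using that assms(1) attachI[of b S y T] by auto
  moreover have "a \<noteq> q" "b \<noteq> q" using assms adj_irrefl by auto
  ultimately show ?thesis
    by (intro T_blockI[of S a b "{q}"]) (use assms adj_irrefl in auto)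
qed

lemma attach_eq_sub:
  assumes "x \<in> S" "attach T S \<subseteq> {x}"
  shows "sealed (T - {x}) (S - {x})"
  unfolding sealed_def using assms attachI by blast

lemma card3_sub4:
  assumes "S' \<subseteq> {a, b, c, d}" "3 \<le> card S'" "distinct [a, b, c, d]"
  shows "S' = {a, b, c, d} \<or> S' = {b, c, d} \<or> S' = {a, c, d} \<or> S' = {a, b, d} \<or> S' = {a, b, c}"
proof (cases "S' = {a, b, c, d}")
  case False
  then obtain z where z: "z \<in> {a, b, c, d}" "z \<notin> S'" using assms(1) by blast
  then have sub: "S' \<subseteq> {a, b, c, d} - {z}" using assms(1) by blast
  have "card ({a, b, c, d} - {z}) = 3" using z assms(3) by (subst card_Diff_singleton) auto
  then have "S' = {a, b, c, d} - {z}"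
    using sub assms(2) by (intro card_seteq) auto
  then show ?thesis using z assms(3) by auto
qed simp

text \<open>A block \<open>S'\<close> of \<open>T'\<close> lies in a block S of T. In the three
  types with triangles, two vertices of \<open>S'\<close> are adjacent to all other vertices of S,
  so the trace of S is biconnected and equals \<open>S'\<close>. It remains to recognise it: the
  four-vertex types may shrink to triangles, T(p) to a smaller T(p).\<close>

lemma admissible_mono:
  assumes c: "admissible T" and T: "finite T" "T' \<subseteq> T"
  shows "admissible T'"
  unfolding admissible_def
proof (intro allI impI)
  fix S' assume S': "max_biconn T' S'" "3 \<le> card S'"
  then have bi: "biconn S'" "S' \<subseteq> T'" by (auto simp: max_biconn_def)
  have fS': "finite S'" using bi T by (meson finite_subset)
  obtain S where S: "S' \<subseteq> S" "max_biconn T S"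
    using biconn_extend[OF T(1) bi(1)] bi(2) T(2) by blast
  have ST: "S \<subseteq> T" using S by (simp add: max_biconn_def)
  have fS: "finite S" using ST T by (meson finite_subset)
  have "3 \<le> card S" using S' S card_mono[OF fS S(1)] by linarith
  then consider "subdiv_block T S" | "K4_block T S" | "T2_block T S" | "T_block T S" using c S unfolding admissible_def by blast
  then show "subdiv_block T' S' \<or> K4_block T' S' \<or> T2_block T' S' \<or> T_block T' S'"
  proof cases
    case 1
    then show ?thesis using subdiv_block_restrict[OF 1 T S'(1) S(1) S'(2)] by blast
  next
    case 2
    then obtain a b c d where S4: "S = {a, b, c, d}" "distinct [a, b, c, d]"
      and cl: "\<And>u v. u \<in> S \<Longrightarrow> v \<in> S \<Longrightarrow> u \<noteq> v \<Longrightarrow> adj u v" and at: "attach T S \<subseteq> {a}"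
      by (rule K4_blockE) (rule that)
    have "card S' \<noteq> 0" "card S' \<noteq> 1" using S' by auto
    then obtain h k where hk: "h \<in> S'" "k \<in> S'" "h \<noteq> k"
      by (metis card_0_eq card_1_singletonE fS' is_singletonI' is_singleton_altdef ex_in_conv)
    have "biconn (S \<inter> T')"
      by (rule biconn_hubs[of h _ k]) (use hk bi S cl in auto)
    note r = max_biconn_restrict[OF S(2) T(2) S'(1) S(1) this]
    have at': "attach T' S' \<subseteq> {a}" using r(2) at by blast
    have "S' \<subseteq> {a, b, c, d}" using S(1) S4(1) by simp
    from card3_sub4[OF this S'(2) S4(2)]
    consider "S' = {a, b, c, d}" | "S' = {b, c, d}" | "S' = {a, c, d}" | "S' = {a, b, d}" | "S' = {a, b, c}"
      by (elim disjE)
    then show ?thesis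
    proof cases
      case 1
      then have "S' = S" using S4(1) by simp
      then have "K4_block T' S'" using 1 S4(2) cl at' by (intro K4_blockI[of _ a b c d]) simp_all
      then show ?thesis by blast
    next
      case 2
      then have "attach T' S' \<subseteq> {b}" using at' attach_sub[of T' S'] S4(2) by auto
      then have "T_block T' S'" using 2 S4 cl by (intro T_block_triangle[of _ b c d]) auto
      then show ?thesis by blast
    next
      case 3
      then have "T_block T' S'" using at' S4 cl by (intro T_block_triangle[of _ a c d]) auto
      then show ?thesis by blast
    next
      case 4
      then have "T_block T' S'" using at' S4 cl by (intro T_block_triangle[of _ a b d]) auto
      then show ?thesis by blast
    next
      case 5
      then have "T_block T' S'" using at' S4 cl by (intro T_block_triangle[of _ a b c]) auto
      then show ?thesis by blast
    qed
  next
    case 3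
    then obtain a b q r where S4: "S = {a, b, q, r}" "distinct [a, b, q, r]"
      and e: "adj a b" "adj a q" "adj a r" "adj b q" "adj b r" "\<not> adj q r" and at: "attach T S \<subseteq> {q}"
      by (rule T2_blockE) (rule that)
    have e': "adj b a" "adj q a" "adj r a" "adj q b" "adj r b" "\<not> adj r q" using e adj_sym by blast+
    \<comment> \<open>Having three vertices, \<open>S'\<close> contains q or r. Such a vertex has
      two neighbours in \<open>S'\<close>, which can only be a and b.\<close>
    have ab: "a \<in> S' \<and> b \<in> S'"
    proof -
      have "q \<in> S' \<or> r \<in> S'"
      proof (rule ccontr)
        assume "\<not> ?thesis"
        then have "S' \<subseteq> {a, b}" using S S4 by auto
        then have "card S' \<le> card {a, b}" by (intro card_mono) auto
        then show False using S'(2) by (simp add: card_insert_if split: if_splits)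
      qed
      then obtain v where v: "v \<in> S'" "v = q \<or> v = r" by blast
      obtain x y where "x \<in> S'" "y \<in> S'" "x \<noteq> y" "adj v x" "adj v y"
        using biconn_two_nbrs[OF bi(1) fS' S'(2) v(1)] by blast
      then show ?thesis using v(2) S(1) S4(1) e e' adj_irrefl by auto
    qed
    have "biconn (S \<inter> T')"
      by (rule biconn_hubs[of a _ b]) (use ab bi e e' S4 in auto)
    note r = max_biconn_restrict[OF S(2) T(2) S'(1) S(1) this]
    have at': "attach T' S' \<subseteq> {q}" using r(2) at by blast
    from card3_sub4[OF _ S'(2) S4(2)] S(1) S4(1) ab S4(2)
    consider "S' = {a, b, q, r}" | "S' = {a, b, r}" | "S' = {a, b, q}"
      by auto
    then show ?thesis
    proof cases
      case 1
      then have "T2_block T' S'" using S4(2) e at' by (intro T2_blockI[of _ a b q r])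
      then show ?thesis by blast
    next
      case 2
      then have "attach T' S' \<subseteq> {a}" using at' attach_sub[of T' S'] S4(2) by auto
      then have "T_block T' S'" using 2 e by (intro T_block_triangle[of _ a b r]) auto
      then show ?thesis by blast
    next
      case 3
      then have "T_block T' S'" using at' e e' by (intro T_block_triangle[of _ q a b]) auto
      then show ?thesis by blast
    qed
  next
    case 4
    then obtain a b Q where S4: "S = insert a (insert b Q)" "a \<notin> Q" "b \<notin> Q"
      and e: "adj a b" "\<And>q. q \<in> Q \<Longrightarrow> adj a q" "\<And>q. q \<in> Q \<Longrightarrow> adj b q"
      and Q: "\<And>q r. q \<in> Q \<Longrightarrow> r \<in> Q \<Longrightarrow> \<not> adj q r" and at: "attach T S \<subseteq> {a, b}"
      and pe: "\<And>y w. y \<in> T - S \<Longrightarrow> adj b y \<Longrightarrow> w \<in> T \<Longrightarrow> adj y w \<Longrightarrow> w = b"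
      by (rule T_blockE) (rule that)
    have e': "adj b a" "\<And>q. q \<in> Q \<Longrightarrow> adj q a" "\<And>q. q \<in> Q \<Longrightarrow> adj q b" using e adj_sym by blast+
    have "\<exists>q. q \<in> S' \<inter> Q"
    proof (rule ccontr)
      assume "\<not> ?thesis"
      then have "S' \<subseteq> {a, b}" using S S4 by auto
      then have "card S' \<le> card {a, b}" by (intro card_mono) auto
      then show False using S'(2) by (simp add: card_insert_if split: if_splits)
    qed
    then obtain v where v: "v \<in> S'" "v \<in> Q" by blast
    obtain x y where "x \<in> S'" "y \<in> S'" "x \<noteq> y" "adj v x" "adj v y"
      using biconn_two_nbrs[OF bi(1) fS' S'(2) v(1)] by blast
    then have ab: "a \<in> S' \<and> b \<in> S'" using v(2) S(1) S4(1) Q by auto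
    have ne: "a \<noteq> b" using e adj_irrefl by auto
    have "biconn (S \<inter> T')"
      by (rule biconn_hubs[of a _ b]) (use ab bi e e' S4 ne in auto)
    note r = max_biconn_restrict[OF S(2) T(2) S'(1) S(1) this]
    have "w = b" if "y \<in> T' - S'" "adj b y" "w \<in> T'" "adj y w" for y w
      using pe[of y w] that T(2) r(1) by blast
    moreover have "S' = insert a (insert b (Q \<inter> S'))" using ab S(1) S4(1) by blast
    moreover have "Q \<inter> S' \<noteq> {}" using v by blast
    moreover have "attach T' S' \<subseteq> {a, b}" using r(2) at by blast
    ultimately have "T_block T' S'"
      by (intro T_blockI[of _ a b "Q \<inter> S'"]) (use S4(2,3) e Q in auto)
    then show ?thesis by blast
  qed
qed

section \<open>Minimal pairs and the min-max equality for admissible graphs\<close>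

lemma has_p4_split:
  assumes "has_p4 A" "A \<subseteq> B" "sealed B U"
  shows "has_p4 (A \<inter> U) \<or> has_p4 (A - U)"
proof -
  obtain a b c d where p: "p4 a b c d" "{a, b, c, d} \<subseteq> A" using assms(1) unfolding has_p4_def by blast
  show ?thesis
  proof (cases "{a, b, c, d} \<inter> U = {}")
    case True
    then have "{a, b, c, d} \<subseteq> A - U" using p(2) by blast
    then show ?thesis using has_p4I[OF p(1)] by blast
  next
    case False
    have "{a, b, c, d} \<subseteq> B" using p(2) assms(2) by (rule subset_trans)
    from p4_sealed[OF p(1) this assms(3) False] have "{a, b, c, d} \<subseteq> A \<inter> U" using p(2) by simp
    then show ?thesis using has_p4I[OF p(1)] by blast
  qed
qed

lemma has_p4_card:
  assumes "has_p4 A" "finite A"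
  shows "4 \<le> card A"
proof -
  obtain a b c d where p: "p4 a b c d" "{a, b, c, d} \<subseteq> A" using assms(1) unfolding has_p4_def by blast
  then have "card {a, b, c, d} = 4" using adj_irrefl by (auto simp: p4_def card_insert_if)
  then show ?thesis using card_mono[OF assms(2) p(2)] by simp
qed

lemma has_p4_not_card2: "\<not> has_p4 {a, b}"
  using has_p4_card[of "{a, b}"] by (auto simp: card_insert_if split: if_splits)

theorem admissible_konig:
  assumes "finite T" "admissible T"
  shows "konig T"
  using assms
proof (induction T rule: finite_psubset_induct)
  case (psubset T)
  have fin: "finite T" and c: "admissible T" by fact+
  have IH: "konig T'" if "T' \<subset> T" for T'
    using psubset.IH[OF that] admissible_mono[OF c fin] that by blast
  have good: "konig T" if "y \<in> T" "U \<subseteq> T - {y}" "sealed (T - {y}) U" "\<not> has_p4 U" "has_p4 (insert y U)" for y U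
  proof (rule konig_extend[OF _ that])
    show "konig (T - {y})" using that(1) by (intro IH) auto
  qed
  show ?case
  proof (cases "has_p4 T")
    case False
    then show ?thesis by (rule konig_no_p4)
  next
    case True
    then obtain a b c d where p: "p4 a b c d" "{a, b, c, d} \<subseteq> T" unfolding has_p4_def by blast
    \<comment> \<open>The set U may itself contain 4-paths. If it does not, \<open>good\<close>
      applies directly; if it does, minimality of |U| makes every smaller piece, together with the
      vertex it hangs from, free of 4-paths.\<close>
    define Q where "Q x U \<longleftrightarrow> x \<in> T \<and> U \<subseteq> T - {x} \<and> sealed (T - {x}) U \<and> has_p4 (insert x U)" for x U
    have "insert a (T - {a}) = T" using p(2) by auto
    then have "Q a (T - {a})" using p(2) True by (simp add: Q_def sealed_def)
    then have ex: "\<exists>n. \<exists>x U. Q x U \<and> card U = n" by blast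
    obtain x0 U where Q: "Q x0 U" and card_U: "card U = (LEAST n. \<exists>x U. Q x U \<and> card U = n)"
      using LeastI_ex[OF ex] by blast
    have min: "card U \<le> card U'" if "Q x U'" for x U'
      unfolding card_U by (rule Least_le) (use that in blast)
    have x0: "x0 \<in> T" "x0 \<notin> U" and UT: "U \<subseteq> T" and se: "sealed (T - {x0}) U" and pU: "has_p4 (insert x0 U)"
      using Q unfolding Q_def by auto
    have fU: "finite U" using UT fin by (rule finite_subset)
    have smaller: "\<not> has_p4 (insert y U')" if "y \<in> T" "U' \<subset> U" "y \<notin> U'" "sealed (T - {y}) U'" for y U'
    proof
      assume "has_p4 (insert y U')"
      then have "Q y U'" using that UT unfolding Q_def by blast
      then show False using min psubset_card_mono[OF fU that(2)] by fastforce
    qed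
    have Unb: "v \<in> U \<or> v = x0" if "y \<in> U" "v \<in> T" "adj y v" for y v
      using se that unfolding sealed_def by blast
    show ?thesis
    proof (cases "has_p4 U")
      case False
      then show ?thesis using good[OF x0(1) _ se False pU] UT x0 by blast
    next
      case p4U: True
      \<comment> \<open>Without such an edge U would be a union of components of T, and removing one
        of its vertices y would give a smaller pair with y in place of x0.\<close>
      have "\<exists>u\<in>U. adj x0 u"
      proof (rule ccontr)
        assume no: "\<not> ?thesis"
        obtain y where y: "y \<in> U" using p4U has_p4_card fU by fastforce
        have "sealed (T - {y}) (U - {y})"
          unfolding sealed_def using Unb no adj_sym by blast
        then have "\<not> has_p4 (insert y (U - {y}))"
          using y UT by (intro smaller) auto
        then show False using p4U y by (simp add: insert_absorb)
      qed
      then obtain u where u: "u \<in> U" "adj x0 u" by blast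
      obtain S where S: "max_biconn T S" "x0 \<in> S" "u \<in> S"
        using biconn_extend[OF fin biconn_edge[OF u(2)]] x0 u UT by auto
      have bi: "biconn S" and ST: "S \<subseteq> T" using S by (auto simp: max_biconn_def)
      have fS: "finite S" using ST fin by (rule finite_subset)
      have ux0: "u \<noteq> x0" using u adj_irrefl by auto
      have SU: "s \<in> U" if s: "s \<in> S" "s \<noteq> x0" for s
      proof -
        have "conn (S - {x0})" using biconn_minus[OF bi S(3)] ux0 by blast
        then have "reach (S - {x0}) u s" using s S ux0 unfolding conn_def by blast
        then have "reach (T - {x0}) u s" by (rule reach_mono) (use ST in auto)
        then show ?thesis using reach_sealed[OF _ se u(1)] by blast
      qed
      \<comment> \<open>The part of U that remains connected to y when the block is removed. By
        \<open>max_biconn_no_ear\<close> different y have disjoint parts.\<close>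
      define hang where "hang y = {v \<in> U - S. \<exists>k. reach (U - S) v k \<and> adj k y}" for y
      have hangD: "hang y \<subseteq> U - S" for y by (auto simp: hang_def)
      have h_disj: "y = y'" if v: "v \<in> hang y" "v \<in> hang y'" and y: "y \<in> S" "y' \<in> S" for v y y'
      proof -
        obtain k k' where k: "reach (U - S) v k" "adj k y" "reach (U - S) v k'" "adj k' y'"
          using v unfolding hang_def by blast
        have "reach (U - S) k k'" using reach_trans[OF k(3) reach_sym[OF k(1)]] .
        then have "reach (T - S) k k'" by (rule reach_mono) (use UT in auto)
        then show ?thesis using max_biconn_no_ear[OF S(1) y _ adj_sym[OF k(2)] k(4)] by blast
      qed
      have h_in: "v \<in> hang y" if "v \<in> U - S" "adj v y" for v y
        using that reach_refl[of v "U - S"] unfolding hang_def by blast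
      have h_nbr: "w \<in> hang y \<or> w = y" if v: "v \<in> hang y" "w \<in> T" "adj v w" and y: "y \<in> S" for v w y
      proof (cases "w \<in> S")
        case True
        have "v \<in> hang w" using h_in v(3) hangD v(1) by blast
        then show ?thesis using h_disj[OF v(1)] y True by blast
      next
        case False
        have vU: "v \<in> U - S" using hangD v(1) by blast
        then have w: "w \<in> U - S" using Unb[of v w] v S(2) False by blast
        obtain k where "reach (U - S) v k" "adj k y" using v(1) unfolding hang_def by (elim CollectE conjE exE) 
        moreover have "reach (U - S) w v" using w vU adj_sym[OF v(3)] by (intro reach_edge)
        ultimately have "w \<in> hang y" using w reach_trans unfolding hang_def by blast
        then show ?thesis by blast
      qed
      \<comment> \<open>Such a y lies in U but not in \<open>hang y\<close>, and it separates
        \<open>hang y\<close> from the rest. So \<open>hang y\<close> is properly smaller than U and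
        minimality applies.\<close>
      have h_free: "\<not> has_p4 (insert y (hang y))" if "y \<in> S" "y \<noteq> x0" for y
      proof (rule smaller)
        show "y \<in> T" "y \<notin> hang y" "hang y \<subset> U" using that SU ST hangD[of y] by auto
        show "sealed (T - {y}) (hang y)" unfolding sealed_def using h_nbr that(1) by blast
      qed
      have card3: "3 \<le> card S"
      proof (rule ccontr)
        assume "\<not> 3 \<le> card S"
        moreover have "card {x0, u} = 2" using ux0 by simp
        ultimately have "S = {x0, u}" using S card_seteq[OF fS, of "{x0, u}"] by auto
        \<comment> \<open>If the block is the single edge from x0 to u, then U splits into H and the
          rest, both free of 4-paths by minimality, although U has a 4-path.\<close>
        define H where "H = insert u (hang u)"
        have "sealed (T - {x0}) (U - H)"
          unfolding sealed_def
        proof (intro ballI impI)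
          fix v w assume v: "v \<in> U - H" "w \<in> T - {x0}" "adj v w"
          then have "w \<in> U" using Unb by blast
          moreover have "w \<noteq> u"
          proof
            assume "w = u"
            then have "v \<in> hang u" using h_in[of v u] v x0(2) by (auto simp: \<open>S = {x0, u}\<close> H_def)
            then show False using v by (simp add: H_def)
          qed
          moreover have "w \<notin> hang u"
          proof
            assume "w \<in> hang u"
            then have "v \<in> hang u \<or> v = u" using h_nbr[of w u v] v adj_sym S(3) UT by blast
            then show False using v by (auto simp: H_def)
          qed
          ultimately show "w \<in> U - H" by (simp add: H_def)
        qed
        moreover from this have "\<not> has_p4 (insert x0 (U - H))"
          by (intro smaller) (use x0 u in \<open>auto simp: H_def\<close>)
        then have "\<not> has_p4 (U - H)" using has_p4_mono by blast
        moreover have "U \<inter> (U - H) = U - H" "U - (U - H) \<subseteq> H" by auto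
        ultimately have "has_p4 H"
          using has_p4_split[OF p4U, of "T - {x0}" "U - H"] UT x0(2) has_p4_mono by (metis subset_Diff_insert Diff_empty)
        then show False using h_free[OF S(3) ux0] by (simp add: H_def)
      qed
      \<comment> \<open>Three vertices hold no 4-path, so a four-vertex block attached at one vertex
        is settled by that vertex.\<close>
      have one: "konig T" if y: "y \<in> S" "attach T S \<subseteq> {y}" "card S = 4" "has_p4 S" for y
      proof (rule good[of y "S - {y}"])
        have "card (S - {y}) = 3" using y fS by simp
        then show "\<not> has_p4 (S - {y})" using has_p4_card[of "S - {y}"] fS by auto
        show "sealed (T - {y}) (S - {y})" using attach_eq_sub y by blast
        show "has_p4 (insert y (S - {y}))" using y by (simp add: insert_absorb)
      qed (use y ST in auto)
      consider "subdiv_block T S" | "K4_block T S" | "T2_block T S" | "T_block T S"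
        using c S(1) card3 unfolding admissible_def by blast
      then show ?thesis
      proof cases
        case 1
        then obtain X Y E where S_eq: "S = X \<union> Y \<union> E" and d: "X \<inter> Y = {}" "X \<inter> E = {}" "Y \<inter> E = {}"
          and ed: "\<And>u v. u \<in> S \<Longrightarrow> v \<in> S \<Longrightarrow> adj u v \<Longrightarrow> u \<in> E \<longleftrightarrow> v \<notin> E"
          and E: "\<And>e. e \<in> E \<Longrightarrow> \<exists>u\<in>X. \<exists>v\<in>Y. {w \<in> T. adj e w} = {u, v}"
          by (rule subdiv_blockE) (rule that)
        have E_nbr: "w \<in> S" if "e \<in> E" "w \<in> T" "adj e w" for e w
        proof -
          obtain u v where "u \<in> X" "v \<in> Y" "{w \<in> T. adj e w} = {u, v}" using E \<open>e \<in> E\<close> by blast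
          moreover have "w \<in> {w \<in> T. adj e w}" using that by simp
          ultimately show ?thesis using S_eq by auto
        qed
        \<comment> \<open>The root is x0 when x0 belongs to H, since what is attached to the block
          at x0 is not controlled. When x0 is a subdivision vertex, nothing outside the block is
          adjacent to it, and any vertex of H can be the root.\<close>
        have "\<exists>x. x \<in> X \<union> Y \<and> (x0 \<in> X \<union> Y \<longrightarrow> x = x0)"
        proof (cases "x0 \<in> X \<union> Y")
          case False
          then have "x0 \<in> E" using S(2) S_eq by blast
          then show ?thesis using E False by blast
        qed blast
        then obtain x where x: "x \<in> X \<union> Y" "x0 \<in> X \<union> Y \<Longrightarrow> x = x0" by blast
        show ?thesis
        proof (rule konig_bipartite_block[OF fin _ ST S_eq d, where x = x and W = hang, OF _ _ _ _ x(1) _ _ _ _ refl])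
          fix v assume v: "v \<in> X \<union> Y"
          then obtain a b where ab: "a \<in> S" "b \<in> S" "a \<noteq> b" "adj v a" "adj v b"
            using biconn_two_nbrs[OF bi fS card3, of v] S_eq by blast
          have "v \<in> S" "v \<notin> E" using v S_eq d by auto
          then have "a \<in> E" "b \<in> E" using ed[of v a] ed[of v b] ab by blast+
          then show "\<exists>e\<in>E. \<exists>e'\<in>E. e \<noteq> e' \<and> adj v e \<and> adj v e'" using ab by blast
        next
          fix y show "hang y \<subseteq> T - S" using hangD UT by blast
        next
          fix y y' assume "y \<in> X \<union> Y - {x}" "y' \<in> X \<union> Y - {x}" "y \<noteq> y'"
          then show "hang y \<inter> hang y' = {}" using h_disj[of _ y y'] S_eq by blast
        next
          fix y v w assume "y \<in> X \<union> Y - {x}" "v \<in> hang y" "w \<in> T" "adj v w"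
          then show "w \<in> hang y \<or> w = y" using h_nbr[of v y w] S_eq by blast
        next
          fix y assume "y \<in> X \<union> Y - {x}"
          then show "\<not> has_p4 (insert y (hang y))" using h_free[of y] S_eq x(2) by blast
        next
          fix r s
          let ?R = "T - S - \<Union> (hang ` (X \<union> Y - {x}))"
          assume r: "r \<in> ?R" and s: "s \<in> T - ?R" and rs: "adj r s"
          have sr: "adj s r" using rs adj_sym by blast
          show "s = x"
          proof (rule ccontr)
            assume sx: "s \<noteq> x"
            show False
            proof (cases "s \<in> S")
              case False
              then obtain y where y: "y \<in> X \<union> Y - {x}" "s \<in> hang y" using s by blast
              then have "r \<in> hang y \<or> r = y" using h_nbr[of s y r] sr r S_eq by blast
              then show False using r y S_eq by blast
            next
              case True
              have "s \<notin> E" using E_nbr[OF _ _ sr] r by blast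
              then have sXY: "s \<in> X \<union> Y - {x}" using True sx S_eq by blast
              then have "r \<notin> U" using h_in[of r s] rs r by blast
              moreover have "s \<in> U" using SU[OF True] x(2) sXY by blast
              ultimately have "r = x0" using Unb[of s r] sr r by blast
              then show False using r S(2) by blast
            qed
          qed
        qed (use IH ed E in auto)
      next
        case 2
        then obtain a b c d where S4: "S = {a, b, c, d}" "distinct [a, b, c, d]"
          and cl: "\<And>u v. u \<in> S \<Longrightarrow> v \<in> S \<Longrightarrow> u \<noteq> v \<Longrightarrow> adj u v" and at: "attach T S \<subseteq> {a}"
          by (rule K4_blockE) (rule that)
        have "p4 a b c d" using S4 cl unfolding p4_def by auto
        then have "has_p4 S" using has_p4I S4(1) by blast
        then show ?thesis using one[of a] S4 at by simp
      next
        case 3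
        then obtain a b q r where S4: "S = {a, b, q, r}" "distinct [a, b, q, r]"
          and e: "adj a b" "adj a q" "adj a r" "adj b q" "adj b r" and at: "attach T S \<subseteq> {q}"
          by (rule T2_blockE) (rule that)
        have "p4 q a r b" using S4 e adj_sym unfolding p4_def by auto
        then have "has_p4 S" by (rule has_p4I) (use S4 in auto)
        then show ?thesis using one[of q] S4 at by simp
      next
        case 4
        then obtain a b Q where S4: "S = insert a (insert b Q)" "a \<notin> Q" "b \<notin> Q" "Q \<noteq> {}"
          and e: "adj a b" "\<And>q. q \<in> Q \<Longrightarrow> adj a q" "\<And>q. q \<in> Q \<Longrightarrow> adj b q"
          and Q: "\<And>q r. q \<in> Q \<Longrightarrow> r \<in> Q \<Longrightarrow> \<not> adj q r" and at: "attach T S \<subseteq> {a, b}"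
          and pe: "\<And>y w. y \<in> T - S \<Longrightarrow> adj b y \<Longrightarrow> w \<in> T \<Longrightarrow> adj y w \<Longrightarrow> w = b"
          by (rule T_blockE) (rule that)
        have ne: "a \<noteq> b" using e adj_irrefl by auto
        have abT: "a \<in> T" "b \<in> T" "Q \<subseteq> T" using S4 ST by auto
        have Q_nbr: "w \<in> S" if "q \<in> Q" "w \<in> T" "adj q w" for q w
          using attachI[of q S w T] that at S4 by blast
        define L where "L = {y \<in> T - S. adj b y}"
        \<comment> \<open>Apart from a, the surroundings of b form a star with leaves Q and L. A
          star has no 4-path, so \<open>good\<close> applies at a as soon as adding a creates
          one.\<close>
        have star: "u = b \<or> v = b" if "u \<in> insert b Q \<union> L" "v \<in> insert b Q \<union> L" "adj u v" for u v
          using that Q pe[of u v] pe[of v u] adj_sym abT unfolding L_def by blast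
        have "\<not> has_p4 (insert b Q \<union> L)"
        proof
          assume "has_p4 (insert b Q \<union> L)"
          then obtain a1 a2 a3 a4 where p: "p4 a1 a2 a3 a4" "{a1, a2, a3, a4} \<subseteq> insert b Q \<union> L"
            unfolding has_p4_def by blast
          then have "a1 = b \<or> a2 = b" "a3 = b \<or> a4 = b" using star by (auto simp: p4_def)
          then show False using p(1) adj_irrefl by (auto simp: p4_def)
        qed
        moreover have "sealed (T - {a}) (insert b Q \<union> L)"
          unfolding sealed_def
        proof (intro ballI impI)
          fix v w assume v: "v \<in> insert b Q \<union> L" "w \<in> T - {a}" "adj v w"
          show "w \<in> insert b Q \<union> L"
            using v Q_nbr[of v w] S4(1) pe[of v w] unfolding L_def by blast
        qed
        ultimately have fin1: "konig T" if "has_p4 (insert a (insert b Q \<union> L))"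
          using good[OF abT(1) _ _ _ that] abT ne S4 by (auto simp: L_def)
        show ?thesis
        proof (cases "\<exists>y. y \<in> L")
          case True
          then obtain y where y: "y \<in> L" by blast
          obtain q where q: "q \<in> Q" using S4 by blast
          have "p4 y b q a" using y q e S4 ne adj_sym unfolding p4_def L_def by auto
          then show ?thesis by (intro fin1 has_p4I) (use y q in auto)
        next
          case noL: False
          obtain q where q: "q \<in> Q" using S4 by blast
          show ?thesis
          proof (cases "Q = {q}")
            case False
            then obtain r where r: "r \<in> Q" "r \<noteq> q" using q by blast
            have "p4 q a r b" using r q e S4 ne adj_sym unfolding p4_def by auto
            then show ?thesis by (intro fin1 has_p4I) (use r q in auto)
          next
            case True
            \<comment> \<open>What remains is a triangle in which only a can have neighbours
              outside.\<close>
            have S3: "S = {a, b, q}" using S4 True by simp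
            have b_nbr: "w \<in> {a, q}" if "w \<in> T" "adj b w" for w
              using that noL S3 adj_irrefl[of b] unfolding L_def by blast
            have q_nbr: "w \<in> {a, b}" if "w \<in> T" "adj q w" for w
              using that Q_nbr[OF q] S3 adj_irrefl[of q] by blast
            have aq: "a \<noteq> q" "b \<noteq> q" using S4 q by auto
            show ?thesis
            proof (cases "x0 = a")
              case x0a: True
              have bq: "b \<in> U" "q \<in> U" using SU S3 x0a ne aq by auto
              \<comment> \<open>Since b and q see only the triangle, what is left of U without them
                is sealed. By minimality it has no 4-path, and {b, q} is too small for one, against
                the assumption on U.\<close>
              have se': "sealed (T - {a}) (U - {b, q})"
                unfolding sealed_def
              proof (intro ballI impI)
                fix v w assume v: "v \<in> U - {b, q}" "w \<in> T - {a}" "adj v w"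
                then have "w \<in> U" "adj w v" "v \<in> T" "v \<noteq> a" using Unb x0a adj_sym UT x0 by auto
                then show "w \<in> U - {b, q}" using b_nbr[of v] q_nbr[of v] v by blast
              qed
              have "\<not> has_p4 (insert a (U - {b, q}))"
                by (intro smaller se') (use abT bq x0a x0 in auto)
              then have "\<not> has_p4 (U \<inter> (U - {b, q}))" using has_p4_mono by blast
              moreover have "U - (U - {b, q}) \<subseteq> {b, q}" by blast
              then have "\<not> has_p4 (U - (U - {b, q}))" using has_p4_not_card2 has_p4_mono by blast
              moreover have "U \<subseteq> T - {a}" using UT x0 x0a by blast
              ultimately show ?thesis using has_p4_split[OF p4U _ se'] by blast
            next
              case False
              \<comment> \<open>Here x0 is b or q, and \<open>q'\<close> is the other one. The
                vertex a settles this case: x0 + U - a is sealed off by a, splits into {x0, q'} and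
                a part free of 4-paths by minimality, and contains a 4-path once a is added.\<close>
              define q' where "q' = (if x0 = b then q else b)"
              have q': "S = {a, x0, q'}" "q' \<noteq> a" "q' \<noteq> x0"
                using S(2) S3 False ne aq by (auto simp: q'_def)
              have x0_nbr: "w \<in> {a, q'}" if "w \<in> T" "adj x0 w" for w
                using b_nbr[of w] q_nbr[of w] that S(2) S3 False by (auto simp: q'_def split: if_splits)
              have q'_nbr: "w \<in> {a, x0}" if "w \<in> T" "adj q' w" for w
                using b_nbr[of w] q_nbr[of w] that S(2) S3 False by (auto simp: q'_def split: if_splits)
              have aU: "a \<in> U" "q' \<in> U" using SU q' False by auto
              have seV: "sealed (T - {a}) (U - {a, q'})"
                unfolding sealed_def
              proof (intro ballI impI)
                fix v w assume v: "v \<in> U - {a, q'}" "w \<in> T - {a}" "adj v w"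
                then have "w \<in> U \<or> w = x0" "adj w v" "v \<in> T" "v \<noteq> x0" using Unb adj_sym UT x0 by auto
                then show "w \<in> U - {a, q'}" using x0_nbr[of v] q'_nbr[of v] v by blast
              qed
              have noV: "\<not> has_p4 (insert a (U - {a, q'}))"
                by (intro smaller seV) (use abT aU in auto)
              let ?U = "insert x0 (U - {a})"
              have "\<not> has_p4 (?U \<inter> (U - {a, q'}))" using noV has_p4_mono by blast
              moreover have "?U - (U - {a, q'}) \<subseteq> {x0, q'}" by blast
              then have "\<not> has_p4 (?U - (U - {a, q'}))" using has_p4_not_card2 has_p4_mono by blast
              moreover have UTa: "?U \<subseteq> T - {a}" using UT x0 False by blast
              ultimately have "\<not> has_p4 ?U" using has_p4_split[OF _ UTa seV] by blast
              moreover have "sealed (T - {a}) ?U"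
                unfolding sealed_def
              proof (intro ballI impI)
                fix v w assume v: "v \<in> ?U" "w \<in> T - {a}" "adj v w"
                show "w \<in> ?U"
                proof (cases "v = x0")
                  case True
                  then show ?thesis using x0_nbr[of w] v aU by blast
                next
                  case False
                  then show ?thesis using Unb[of v w] v by blast
                qed
              qed
              moreover have "has_p4 (insert a ?U)" using p4U by (rule has_p4_mono) blast
              ultimately show ?thesis using good[OF abT(1) UTa] by blast
            qed
          qed
        qed
      qed
    qed
  qed
qed

subsection \<open>Cycles in hereditarily Koenig graphs\<close>

definition hereditary_konig :: "'a set \<Rightarrow> bool" where
  "hereditary_konig T \<longleftrightarrow> finite T \<and> (\<forall>T'\<subseteq>T. konig T')"

lemma packing_card:
  assumes "packing T P" "finite T"
  shows "4 * card P \<le> card T"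
proof -
  have c4: "card A = 4" if A: "A \<in> P" for A
  proof -
    obtain a b c d where "A = {a, b, c, d}" "p4 a b c d" using packingD(3)[OF assms(1) A] by blast
    then show ?thesis using adj_irrefl by (auto simp: p4_def card_insert_if)
  qed
  have "card (\<Union>P) = (\<Sum>A\<in>P. card A)"
  proof (rule card_Union_disjoint)
    show "pairwise disjnt P" using assms(1) by (simp add: packing_def)
    show "finite A" if "A \<in> P" for A using packingD(2)[OF assms(1) that] assms(2) by (rule finite_subset)
  qed
  also have "\<dots> = 4 * card P" using c4 by simp
  finally have "4 * card P = card (\<Union>P)" by simp
  also have "\<dots> \<le> card T" using packingD(2)[OF assms(1)] assms(2) by (intro card_mono) auto
  finally show ?thesis .
qed

text \<open>Four paths without a common vertex within at most seven vertices: no single vertex hits them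
  all, but no two of the 4-paths are disjoint.\<close>

lemma hk_bad:
  assumes hk: "hereditary_konig T" and L: "set L \<subseteq> T" "length L \<le> 7"
    and p1: "p4 a1 b1 c1 d1" "{a1, b1, c1, d1} \<subseteq> set L"
    and p2: "p4 a2 b2 c2 d2" "{a2, b2, c2, d2} \<subseteq> set L"
    and p3: "p4 a3 b3 c3 d3" "{a3, b3, c3, d3} \<subseteq> set L"
    and p4: "p4 a4 b4 c4 d4" "{a4, b4, c4, d4} \<subseteq> set L"
    and I: "{a1, b1, c1, d1} \<inter> {a2, b2, c2, d2} \<inter> {a3, b3, c3, d3} \<inter> {a4, b4, c4, d4} = {}"
  shows False
proof -
  obtain P X where P: "packing (set L) P" and X: "hits (set L) X" and c: "card X \<le> card P"
    using hk L(1) unfolding hereditary_konig_def konig_def by blast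
  have "4 * card P \<le> 7"
    using packing_card[OF P] card_length[of L] L(2) by simp
  then have "card X \<le> Suc 0" using c by simp
  moreover have "finite X" using X by (simp add: hits_def)
  ultimately have one: "x = y" if "x \<in> X" "y \<in> X" for x y
    using that card_le_Suc0_iff_eq by blast
  obtain x1 where x1: "x1 \<in> {a1, b1, c1, d1}" "x1 \<in> X" using hitsD[OF X p1] by blast
  obtain x2 where x2: "x2 \<in> {a2, b2, c2, d2}" "x2 \<in> X" using hitsD[OF X p2] by blast
  obtain x3 where x3: "x3 \<in> {a3, b3, c3, d3}" "x3 \<in> X" using hitsD[OF X p3] by blast
  obtain x4 where x4: "x4 \<in> {a4, b4, c4, d4}" "x4 \<in> X" using hitsD[OF X p4] by blast
  have "x2 = x1" "x3 = x1" "x4 = x1" using one x1(2) x2(2) x3(2) x4(2) by simp_all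
  then have "x1 \<in> {a1, b1, c1, d1} \<inter> {a2, b2, c2, d2} \<inter> {a3, b3, c3, d3} \<inter> {a4, b4, c4, d4}"
    using x1(1) x2(1) x3(1) x4(1) by (intro IntI) simp_all
  with I show False by simp
qed

text \<open>Indices run over all natural numbers with period n, so that stretches passing the
  starting point are ordinary intervals. Chords are allowed.\<close>

definition periodic_cycle :: "(nat \<Rightarrow> 'a) \<Rightarrow> nat \<Rightarrow> bool" where
  "periodic_cycle c n \<longleftrightarrow> (\<forall>i. adj (c i) (c (Suc i))) \<and> (\<forall>i j. c i = c j \<longleftrightarrow> i mod n = j mod n)"

lemma mod_shift_neq:
  fixes i d n :: nat
  assumes "0 < d" "d < n"
  shows "(i + d) mod n \<noteq> i mod n"
proof
  assume "(i + d) mod n = i mod n"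
  then have "n dvd (i + d) - i" by (metis mod_eq_dvd_iff_nat le_add1)
  with assms show False by (auto dest: dvd_imp_le)
qed

lemma periodic_cycle_p4:
  assumes "periodic_cycle c n" "4 \<le> n"
  shows "p4 (c i) (c (i + 1)) (c (i + 2)) (c (i + 3))"
proof -
  have "c (j + d) \<noteq> c j" if "0 < d" "d < 4" for j d
    using mod_shift_neq[of d n j] that assms unfolding periodic_cycle_def by simp
  from this[of 2 i] this[of 3 i] this[of 2 "i + 1"]
  have "c i \<noteq> c (i + 2)" "c i \<noteq> c (i + 3)" "c (i + 1) \<noteq> c (i + 3)"
    by (simp_all add: numeral_eq_Suc eq_commute)
  moreover have "adj (c j) (c (Suc j))" for j using assms(1) by (simp add: periodic_cycle_def)
  from this[of i] this[of "i + 1"] this[of "i + 2"]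
  have "adj (c i) (c (i + 1))" "adj (c (i + 1)) (c (i + 2))" "adj (c (i + 2)) (c (i + 3))"
    by (simp_all add: numeral_eq_Suc)
  ultimately show ?thesis by (simp add: p4_def)
qed

text \<open>Send each i below n to the first member of X among the four consecutive cycle vertices
  starting at i, together with its offset. This map into the pairs of a member of X and an offset
  below four is injective, whence n \<le> 4|X|. In case of equality it is onto, so X lies on the
  cycle and four consecutive vertices never contain two members.\<close>

lemma periodic_cycle_hits:
  assumes c: "periodic_cycle c n" "4 \<le> n" and X: "hits T X" and T: "range c \<subseteq> T"
  shows "n \<le> 4 * card X"
    and "4 * card X \<le> n \<Longrightarrow> X \<subseteq> range c"
    and "4 * card X \<le> n \<Longrightarrow> d < d' \<Longrightarrow> d' < 4 \<Longrightarrow> c (i + d) \<in> X \<Longrightarrow> c (i + d') \<notin> X"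
    and "\<exists>d<4. c (i + d) \<in> X"
proof -
  have ex: "\<exists>d<4. c (i + d) \<in> X" for i
  proof -
    have "{c i, c (i + 1), c (i + 2), c (i + 3)} \<subseteq> T" using T by auto
    then have "\<not> {c i, c (i + 1), c (i + 2), c (i + 3)} \<inter> X = {}"
      using hitsD[OF X periodic_cycle_p4[OF c, of i]] by (intro notI)
    then have disj: "c (i + 0) \<in> X \<or> c (i + 1) \<in> X \<or> c (i + 2) \<in> X \<or> c (i + 3) \<in> X" by simp
    have w: "?thesis" if "c (i + d) \<in> X" "d < 4" for d using that by blast
    from disj show ?thesis by (elim disjE) (erule w, simp)+
  qed
  then show "\<exists>d<4. c (i + d) \<in> X" .
  define dd where "dd i = (LEAST d. d < 4 \<and> c (i + d) \<in> X)" for i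
  have dd: "dd i < 4 \<and> c (i + dd i) \<in> X" for i
    unfolding dd_def using LeastI_ex[OF ex[of i]] .
  have dd_le: "dd i \<le> d" if "d < 4" "c (i + d) \<in> X" for i d
    unfolding dd_def by (rule Least_le) (use that in blast)
  define f where "f i = (c (i + dd i), dd i)" for i
  have finX: "finite X" using X by (simp add: hits_def)
  have f_eq: "i mod n = j mod n" if "c (i + d) = c (j + d)" for i j d
  proof -
    have "(i + d) mod n = (j + d) mod n" using c(1) that unfolding periodic_cycle_def by blast
    then obtain q1 q2 where "i + d + n * q1 = j + d + n * q2" unfolding nat_mod_eq_iff by blast
    then have "i + n * q1 = j + n * q2" by simp
    then show ?thesis unfolding nat_mod_eq_iff by blast
  qed
  have inj: "inj_on f {..<n}"
  proof (rule inj_onI)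
    fix i j assume "i \<in> {..<n}" "j \<in> {..<n}" "f i = f j"
    then have "i mod n = j mod n" "i < n" "j < n" using f_eq[of i "dd i" j] by (auto simp: f_def)
    then show "i = j" by simp
  qed
  have sub: "f ` {..<n} \<subseteq> X \<times> {..<4}" using dd by (auto simp: f_def)
  have cX: "card (X \<times> {..<4::nat}) = 4 * card X" using finX by (simp add: card_cartesian_product)
  have "card (f ` {..<n}) \<le> card (X \<times> {..<4::nat})"
    using sub finX by (intro card_mono) auto
  then show n: "n \<le> 4 * card X" using inj cX by (simp add: card_image)
  have eq: "f ` {..<n} = X \<times> {..<4}" if "4 * card X \<le> n"
    using sub finX inj cX that by (intro card_seteq) (auto simp: card_image)
  show "X \<subseteq> range c" if "4 * card X \<le> n"
  proof
    fix x assume "x \<in> X"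
    then have "(x, 0) \<in> f ` {..<n}" unfolding eq[OF that] by simp
    then show "x \<in> range c" by (auto simp: f_def)
  qed
  show "c (i + d') \<notin> X" if "4 * card X \<le> n" "d < d'" "d' < 4" "c (i + d) \<in> X" for d d' i
  proof
    assume "c (i + d') \<in> X"
    \<comment> \<open>By surjectivity d' is the first offset of some window. That window starts at
      the same cycle vertex as the one at i and therefore already has a hit at d.\<close>
    then have "(c (i + d'), d') \<in> f ` {..<n}" unfolding eq[OF that(1)] using that by simp
    then obtain j where j: "c (i + d') = c (j + dd j)" "d' = dd j" by (auto simp: f_def)
    then have "i mod n = j mod n" using f_eq by blast
    moreover from this have "c (i + d) = c (j + d)"
      using c(1) unfolding periodic_cycle_def by (metis mod_add_left_eq)
    then have "dd j \<le> d" using dd_le[of d j] that by simp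
    with j that show False by simp
  qed
qed

text \<open>With P and X for the vertex set of the cycle, n \<le> 4|X| \<le> 4|P| \<le> n.\<close>

lemma hk_periodic_cycle_dvd:
  assumes hk: "hereditary_konig T" and c: "periodic_cycle c n" "4 \<le> n" "range c \<subseteq> T" and card: "card (range c) = n"
  shows "4 dvd n"
proof -
  obtain P X where P: "packing (range c) P" "hits (range c) X" "card X \<le> card P"
    using hk c(3) unfolding hereditary_konig_def konig_def by blast
  have "finite (range c)" using hk c(3) finite_subset unfolding hereditary_konig_def by blast
  then have "4 * card P \<le> n" using packing_card[OF P(1)] card by simp
  moreover have "n \<le> 4 * card X" using periodic_cycle_hits(1)[OF c(1,2) P(2)] by simp
  ultimately have "n = 4 * card P" using P(3) by simp
  then show ?thesis by simp
qed

text \<open>As 4 divides n, the n + 2 vertices hold at most n/4 disjoint 4-paths. So the transversal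
  is tight and consists of every fourth cycle vertex. The two 4-paths from p through
  \<open>c s\<close>, one in each direction, show that it contains no cycle neighbour of
  \<open>c s\<close>; so its indices have the parity of s, and likewise that of t.\<close>

lemma hk_periodic_cycle_pendants:
  assumes hk: "hereditary_konig T" and c: "periodic_cycle c n" "4 \<le> n" "range c \<subseteq> T" and card: "card (range c) = n"
    and pq: "p \<in> T" "q \<in> T" "p \<notin> range c" "q \<notin> range c" "p \<noteq> q"
    and ad: "adj (c s) p" "adj (c t) q"
  shows "even (s + t)"
proof -
  let ?T = "insert p (insert q (range c))"
  have n4: "4 dvd n" using hk_periodic_cycle_dvd[OF hk c card] .
  obtain P X where P: "packing ?T P" and X: "hits ?T X" and XP: "card X \<le> card P"
    using hk c(3) pq(1,2) unfolding hereditary_konig_def konig_def by (meson insert_subset)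
  have fin: "finite (range c)" using hk c(3) finite_subset unfolding hereditary_konig_def by blast
  have "card ?T = n + 2" using fin card pq by simp
  then have "4 * card P \<le> n + 2" using packing_card[OF P] fin by simp
  then have "4 * card P \<le> n" using n4 by presburger
  then have le: "4 * card X \<le> n" using XP by simp
  have "range c \<subseteq> ?T" by blast
  note h = periodic_cycle_hits[OF c(1,2) X this]
  define m where "m i \<longleftrightarrow> c i \<in> X" for i
  have ex: "\<exists>d<4. m (i + d)" for i using h(4) by (simp add: m_def)
  have uq: "\<not> m (i + d')" if "m (i + d)" "d < d'" "d' < 4" for i d d'
    using h(3)[OF le] that by (simp add: m_def)
  \<comment> \<open>Exactly one of any four consecutive indices is hit, hence the hits have period
    four.\<close>
  have per: "m (i + 4) \<longleftrightarrow> m i" for i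
  proof
    assume m4: "m (i + 4)"
    obtain d where d: "d < 4" "m (i + d)" using ex by blast
    have "d = 0"
    proof (rule ccontr)
      assume "d \<noteq> 0"
      then have "\<not> m (i + d + (4 - d))" using uq[of "i + d" 0 "4 - d"] d by simp
      with m4 d show False by simp
    qed
    with d show "m i" by simp
  next
    assume mi: "m i"
    obtain d where d: "d < 4" "m (i + 1 + d)" using ex by blast
    have "d = 3"
    proof (rule ccontr)
      assume "d \<noteq> 3"
      then have "\<not> m (i + (1 + d))" using uq[of i 0 "1 + d"] mi d by simp
      with d show False by (simp add: add.assoc)
    qed
    then have "i + 1 + d = i + 4" by simp
    with d show "m (i + 4)" by metis
  qed
  have per': "m (i + 4 * k) \<longleftrightarrow> m i" for i k
  proof (induction k)
    case (Suc k)
    have "i + 4 * Suc k = i + 4 * k + 4" by simp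
    with Suc per show ?case by metis
  qed simp
  have md: "m i \<longleftrightarrow> m (i mod 4)" for i
    using per'[of "i mod 4" "i div 4"] by (simp add: add.commute)
  obtain r where r: "r < 4" "m r" using ex[of 0] by auto
  have mr: "m i \<longleftrightarrow> i mod 4 = r" for i
  proof
    assume "m i"
    then have "m (i mod 4)" using md by blast
    then show "i mod 4 = r" using uq[of 0 r "i mod 4"] uq[of 0 "i mod 4" r] r
      by (metis add_0 linorder_neqE_nat mod_less_divisor zero_less_numeral)
  next
    assume "i mod 4 = r"
    with r md[of i] show "m i" by simp
  qed
  have cn: "c (i + n) = c i" for i using c(1) unfolding periodic_cycle_def by simp
  have par: "even (s + r)" if ps: "adj (c s) p" "p \<in> ?T" "p \<notin> range c" for s p
  proof -
    have adc: "adj (c i) (c (Suc i))" "adj (c (Suc i)) (c i)" for i using c(1) adj_sym by (auto simp: periodic_cycle_def)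
    have ne: "c (i + 2) \<noteq> c i" for i
      using mod_shift_neq[of 2 n i] c(1,2) unfolding periodic_cycle_def by simp
    have np: "p \<noteq> c i" for i using ps by blast
    have pX: "p \<notin> X" using h(2)[OF le] ps by blast
    have "p4 p (c s) (c (s + 1)) (c (s + 2))"
      using ps adj_sym adc[of s] adc[of "s + 1"] ne[of s] np unfolding p4_def by (simp add: eq_commute)
    moreover have "{p, c s, c (s + 1), c (s + 2)} \<subseteq> ?T" using ps(2) by auto
    ultimately have "\<not> {p, c s, c (s + 1), c (s + 2)} \<inter> X = {}" using hitsD[OF X] by (intro notI)
    then have 1: "m s \<or> m (s + 1) \<or> m (s + 2)" using pX by (auto simp: m_def)
    \<comment> \<open>The index s - 2 on the cycle, shifted by n to stay within the natural
      numbers.\<close>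
    define u where "u = s + n - 2"
    have u: "s + n = u + 2" using c(2) by (simp add: u_def)
    have cs: "c s = c (u + 2)" using cn[of s] u by simp
    have "p4 p (c (u + 2)) (c (u + 1)) (c u)"
      using ps adj_sym adc[of u] adc[of "u + 1"] ne[of u] np cs unfolding p4_def by simp
    moreover have "{p, c (u + 2), c (u + 1), c u} \<subseteq> ?T" using ps(2) by auto
    ultimately have "\<not> {p, c (u + 2), c (u + 1), c u} \<inter> X = {}" using hitsD[OF X] by (intro notI)
    then have "m (u + 2) \<or> m (u + 1) \<or> m u" using pX by (auto simp: m_def)
    moreover have "m (u + 2) \<longleftrightarrow> m s" using cs by (simp add: m_def)
    moreover have "m (u + 1) \<longleftrightarrow> m (s + 3)"
    proof -
      have "u + 1 + 4 = s + 3 + n" using u by simp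
      then show ?thesis using per[of "u + 1"] cn[of "s + 3"] unfolding m_def by metis
    qed
    moreover have "m u \<longleftrightarrow> m (s + 2)"
    proof -
      have "u + 4 = s + 2 + n" using u by simp
      then show ?thesis using per[of u] cn[of "s + 2"] unfolding m_def by metis
    qed
    ultimately have "m s \<or> m (s + 3) \<or> m (s + 2)" by blast
    then have "m s \<or> m (s + 2)" using 1 uq[of s 1 3] by auto
    moreover have ev: "even (i + i mod 4)" for i :: nat by presburger
    moreover have "even (s + (s + 2) mod 4)" using ev[of "s + 2"] by simp
    ultimately show ?thesis using mr by metis
  qed
  from par[OF ad(1)] par[OF ad(2)] pq have "even (s + r)" "even (t + r)" by auto
  then show ?thesis by presburger
qed

section \<open>Cycles as vertex lists, their chords and their vertices of degree at least
  three\<close>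

definition cyc :: "'a list \<Rightarrow> bool" where
  "cyc xs \<longleftrightarrow> distinct xs \<and> 3 \<le> length xs \<and> successively adj xs \<and> adj (last xs) (hd xs)"

lemma cyc_nth:
  assumes "cyc xs" "i < length xs"
  shows "adj (xs ! i) (xs ! (Suc i mod length xs))"
proof (cases "Suc i < length xs")
  case True
  then show ?thesis using assms by (simp add: cyc_def successively_conv_nth)
next
  case False
  then have "Suc i = length xs" "xs \<noteq> []" using assms by auto
  then show ?thesis using assms by (auto simp: cyc_def last_conv_nth hd_conv_nth simp flip: \<open>Suc i = length xs\<close>)
qed

lemma cyc_periodic_cycle:
  assumes "cyc xs"
  shows "periodic_cycle (\<lambda>i. xs ! (i mod length xs)) (length xs)"
    "range (\<lambda>i. xs ! (i mod length xs)) = set xs"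
proof -
  have pos: "0 < length xs" using assms by (auto simp: cyc_def)
  show "periodic_cycle (\<lambda>i. xs ! (i mod length xs)) (length xs)"
    unfolding periodic_cycle_def
  proof (intro conjI allI)
    fix i show "adj (xs ! (i mod length xs)) (xs ! (Suc i mod length xs))"
      using cyc_nth[OF assms, of "i mod length xs"] pos by (simp add: mod_Suc_eq)
    fix j show "xs ! (i mod length xs) = xs ! (j mod length xs) \<longleftrightarrow> i mod length xs = j mod length xs"
      using assms pos by (simp add: cyc_def nth_eq_iff_index_eq)
  qed
  show "range (\<lambda>i. xs ! (i mod length xs)) = set xs"
  proof
    show "range (\<lambda>i. xs ! (i mod length xs)) \<subseteq> set xs" using pos by auto
    show "set xs \<subseteq> range (\<lambda>i. xs ! (i mod length xs))"
    proof
      fix x assume "x \<in> set xs"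
      then obtain i where "i < length xs" "x = xs ! i" by (metis in_set_conv_nth)
      then have "x = xs ! (i mod length xs)" by simp
      then show "x \<in> range (\<lambda>i. xs ! (i mod length xs))" by (rule range_eqI)
    qed
  qed
qed

lemma hk_cyc:
  assumes "hereditary_konig T" "cyc xs" "set xs \<subseteq> T"
  shows "length xs = 3 \<or> 4 dvd length xs"
proof (cases "length xs = 3")
  case False
  then have "4 \<le> length xs" using assms by (simp add: cyc_def)
  moreover have "card (set xs) = length xs" using assms by (simp add: cyc_def distinct_card)
  ultimately show ?thesis
    using hk_periodic_cycle_dvd[OF assms(1) cyc_periodic_cycle(1)[OF assms(2)]] assms(3) unfolding cyc_periodic_cycle(2)[OF assms(2)] by blast
qed simp

lemma hk_cyc_pendants:
  assumes "hereditary_konig T" "cyc xs" "set xs \<subseteq> T" "4 \<le> length xs"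
    and "p \<in> T - set xs" "q \<in> T - set xs" "p \<noteq> q"
    and "i < length xs" "j < length xs" "adj (xs ! i) p" "adj (xs ! j) q"
  shows "even (i + j)"
proof -
  have "card (set xs) = length xs" using assms by (simp add: cyc_def distinct_card)
  then show ?thesis
    using hk_periodic_cycle_pendants[OF assms(1) cyc_periodic_cycle(1)[OF assms(2)] assms(4), of p q i j] assms
    unfolding cyc_periodic_cycle(2)[OF assms(2)] by simp
qed

definition triangle_free :: "'a set \<Rightarrow> bool" where
  "triangle_free A \<longleftrightarrow> (\<forall>a\<in>A. \<forall>b\<in>A. \<forall>c\<in>A. \<not> (adj a b \<and> adj b c \<and> adj c a))"

lemma cyc_not3:
  assumes "cyc xs" "triangle_free (set xs)"
  shows "length xs \<noteq> 3"
proof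
  assume "length xs = 3"
  then obtain a b c where "xs = [a, b, c]" by (auto simp: length_Suc_conv numeral_3_eq_3)
  then show False using assms by (auto simp: cyc_def triangle_free_def)
qed

lemma triangle_free_mono: "triangle_free A \<Longrightarrow> B \<subseteq> A \<Longrightarrow> triangle_free B"
  unfolding triangle_free_def by blast

lemma successively_take: "successively P xs \<Longrightarrow> successively P (take n xs)"
  by (simp add: successively_conv_nth)

lemma successively_drop: "successively P xs \<Longrightarrow> successively P (drop n xs)"
  by (simp add: successively_conv_nth)

text \<open>A chord splits the cycle into two cycles whose lengths add up to n + 2. Without
  triangles all three lengths are multiples of four, which is impossible.\<close>

lemma cyc_no_chord:
  assumes hk: "hereditary_konig T" "cyc xs" "set xs \<subseteq> T" "triangle_free (set xs)"
    and ij: "i < j" "j < length xs" "adj (xs ! i) (xs ! j)"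
  shows "j = Suc i \<or> (i = 0 \<and> j = length xs - 1)"
proof (rule ccontr)
  assume no: "\<not> ?thesis"
  let ?ys = "take (j - i + 1) (drop i xs)"
  let ?zs = "take (i + 1) xs @ drop j xs"
  have d: "distinct xs" "successively adj xs" "adj (last xs) (hd xs)" "3 \<le> length xs"
    using hk(2) by (auto simp: cyc_def)
  have ly: "length ?ys = j - i + 1" using ij by simp
  have lz: "length ?zs = i + 1 + (length xs - j)" using ij by simp
  have hy: "hd ?ys = xs ! i" using ij by (simp add: hd_drop_conv_nth)
  have ey: "last ?ys = xs ! j"
  proof -
    have "?ys \<noteq> []" using ly by (metis Suc_eq_plus1 length_0_conv nat.distinct(1))
    then have "last ?ys = ?ys ! (j - i)" using ly by (simp add: last_conv_nth)
    also have "\<dots> = xs ! j" using ij by simp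
    finally show ?thesis .
  qed
  have cy: "cyc ?ys"
    unfolding cyc_def hy ey ly using d ij no adj_sym
    by (auto intro!: successively_take successively_drop)
  have hz: "hd ?zs = hd xs" using d by (cases xs) auto
  have ez: "last ?zs = last xs" using ij by simp
  have "last (take (i + 1) xs) = xs ! i" using ij by (simp add: last_conv_nth take_Suc_conv_app_nth)
  moreover have "hd (drop j xs) = xs ! j" using ij by (simp add: hd_drop_conv_nth)
  ultimately have "successively adj ?zs"
    using d ij by (auto simp: successively_append_iff intro: successively_take successively_drop)
  moreover have "distinct ?zs"
    using d ij by (auto simp: set_take_disj_set_drop_if_distinct)
  moreover have "3 \<le> length ?zs" using no ij unfolding lz by linarith
  ultimately have cz: "cyc ?zs" unfolding cyc_def hz ez using d by simp
  have sy: "set ?ys \<subseteq> set xs" by (meson set_drop_subset set_take_subset subset_trans)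
  have sz: "set ?zs \<subseteq> set xs" by (simp add: set_drop_subset set_take_subset)
  have "4 dvd length xs" using hk_cyc[OF hk(1-3)] cyc_not3[OF hk(2,4)] by blast
  moreover have "4 dvd length ?ys"
    using hk_cyc[OF hk(1) cy] cyc_not3[OF cy] triangle_free_mono[OF hk(4) sy] sy hk(3) by blast
  moreover have "4 dvd length ?zs"
    using hk_cyc[OF hk(1) cz] cyc_not3[OF cz] triangle_free_mono[OF hk(4) sz] sz hk(3) by blast
  moreover have "length ?ys + length ?zs = length xs + 2" unfolding ly lz using ij by simp
  ultimately show False by presburger
qed

lemma cyc_nbr:
  assumes "hereditary_konig T" "cyc xs" "set xs \<subseteq> T" "triangle_free (set xs)"
    and ij: "i < length xs" "j < length xs" "adj (xs ! i) (xs ! j)"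
  shows "j = Suc i mod length xs \<or> i = Suc j mod length xs"
proof -
  have "i \<noteq> j" using ij adj_irrefl by auto
  then consider "i < j" | "j < i" by linarith
  then show ?thesis
  proof cases
    case 1
    from cyc_no_chord[OF assms(1-4) 1 ij(2,3)] show ?thesis
    proof
      assume "i = 0 \<and> j = length xs - 1"
      then have "Suc j = length xs" "i = 0" using ij 1 by auto
      then show ?thesis by simp
    qed (use ij in simp)
  next
    case 2
    from cyc_no_chord[OF assms(1-4) 2 ij(1) adj_sym[OF ij(3)]] show ?thesis
    proof
      assume "j = 0 \<and> i = length xs - 1"
      then have "Suc i = length xs" "j = 0" using ij 2 by auto
      then show ?thesis by simp
    qed (use ij in simp)
  qed
qed

text \<open>Neighbours are counted in all of T, not only on the cycle or in the block.\<close>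

definition deg3 :: "'a set \<Rightarrow> 'a \<Rightarrow> bool" where
  "deg3 T v \<longleftrightarrow> (\<exists>a\<in>T. \<exists>b\<in>T. \<exists>c\<in>T. adj v a \<and> adj v b \<and> adj v c \<and> a \<noteq> b \<and> a \<noteq> c \<and> b \<noteq> c)"

lemma cyc_off:
  assumes hk: "hereditary_konig T" "cyc xs" "set xs \<subseteq> T" "triangle_free (set xs)"
    and i: "i < length xs" "deg3 T (xs ! i)"
  shows "\<exists>p\<in>T - set xs. adj (xs ! i) p"
proof (rule ccontr)
  assume no: "\<not> ?thesis"
  obtain a b c where abc: "a \<in> T" "b \<in> T" "c \<in> T" "adj (xs ! i) a" "adj (xs ! i) b" "adj (xs ! i) c"
    "a \<noteq> b" "a \<noteq> c" "b \<noteq> c" using i(2) unfolding deg3_def by blast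
  have "\<exists>j. j < length xs \<and> v = xs ! j \<and> (j = Suc i mod length xs \<or> i = Suc j mod length xs)"
    if v: "v \<in> T" "adj (xs ! i) v" for v
  proof -
    have "v \<in> set xs" using no v by blast
    then obtain j where "j < length xs" "v = xs ! j" by (metis in_set_conv_nth)
    then show ?thesis using cyc_nbr[OF hk i(1)] v by blast
  qed
  from this[OF abc(1,4)] this[OF abc(2,5)] this[OF abc(3,6)]
  obtain ja jb jc where j: "ja < length xs" "jb < length xs" "jc < length xs" 
    "a = xs ! ja" "b = xs ! jb" "c = xs ! jc"
    "ja = Suc i mod length xs \<or> i = Suc ja mod length xs"
    "jb = Suc i mod length xs \<or> i = Suc jb mod length xs"
    "jc = Suc i mod length xs \<or> i = Suc jc mod length xs" by blast
  have "k = k'" if "k < length xs" "k' < length xs" "i = Suc k mod length xs" "i = Suc k' mod length xs" for k k'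
    using that by (metis Suc_inject mod_Suc mod_less nat.distinct(1))
  with j abc(7-9) show False by metis
qed

text \<open>There being no chords, each of the two vertices has a neighbour off the cycle. Different
  such neighbours fall under \<open>hk_cyc_pendants\<close>. A common one, p, closes both arcs
  between the vertices to cycles of lengths a + 2 and b + 2 with a + b = n, and the restriction on
  cycle lengths makes a even.\<close>

lemma cyc_parity:
  assumes hk: "hereditary_konig T" "cyc xs" "set xs \<subseteq> T" "triangle_free (set xs)"
    and i: "i < length xs" "deg3 T (xs ! i)" and j: "j < length xs" "deg3 T (xs ! j)"
  shows "even (i + j)"
proof -
  have *: "even (i + j)" if ij: "i < j" and i: "i < length xs" "deg3 T (xs ! i)" and j: "j < length xs" "deg3 T (xs ! j)" for i j
  proof -
    obtain p q where p: "p \<in> T - set xs" "adj (xs ! i) p" and q: "q \<in> T - set xs" "adj (xs ! j) q"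
      using cyc_off[OF hk i] cyc_off[OF hk j] by blast
    have d: "distinct xs" "successively adj xs" "adj (last xs) (hd xs)" "3 \<le> length xs"
      using hk(2) by (auto simp: cyc_def)
    have n4: "4 dvd length xs" using hk_cyc[OF hk(1-3)] cyc_not3[OF hk(2,4)] by blast
    then have n: "4 \<le> length xs" using d by presburger
    show ?thesis
    proof (cases "p = q")
      case False
      then show ?thesis using hk_cyc_pendants[OF hk(1-3) n p(1) q(1)] i j p q by blast
    next
      case True
      let ?ys = "take (j - i + 1) (drop i xs)"
      let ?zs = "drop j xs @ take (i + 1) xs"
      have ly: "length ?ys = j - i + 1" using ij j by simp
      have lz: "length ?zs = i + 1 + (length xs - j)" using ij j by simp
      have hy: "hd ?ys = xs ! i" using ij j by (simp add: hd_drop_conv_nth)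
      have ney: "?ys \<noteq> []" using ly by (metis Suc_eq_plus1 length_0_conv nat.distinct(1))
      have ey: "last ?ys = xs ! j"
      proof -
        have "last ?ys = ?ys ! (j - i)" using ly ney by (simp add: last_conv_nth)
        also have "\<dots> = xs ! j" using ij j by simp
        finally show ?thesis .
      qed
      have sy: "set ?ys \<subseteq> set xs" by (meson set_drop_subset set_take_subset subset_trans)
      have sz: "set ?zs \<subseteq> set xs" by (simp add: set_drop_subset set_take_subset)
      have "successively adj (p # ?ys)"
        using hy adj_sym[OF p(2)] successively_take[OF successively_drop[OF d(2)]] ney
        by (simp only: successively_Cons) simp
      moreover have "last (p # ?ys) = xs ! j" using ney ey by simp
      moreover have "distinct (p # ?ys)" using p(1) sy d by auto
      ultimately have cy: "cyc (p # ?ys)" unfolding cyc_def using q(2) True ij ly by simp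
      have hz: "hd ?zs = xs ! j" using j by (simp add: hd_drop_conv_nth)
      have "last (take (i + 1) xs) = xs ! i" using i by (simp add: take_Suc_conv_app_nth)
      moreover have "take (i + 1) xs \<noteq> []" using i by auto
      ultimately have ez: "last ?zs = xs ! i" by (metis last_append)
      have "hd (take (i + 1) xs) = hd xs" using d by (cases xs) auto
      then have "successively adj ?zs"
        using d i j by (auto simp: successively_append_iff intro: successively_take successively_drop)
      moreover have nez: "?zs \<noteq> []" using j by simp
      ultimately have "successively adj (p # ?zs)"
        using hz q True adj_sym by (cases ?zs) auto
      moreover have "last (p # ?zs) = xs ! i" using nez ez by (metis last_ConsR)
      moreover have "distinct (p # ?zs)"
        using p(1) sz d ij set_take_disj_set_drop_if_distinct[OF d(1), of "i + 1" j]
        by (simp add: Int_commute) blast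
      ultimately have cz: "cyc (p # ?zs)" unfolding cyc_def using p(2) j lz by simp
      have "length (p # ?ys) = 3 \<or> 4 dvd length (p # ?ys)" "length (p # ?zs) = 3 \<or> 4 dvd length (p # ?zs)"
        using hk_cyc[OF hk(1) cy] hk_cyc[OF hk(1) cz] sy sz hk(3) p(1) by auto
      then have "j - i = 1 \<or> 4 dvd j - i + 2" "i + (length xs - j) = 1 \<or> 4 dvd i + (length xs - j) + 2"
        unfolding list.size ly lz by auto
      moreover have "(j - i) + (i + (length xs - j)) = length xs" using ij j by simp
      \<comment> \<open>Only the cycle itself is known to be triangle-free, so p may form a triangle
        with an arc of length a = 1. This is impossible: b + 2 would exceed 3 and be congruent to 1
        modulo 4.\<close>
      moreover have "even a" if "a = 1 \<or> 4 dvd a + 2" "b = 1 \<or> 4 dvd b + 2" "a + b = m" "4 dvd m" "4 \<le> m"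
        for a b m :: nat
      proof (cases "a = 1")
        case True
        then have "4 dvd b + 1" "b \<noteq> 1" using that by auto
        with that(2) show ?thesis by presburger
      next
        case False
        with that(1) show ?thesis by presburger
      qed
      ultimately have "even (j - i)" using n4 n by blast
      then show ?thesis using ij by presburger
    qed
  qed
  show ?thesis
  proof (cases "i = j")
    case False
    then show ?thesis using *[of i j] *[of j i] i j by (metis add.commute linorder_neqE_nat)
  qed simp
qed

subsection \<open>Triangle-free blocks\<close>

lemma cyc_rotate1: "cyc xs \<Longrightarrow> cyc (rotate1 xs)"
proof (cases xs)
  case (Cons x ys)
  assume c: "cyc xs"
  then have ne: "ys \<noteq> []" using Cons by (auto simp: cyc_def)
  with c Cons show ?thesis by (auto simp: cyc_def successively_append_iff successively_Cons)
qed (simp add: cyc_def)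

lemma cyc_rotate: "cyc xs \<Longrightarrow> cyc (rotate n xs)"
  by (induction n) (simp_all add: cyc_rotate1)

lemma not_deg3_nbrs:
  assumes "\<not> deg3 T v" "a \<in> T" "b \<in> T" "a \<noteq> b" "adj v a" "adj v b"
  shows "{w \<in> T. adj v w} = {a, b}"
  using assms unfolding deg3_def by blast

text \<open>Colour 1 marks the subdivision vertices, colours 0 and 2 the two classes of \<open>H\<close>; along a path
  starting in \<open>H\<close> the colours follow the 4-periodic pattern \<open>pat\<close> defined below.\<close>

definition tricol :: "'a set \<Rightarrow> ('a \<Rightarrow> nat) \<Rightarrow> 'a set \<Rightarrow> bool" where
  "tricol T k W \<longleftrightarrow> (\<forall>v\<in>W. k v \<le> 2) \<and> (\<forall>u\<in>W. \<forall>v\<in>W. adj u v \<longrightarrow> (k u = 1 \<longleftrightarrow> k v \<noteq> 1)) \<and>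
     (\<forall>e\<in>W. k e = 1 \<longrightarrow> (\<exists>u\<in>W. \<exists>v\<in>W. k u = 0 \<and> k v = 2 \<and> {w \<in> T. adj e w} = {u, v})) \<and>
     conn W \<and> (\<forall>v\<in>W. \<exists>a\<in>W. \<exists>b\<in>W. a \<noteq> b \<and> adj v a \<and> adj v b)"

lemma tricolD:
  assumes "tricol T k W"
  shows "v \<in> W \<Longrightarrow> k v \<le> 2" "u \<in> W \<Longrightarrow> v \<in> W \<Longrightarrow> adj u v \<Longrightarrow> k u = 1 \<longleftrightarrow> k v \<noteq> 1"
    "e \<in> W \<Longrightarrow> k e = 1 \<Longrightarrow> \<exists>u\<in>W. \<exists>v\<in>W. k u = 0 \<and> k v = 2 \<and> {w \<in> T. adj e w} = {u, v}"
    "conn W" "v \<in> W \<Longrightarrow> \<exists>a\<in>W. \<exists>b\<in>W. a \<noteq> b \<and> adj v a \<and> adj v b"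
  using assms unfolding tricol_def by simp_all

lemma tricolI:
  assumes "\<And>v. v \<in> W \<Longrightarrow> k v \<le> 2"
    "\<And>u v. u \<in> W \<Longrightarrow> v \<in> W \<Longrightarrow> adj u v \<Longrightarrow> k u = 1 \<longleftrightarrow> k v \<noteq> 1"
    "\<And>e. e \<in> W \<Longrightarrow> k e = 1 \<Longrightarrow> \<exists>u\<in>W. \<exists>v\<in>W. k u = 0 \<and> k v = 2 \<and> {w \<in> T. adj e w} = {u, v}"
    "conn W" "\<And>v. v \<in> W \<Longrightarrow> \<exists>a\<in>W. \<exists>b\<in>W. a \<noteq> b \<and> adj v a \<and> adj v b"
  shows "tricol T k W"
  unfolding tricol_def using assms by simp

lemma tricol_subdiv_block:
  assumes "tricol T k S"
  shows "subdiv_block T S"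
proof (rule subdiv_blockI)
  note t = tricolD[OF assms]
  let ?X = "{v \<in> S. k v = 0}" and ?Y = "{v \<in> S. k v = 2}" and ?E = "{v \<in> S. k v = 1}"
  show "S = ?X \<union> ?Y \<union> ?E" using t(1) by force
  show "?X \<inter> ?Y = {}" "?X \<inter> ?E = {}" "?Y \<inter> ?E = {}" by auto
  show "u \<in> ?E \<longleftrightarrow> v \<notin> ?E" if "u \<in> S" "v \<in> S" "adj u v" for u v
    using t(2)[OF that] that by simp
  show "\<exists>u\<in>?X. \<exists>v\<in>?Y. {w \<in> T. adj e w} = {u, v}" if "e \<in> ?E" for e
    using t(3)[of e] that by blast
qed

definition pat :: "nat \<Rightarrow> nat \<Rightarrow> nat" where
  "pat r j = (if odd j then 1 else if 4 dvd j then r else 2 - r)"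

lemma pat_1: "r = 0 \<or> r = 2 \<Longrightarrow> pat r j = 1 \<longleftrightarrow> odd j"
  by (auto simp: pat_def)

lemma pat_le: "r \<le> 2 \<Longrightarrow> pat r j \<le> 2"
  by (auto simp: pat_def)

lemma pat_flip: "r = 0 \<or> r = 2 \<Longrightarrow> even j \<Longrightarrow> {pat r j, pat r (j + 2)} = {0, 2}"
proof -
  assume r: "r = 0 \<or> r = 2" and j: "even j"
  have "4 dvd j \<longleftrightarrow> \<not> 4 dvd (j + 2)" using j by presburger
  then show ?thesis using r j by (auto simp: pat_def)
qed

text \<open>Colour 1 occurs at every other vertex. A vertex of colour 1 has just two neighbours, one
  of colour 0 and one of colour 2, so passing through it exchanges 0 and 2.\<close>

lemma tricol_path:
  assumes t: "tricol T k W" and W: "W \<subseteq> T" and p: "path W p" "k (hd p) \<noteq> 1" and i: "i < length p"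
  shows "k (p ! i) = pat (k (hd p)) i"
  using i
proof (induction i rule: less_induct)
  case (less i)
  have d: "distinct p" "set p \<subseteq> W" "successively adj p" "p \<noteq> []" using p by (auto simp: path_def)
  let ?r = "k (hd p)"
  have "hd p \<in> W" using d by auto
  then have "?r \<le> 2" by (rule tricolD(1)[OF t])
  then have r: "?r = 0 \<or> ?r = 2" using p(2) by arith
  have inW: "p ! j \<in> W" if "j < length p" for j using d that by auto
  have ad: "adj (p ! j) (p ! Suc j)" if "Suc j < length p" for j
    using d(3) that by (simp add: successively_conv_nth)
  show ?case
  proof (cases i)
    case 0
    then show ?thesis using d by (simp add: hd_conv_nth pat_def)
  next
    case (Suc j)
    have kj: "k (p ! j) = pat ?r j" using less Suc by simp
    have aj: "adj (p ! j) (p ! i)" using ad[of j] less Suc by simp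
    have opp: "k (p ! j) = 1 \<longleftrightarrow> k (p ! i) \<noteq> 1"
      using tricolD(2)[OF t _ _ aj] inW less Suc by simp
    show ?thesis
    proof (cases "odd i")
      case True
      then have "k (p ! j) \<noteq> 1" using kj Suc pat_1[OF r] by simp
      then show ?thesis using opp True by (simp add: pat_def)
    next
      case False
      then have oj: "odd j" using Suc by simp
      then obtain l where l: "j = Suc l" using odd_pos gr0_conv_Suc by blast
      have el: "even l" using oj l by simp
      have kj1: "k (p ! j) = 1" using kj oj by (simp add: pat_def)
      obtain u v where uv: "k u = 0" "k v = 2" "{w \<in> T. adj (p ! j) w} = {u, v}"
        using tricolD(3)[OF t _ kj1] inW less Suc by (metis Suc_lessD)
      have lb: "l < length p" "j < length p" using l less Suc by auto
      have "p ! l \<in> {w \<in> T. adj (p ! j) w}"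
        using ad[of l] adj_sym l lb W inW[of l] by auto
      moreover have "p ! i \<in> {w \<in> T. adj (p ! j) w}" using aj W inW[of i] less by auto
      moreover have "p ! l \<noteq> p ! i" using d(1) lb less l Suc by (simp add: nth_eq_iff_index_eq)
      ultimately have "{p ! l, p ! i} = {u, v}" using uv(3) by auto
      then have "{k (p ! l), k (p ! i)} = {0, 2}" using uv(1,2) by (metis image_empty image_insert)
      moreover have "k (p ! l) = pat ?r l" using less Suc l by simp
      moreover have "{pat ?r l, pat ?r i} = {0, 2}" using pat_flip[OF r el] Suc l by simp
      ultimately show ?thesis by (metis doubleton_eq_iff)
    qed
  qed
qed

lemma path_conn_mid:
  assumes "successively adj p" "set p \<subseteq> A" "v \<in> set p"
  shows "reach A (hd p) v"
proof -
  obtain xs ys where pe: "p = xs @ v # ys" using split_list[OF assms(3)] by blast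
  have "successively adj (xs @ [v])" using assms(1) by (auto simp: pe successively_append_iff)
  then have "reach A (hd (xs @ [v])) (last (xs @ [v]))"
    by (rule successively_reach) (use assms(2) pe in auto)
  moreover have "hd (xs @ [v]) = hd p" by (cases xs) (auto simp: pe)
  ultimately show ?thesis by simp
qed

lemma conn_path: "path A p \<Longrightarrow> conn (set p)"
  unfolding conn_def
proof (intro conjI ballI)
  assume p: "path A p"
  then show "set p \<noteq> {}" by (simp add: path_def)
  fix u v assume "u \<in> set p" "v \<in> set p"
  then have "reach (set p) (hd p) u" "reach (set p) (hd p) v"
    using p path_conn_mid[of p "set p"] by (auto simp: path_def)
  then show "reach (set p) u v" using reach_sym reach_trans by blast
qed

lemma cycle_exists:
  assumes S: "biconn S" "finite S" "3 \<le> card S"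
  shows "\<exists>xs. cyc xs \<and> set xs \<subseteq> S"
proof -
  obtain a where a: "a \<in> S" using S by (auto simp: biconn_def conn_def)
  obtain b where b: "b \<in> S" "adj a b" using biconn_two_nbrs[OF S a] by blast
  have ab: "a \<noteq> b" using b adj_irrefl by auto
  have "{a, b} \<noteq> S" using S(3) ab by auto
  then obtain p s t where p: "path (S - {a, b}) p" "s \<in> {a, b}" "t \<in> {a, b}" "s \<noteq> t" "adj s (hd p)" "adj (last p) t"
    using ear_exists[OF S(1), of "{a, b}" a b] a b ab by blast
  have st: "adj t s" using p(2-4) b adj_sym by auto
  have d: "p \<noteq> []" "distinct p" "successively adj p" "set p \<subseteq> S - {a, b}" using p(1) by (auto simp: path_def)
  have "cyc (s # p @ [t])"
    unfolding cyc_def using d p(2-6) st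
    by (auto simp: successively_append_iff successively_Cons Suc_le_eq)
  moreover have "set (s # p @ [t]) \<subseteq> S" using d p(2,3) a b by auto
  ultimately show ?thesis by blast
qed

text \<open>If some vertex of a cycle has degree at least three in T, the cycle is rotated to begin
  there. Then the vertices with odd index have degree two and can serve as subdivision vertices, and
  the colour pattern closes up because 4 divides the length. Without such a vertex any starting
  point will do.\<close>

lemma tricol_start:
  assumes hk: "hereditary_konig T" and S: "biconn S" "S \<subseteq> T" "3 \<le> card S" "triangle_free S"
  shows "\<exists>k W. W \<subseteq> S \<and> tricol T k W"
proof -
  have fS: "finite S" using hk S(2) finite_subset unfolding hereditary_konig_def by blast
  obtain xs where xs: "cyc xs" "set xs \<subseteq> S" using cycle_exists[OF S(1) fS S(3)] by blast
  have "\<exists>ys. cyc ys \<and> set ys \<subseteq> S \<and> (\<forall>i<length ys. odd i \<longrightarrow> \<not> deg3 T (ys ! i))"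
  proof (cases "\<exists>i<length xs. deg3 T (xs ! i)")
    case True
    then obtain i0 where i0: "i0 < length xs" "deg3 T (xs ! i0)" by blast
    let ?ys = "rotate i0 xs"
    have c: "cyc ?ys" "set ?ys \<subseteq> S" using cyc_rotate xs by auto
    have T': "set ?ys \<subseteq> T" "triangle_free (set ?ys)" using c S triangle_free_mono by auto
    have pos: "0 < length ?ys" using i0 by (simp add: gr_zeroI) (use i0 in auto)
    have y0: "deg3 T (?ys ! 0)" using i0 pos by (simp add: nth_rotate)
    have "\<not> deg3 T (?ys ! i)" if "i < length ?ys" "odd i" for i
      using cyc_parity[OF hk c(1) T' pos y0 that(1)] that(2) by auto
    then show ?thesis using c by blast
  qed (use xs in blast)
  then obtain ys where ys: "cyc ys" "set ys \<subseteq> S" and nd: "\<And>i. i < length ys \<Longrightarrow> odd i \<Longrightarrow> \<not> deg3 T (ys ! i)" by blast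
  let ?n = "length ys"
  have T': "set ys \<subseteq> T" "triangle_free (set ys)" using ys S triangle_free_mono by auto
  have n4: "4 dvd ?n" using hk_cyc[OF hk ys(1) T'(1)] cyc_not3[OF ys(1) T'(2)] by blast
  have d: "distinct ys" "3 \<le> ?n" using ys by (auto simp: cyc_def)
  have n: "4 \<le> ?n" using n4 d by presburger
  define idx where "idx v = (THE i. i < ?n \<and> ys ! i = v)" for v
  have idx: "idx (ys ! i) = i" if "i < ?n" for i
    unfolding idx_def using that d(1) by (intro the_equality) (auto simp: nth_eq_iff_index_eq)
  define k where "k v = pat 0 (idx v)" for v
  have k: "k (ys ! i) = pat 0 i" if "i < ?n" for i using idx that by (simp add: k_def)
  have par: "even (Suc i mod ?n) \<longleftrightarrow> odd i" if "i < ?n" for i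
  proof (cases "Suc i = ?n")
    case True
    then have "Suc i mod ?n = 0" by simp
    moreover have "even (Suc i)" using True n4 by presburger
    ultimately show ?thesis by simp
  next
    case False
    then show ?thesis using that by simp
  qed
  have "tricol T k (set ys)"
  proof (rule tricolI)
    fix v assume "v \<in> set ys" then show "k v \<le> 2" by (simp add: k_def pat_le)
  next
    fix u v assume uv: "u \<in> set ys" "v \<in> set ys" "adj u v"
    then obtain i j where ij: "i < ?n" "u = ys ! i" "j < ?n" "v = ys ! j" by (metis in_set_conv_nth)
    then have "j = Suc i mod ?n \<or> i = Suc j mod ?n" using cyc_nbr[OF hk ys(1) T'] uv by blast
    then have "odd i \<longleftrightarrow> even j" using par ij by blast
    then show "k u = 1 \<longleftrightarrow> k v \<noteq> 1" using k ij pat_1[of 0] by simp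
  next
    fix e assume e: "e \<in> set ys" "k e = 1"
    then obtain i where i: "i < ?n" "e = ys ! i" by (metis in_set_conv_nth)
    then have oi: "odd i" using e(2) k pat_1[of 0 i] by simp
    then obtain l where l: "i = Suc l" using odd_pos gr0_conv_Suc by blast
    have el: "even l" using oi l by simp
    let ?j = "Suc i mod ?n"
    have jn: "?j < ?n" using n by (intro mod_less_divisor) linarith
    have a1: "adj e (ys ! l)" using cyc_nth[OF ys(1), of l] i l adj_sym by auto
    have a2: "adj e (ys ! ?j)" using cyc_nth[OF ys(1) i(1)] i by simp
    have "l \<noteq> ?j" using i(1) l n by (cases "Suc i = ?n") auto
    then have ne: "ys ! l \<noteq> ys ! ?j" using d(1) i l jn by (simp add: nth_eq_iff_index_eq)
    have inT: "ys ! l \<in> set ys" "ys ! ?j \<in> set ys" using i l jn by auto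
    have nb: "{w \<in> T. adj e w} = {ys ! l, ys ! ?j}"
      using not_deg3_nbrs[OF _ _ _ ne a1 a2] nd[OF i(1) oi] i(2) inT T'(1) by blast
    have "pat 0 ?j = pat 0 (l + 2)"
    proof (cases "Suc i = ?n")
      case True
      then have "4 dvd l + 2" using n4 l by simp
      then show ?thesis using True el by (simp add: pat_def)
    next
      case False
      then show ?thesis using i l by simp
    qed
    then have "{k (ys ! l), k (ys ! ?j)} = {0, 2}"
      using pat_flip[of 0 l] el k[of l] k[OF jn] i l by simp
    then have "k (ys ! l) = 0 \<and> k (ys ! ?j) = 2 \<or> k (ys ! l) = 2 \<and> k (ys ! ?j) = 0"
      by (auto simp: doubleton_eq_iff)
    then show "\<exists>u\<in>set ys. \<exists>v\<in>set ys. k u = 0 \<and> k v = 2 \<and> {w \<in> T. adj e w} = {u, v}"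
    proof (elim disjE conjE)
      assume "k (ys ! l) = 2" "k (ys ! ?j) = 0"
      moreover have "{w \<in> T. adj e w} = {ys ! ?j, ys ! l}" using nb by (simp add: insert_commute)
      ultimately show ?thesis using inT by blast
    qed (use nb inT in blast)
  next
    have "path S ys" using ys by (auto simp: path_def cyc_def)
    then show "conn (set ys)" by (rule conn_path)
  next
    fix v assume "v \<in> set ys"
    then obtain i where i: "i < ?n" "v = ys ! i" by (metis in_set_conv_nth)
    let ?j = "Suc i mod ?n"
    have jn: "?j < ?n" using n by (intro mod_less_divisor) linarith
    have a2: "adj v (ys ! ?j)" using cyc_nth[OF ys(1) i(1)] i by simp
    define l where "l = (if i = 0 then ?n - 1 else i - 1)"
    have l: "l < ?n" "i = Suc l mod ?n" using i n by (auto simp: l_def)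
    have a1: "adj v (ys ! l)" using cyc_nth[OF ys(1) l(1)] l(2) i adj_sym by auto
    have "l \<noteq> ?j" using i(1) n by (cases "Suc i = ?n") (auto simp: l_def)
    then have "ys ! l \<noteq> ys ! ?j" using d(1) l jn by (simp add: nth_eq_iff_index_eq)
    then show "\<exists>a\<in>set ys. \<exists>b\<in>set ys. a \<noteq> b \<and> adj v a \<and> adj v b"
      using a1 a2 l jn nth_mem by blast
  qed
  then show ?thesis using ys(2) by blast
qed


section \<open>Shortest ears and the extension of a colouring\<close>

lemma reach_union_path:
  assumes "conn W" "path A p" "s \<in> W" "adj s (hd p)"
  shows "conn (W \<union> set p)"
  using assms(1)
proof (rule conn_attach)
  fix v assume v: "v \<in> W \<union> set p"
  show "\<exists>w\<in>W. reach (W \<union> set p) v w"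
  proof (cases "v \<in> W")
    case True
    then show ?thesis using reach_refl[of v "W \<union> set p"] by blast
  next
    case False
    then have "reach (W \<union> set p) (hd p) v"
      using v assms(2) by (intro path_conn_mid) (auto simp: path_def)
    moreover have "reach (W \<union> set p) s (hd p)"
      using assms reach_in[OF calculation] by (intro reach_edge) auto
    ultimately have "reach (W \<union> set p) v s" using reach_trans reach_sym by blast
    then show ?thesis using assms(3) by blast
  qed
qed simp

definition ear :: "'a set \<Rightarrow> 'a set \<Rightarrow> 'a list \<Rightarrow> 'a \<Rightarrow> 'a \<Rightarrow> bool" where
  "ear S W p s t \<longleftrightarrow> path (S - W) p \<and> s \<in> W \<and> t \<in> W \<and> s \<noteq> t \<and> adj s (hd p) \<and> adj (last p) t"

text \<open>This and the next two lemmas cut an ear short at an edge to W or along a chord; they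
  turn minimality of an ear into the absence of such edges.\<close>

lemma ear_take:
  assumes e: "ear S W p s t" and i: "i < length p" and v: "v \<in> W" "v \<noteq> s" "adj (p ! i) v"
  shows "ear S W (take (Suc i) p) s v"
proof -
  have p: "p \<noteq> []" "distinct p" "set p \<subseteq> S - W" "successively adj p"
    using e by (auto simp: ear_def path_def)
  have "hd (take (Suc i) p) = hd p" using p by (cases p) auto
  moreover have "last (take (Suc i) p) = p ! i" using i by (simp add: take_Suc_conv_app_nth)
  moreover have "set (take (Suc i) p) \<subseteq> S - W" using p(3) set_take_subset by (rule subset_trans[rotated])
  ultimately show ?thesis using e p v unfolding ear_def path_def
    by (simp add: successively_take)
qed

lemma ear_drop:
  assumes e: "ear S W p s t" and i: "i < length p" and v: "v \<in> W" "v \<noteq> t" "adj v (p ! i)"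
  shows "ear S W (drop i p) v t"
proof -
  have p: "p \<noteq> []" "distinct p" "set p \<subseteq> S - W" "successively adj p"
    using e by (auto simp: ear_def path_def)
  have "hd (drop i p) = p ! i" using i by (simp add: hd_drop_conv_nth)
  moreover have "last (drop i p) = last p" using i by simp
  moreover have "set (drop i p) \<subseteq> S - W" using p(3) set_drop_subset by (rule subset_trans[rotated])
  ultimately show ?thesis using e p v i unfolding ear_def path_def
    by (simp add: successively_drop)
qed

lemma ear_shortcut:
  assumes e: "ear S W p s t" and ij: "i < j" "j < length p" "adj (p ! i) (p ! j)"
  shows "ear S W (take (Suc i) p @ drop j p) s t"
proof -
  have p: "p \<noteq> []" "distinct p" "set p \<subseteq> S - W" "successively adj p"
    using e by (auto simp: ear_def path_def)
  have "hd (take (Suc i) p @ drop j p) = hd p" using p by (cases p) auto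
  moreover have "last (take (Suc i) p @ drop j p) = last p" using ij by simp
  moreover have "set (take (Suc i) p @ drop j p) \<subseteq> S - W"
    using p(3) set_drop_subset[of j p] set_take_subset[of "Suc i" p] by auto
  moreover have "last (take (Suc i) p) = p ! i" using ij by (simp add: take_Suc_conv_app_nth)
  moreover have "hd (drop j p) = p ! j" using ij by (simp add: hd_drop_conv_nth)
  moreover have "distinct (take (Suc i) p @ drop j p)"
    using p(2) ij by (auto simp: set_take_disj_set_drop_if_distinct simp del: take_Suc)
  ultimately show ?thesis using e p ij unfolding ear_def path_def
    by (simp add: successively_append_iff successively_drop successively_take)
qed

text \<open>A shortest ear leaves W at vertices not coloured 1, as the latter have all their
  neighbours in W. Together with a path in W it forms a cycle whose length is a multiple of four, so
  the pattern started at s arrives at \<open>t'\<close> with the colour that \<open>t'\<close>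
  already has. Since s has degree at least three, the ear vertices at odd distance from s have
  degree two by \<open>cyc_parity\<close>.\<close>

lemma tricol_grow:
  assumes hk: "hereditary_konig T" and S: "biconn S" "S \<subseteq> T" "triangle_free S"
    and t: "tricol T k W" and W: "W \<subseteq> S" "W \<noteq> S"
  shows "\<exists>k' W'. W \<subset> W' \<and> W' \<subseteq> S \<and> tricol T k' W'"
proof -
  obtain w where w: "w \<in> W" using tricolD(4)[OF t] by (auto simp: conn_def)
  obtain a b where ab: "a \<in> W" "b \<in> W" "a \<noteq> b" using tricolD(5)[OF t w] by blast
  define Q where "Q n \<longleftrightarrow> (\<exists>p s t. ear S W p s t \<and> length p = n)" for n
  have "\<exists>n. Q n" using ear_exists[OF S(1) W ab] unfolding Q_def ear_def by blast
  then have "Q (LEAST n. Q n)" by (rule LeastI_ex)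
  then obtain p s t' where e: "ear S W p s t'" and lp: "length p = (LEAST n. Q n)"
    unfolding Q_def by blast
  have short: "length p \<le> length p'" if "ear S W p' s' u" for p' s' u
    unfolding lp by (rule Least_le) (use that in \<open>auto simp: Q_def\<close>)
  have p: "p \<noteq> []" "distinct p" "set p \<subseteq> S - W" "successively adj p" "s \<in> W" "t' \<in> W" "s \<noteq> t'"
    "adj s (hd p)" "adj (last p) t'"
    using e by (auto simp: ear_def path_def)
  let ?m = "length p"
  have m: "0 < ?m" using p(1) by simp
  have WT: "W \<subseteq> T" using W S by blast
  have pT: "p ! i \<in> T" "p ! i \<notin> W" "p ! i \<in> S" if "i < ?m" for i using p(3) nth_mem[OF that] S(2) by auto
  have E_nbr: "w \<in> W" if ek: "e \<in> W" "k e = 1" and ew: "w \<in> T" "adj e w" for e w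
  proof -
    obtain u v where "u \<in> W" "v \<in> W" "{w \<in> T. adj e w} = {u, v}" using tricolD(3)[OF t ek] by blast
    moreover have "w \<in> {w \<in> T. adj e w}" using ew by simp
    ultimately show ?thesis by auto
  qed
  have outside: "k v \<noteq> 1" if "v \<in> W" "i < ?m" "adj v (p ! i)" for v i
    using E_nbr[OF that(1) _ _ that(3)] pT[OF that(2)] by blast
  have hdp: "hd p = p ! 0" and lastp: "last p = p ! (?m - 1)" using p(1) by (simp_all add: hd_conv_nth last_conv_nth)
  have ks: "k s \<noteq> 1" using outside[OF p(5) m] p(8) hdp by simp
  have kt: "k t' \<noteq> 1" using outside[OF p(6), of "?m - 1"] p(9) lastp m adj_sym by simp
  have rs: "k s = 0 \<or> k s = 2" using tricolD(1)[OF t p(5)] ks by arith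
  have "reach W s t'" using tricolD(4)[OF t] p(5,6) by (simp add: conn_def)
  then obtain q where q: "path W q" "hd q = s" "last q = t'" using reach_path by blast
  have dq: "q \<noteq> []" "distinct q" "set q \<subseteq> W" "successively adj q" using q(1) by (auto simp: path_def)
  let ?L = "length q - 1"
  have Lq: "length q = ?L + 1" using dq(1) by (cases q) auto
  have L1: "1 \<le> ?L"
  proof (rule ccontr)
    assume "\<not> 1 \<le> ?L"
    then have "length q = 1" using Lq by simp
    then have "hd q = last q" by (cases q) auto
    then show False using q p(7) by simp
  qed
  have kq: "k (q ! i) = pat (k s) i" if "i < length q" for i
    using tricol_path[OF t WT q(1)] that ks q(2) by simp
  have q0: "q ! 0 = s" "q ! ?L = t'" using q dq(1) by (simp_all add: hd_conv_nth last_conv_nth)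
  have kt_pat: "k t' = pat (k s) ?L" using kq[of ?L] q0 Lq by simp
  have eL: "even ?L" using kt kt_pat pat_1[OF rs] by simp
  \<comment> \<open>\<open>?L\<close> counts the edges of q and \<open>?m\<close> the vertices of p,
    so this cycle has \<open>?L + 1 + ?m\<close> vertices. As \<open>?L\<close> is even and 4
    divides the length, \<open>?m\<close> is odd.\<close>
  let ?xs = "q @ rev p"
  have cx: "cyc ?xs"
    unfolding cyc_def
  proof (intro conjI)
    show "distinct ?xs" using dq p(2,3) by auto
    show "3 \<le> length ?xs" unfolding length_append length_rev using L1 Lq m by linarith
    have "successively adj (rev p)"
      using p(4) adj_sym by (simp add: successively_rev successively_mono[of adj])
    then show "successively adj ?xs"
      using dq(1,4) p(1,9) q(3) adj_sym by (simp add: successively_append_iff hd_rev)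
    show "adj (last ?xs) (hd ?xs)" using p(1,8) q(2) dq(1) adj_sym by (simp add: last_rev)
  qed
  have xsS: "set ?xs \<subseteq> S" "set ?xs \<subseteq> T" using dq(3) p(3) W S(2) by auto
  have tfx: "triangle_free (set ?xs)" using S(3) xsS(1) by (rule triangle_free_mono)
  have n4: "4 dvd ?L + 1 + ?m"
    using hk_cyc[OF hk cx xsS(2)] cyc_not3[OF cx tfx] Lq by simp
  have om: "odd ?m" using n4 eL by presburger
  obtain a1 a2 where a12: "a1 \<in> W" "a2 \<in> W" "a1 \<noteq> a2" "adj s a1" "adj s a2" using tricolD(5)[OF t p(5)] by blast
  have s3: "deg3 T s"
    unfolding deg3_def using a12 WT pT[OF m] p(8) hdp by (intro bexI[of _ a1] bexI[of _ a2] bexI[of _ "p ! 0"]) auto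
  \<comment> \<open>Along the ear \<open>p ! i\<close> has distance i + 1 from s, which is odd for
    even i.\<close>
  have nd: "\<not> deg3 T (p ! i)" if i: "i < ?m" "even i" for i
  proof
    assume d: "deg3 T (p ! i)"
    let ?j = "?L + 1 + (?m - 1 - i)"
    have jl: "?j < length ?xs" using i L1 Lq by simp
    have "?xs ! ?j = rev p ! (?m - 1 - i)" using Lq by (simp add: nth_append)
    also have "\<dots> = p ! i" using i by (simp add: rev_nth)
    finally have dj: "deg3 T (?xs ! ?j)" using d by simp
    have "?xs ! 0 = s" using q0(1) dq(1) by (simp add: nth_append)
    then have d0: "deg3 T (?xs ! 0)" using s3 by simp
    have z: "0 < length ?xs" using dq(1) by simp
    have "even (0 + ?j)" by (rule cyc_parity[OF hk cx xsS(2) tfx z d0 jl dj])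
    then show False using i eL om by presburger
  qed
  \<comment> \<open>The ear with both of its ends, indexed by the distance from s; s has index 0 and
    \<open>t'\<close> has index \<open>Suc ?m\<close>.\<close>
  define r where "r j = (if j = 0 then s else if j \<le> ?m then p ! (j - 1) else t')" for j
  have r_in: "r j \<in> W \<union> set p" for j using p m by (auto simp: r_def)
  have r_adj: "adj (r j) (r (Suc j))" if jm: "j \<le> ?m" for j
  proof -
    consider "j = 0" | "0 < j" "j < ?m" | "j = ?m" using jm by linarith
    then show ?thesis
    proof cases
      case 1
      then show ?thesis using p(8) hdp m by (simp add: r_def Suc_le_eq)
    next
      case 2
      then obtain l where "j = Suc l" using gr0_conv_Suc by blast
      then show ?thesis using 2 p(4) by (simp add: r_def successively_conv_nth)
    next
      case 3
      then show ?thesis using p(9) lastp m by (simp add: r_def)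
    qed
  qed
  have r_inj: "i = j" if "r i = r j" "i \<le> Suc ?m" "j \<le> Suc ?m" for i j
  proof -
    have *: "r i \<noteq> r j" if "i < j" "j \<le> Suc ?m" for i j
    proof -
      have pj: "p ! (i - 1) \<noteq> p ! (j - 1)" if "0 < i" "j \<le> ?m"
        using p(2) \<open>i < j\<close> that by (simp add: nth_eq_iff_index_eq)
      have pW: "p ! (l - 1) \<noteq> s" "p ! (l - 1) \<noteq> t'" if "0 < l" "l \<le> ?m" for l
      proof -
        have "l - 1 < ?m" using that by linarith
        from pT(2)[OF this] show "p ! (l - 1) \<noteq> s" "p ! (l - 1) \<noteq> t'" using p(5,6) by metis+
      qed
      show ?thesis using that pj pW[of i] pW[of j] p(7) by (auto simp: r_def)
    qed
    from *[of i j] *[of j i] that show ?thesis by (metis linorder_neqE_nat)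
  qed
  define k' where "k' v = (if v \<in> W then k v else pat (k s) (THE j. 0 < j \<and> j \<le> ?m \<and> v = r j))" for v
  have rW: "r j \<notin> W" if "0 < j" "j \<le> ?m" for j using pT[of "j - 1"] that by (simp add: r_def)
  have k'W: "k' v = k v" if "v \<in> W" for v using that by (simp add: k'_def)
  have k'r: "k' (r j) = pat (k s) j" if jm: "j \<le> Suc ?m" for j
  proof -
    consider "j = 0" | "0 < j" "j \<le> ?m" | "j = Suc ?m" using jm by linarith
    then show ?thesis
    proof cases
      case 1
      then show ?thesis using p(5) by (simp add: r_def k'_def pat_def)
    next
      case 2
      have "(THE j'. 0 < j' \<and> j' \<le> ?m \<and> r j = r j') = j"
        by (rule the_equality) (use 2 r_inj in auto)
      then show ?thesis using rW[OF 2] by (simp add: k'_def)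
    next
      case 3
      then have "k' (r j) = k t'" using p(6) m by (simp add: r_def k'_def)
      also have "\<dots> = pat (k s) ?L" by (rule kt_pat)
      also have "\<dots> = pat (k s) (Suc ?m)"
      proof -
        \<comment> \<open>\<open>?L\<close> and \<open>Suc ?m\<close> are even with a sum divisible
          by four, hence congruent modulo 4: both ways around the cycle give \<open>t'\<close> the
          same colour.\<close>
        have "odd ?L \<longleftrightarrow> odd (Suc ?m)" "4 dvd ?L \<longleftrightarrow> 4 dvd Suc ?m" using n4 by presburger+
        then show ?thesis unfolding pat_def by simp
      qed
      finally show ?thesis using 3 by simp
    qed
  qed
  have pr: "\<exists>j. 0 < j \<and> j \<le> ?m \<and> v = r j" if "v \<in> set p" for v
  proof -
    obtain i where "i < ?m" "v = p ! i" using \<open>v \<in> set p\<close> by (metis in_set_conv_nth)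
    then show ?thesis by (intro exI[of _ "Suc i"]) (simp add: r_def)
  qed
  \<comment> \<open>Minimality of the ear leaves two places for an edge from the ear to W: an edge
    to s starts at the first ear vertex, any other edge at the last one. Both have odd index since
    \<open>?m\<close> is odd.\<close>
  have mixed: "odd j \<and> k v \<noteq> 1" if j: "0 < j" "j \<le> ?m" and v: "v \<in> W" "adj (r j) v" for j v
  proof -
    have rj: "r j = p ! (j - 1)" "j - 1 < ?m" using j by (auto simp: r_def)
    have kv: "k v \<noteq> 1" using outside[OF v(1) rj(2)] v(2) rj(1) adj_sym by simp
    show ?thesis
    proof (cases "v = s")
      case False
      have "ear S W (take (Suc (j - 1)) p) s v"
        by (rule ear_take[OF e rj(2) v(1) False]) (use v rj in simp)
      then have "?m \<le> j" using short[of "take (Suc (j - 1)) p" s v] j by simp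
      then show ?thesis using om j kv by simp
    next
      case True
      have "ear S W (drop (j - 1) p) v t'"
        by (rule ear_drop[OF e rj(2) v(1)]) (use True p(7) v rj adj_sym in auto)
      then have "j = 1" using short[of "drop (j - 1) p" v t'] j by simp
      then show ?thesis using kv by simp
    qed
  qed
  have inner: "j = Suc i" if ij: "0 < i" "i < j" "j \<le> ?m" "adj (r i) (r j)" for i j
  proof (rule ccontr)
    assume no: "j \<noteq> Suc i"
    have "ear S W (take (Suc (i - 1)) p @ drop (j - 1) p) s t'"
      by (rule ear_shortcut[OF e]) (use ij in \<open>auto simp: r_def\<close>)
    then have "?m \<le> length (take (Suc (i - 1)) p @ drop (j - 1) p)" by (rule short)
    then show False using ij no by simp
  qed
  have "tricol T k' (W \<union> set p)"
  proof (rule tricolI)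
    fix v assume "v \<in> W \<union> set p"
    then show "k' v \<le> 2" using tricolD(1)[OF t] pat_le[of "k s"] tricolD(1)[OF t p(5)] by (auto simp: k'_def)
  next
    fix u v assume uv: "u \<in> W \<union> set p" "v \<in> W \<union> set p" "adj u v"
    have vu: "adj v u" using uv(3) by (rule adj_sym)
    show "k' u = 1 \<longleftrightarrow> k' v \<noteq> 1"
    proof (cases "u \<in> W")
      case uW: True
      show ?thesis
      proof (cases "v \<in> W")
        case True
        then show ?thesis using tricolD(2)[OF t uW True uv(3)] uW k'W by simp
      next
        case False
        then obtain j where j: "0 < j" "j \<le> ?m" "v = r j" using pr uv by blast
        then show ?thesis using mixed[of j u] vu uW k'W k'r[of j] pat_1[OF rs] by simp
      qed
    next
      case False
      then obtain i where i: "0 < i" "i \<le> ?m" "u = r i" using pr uv by blast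
      show ?thesis
      proof (cases "v \<in> W")
        case True
        then show ?thesis using mixed[of i v] i uv(3) k'W k'r[of i] pat_1[OF rs] by simp
      next
        case False
        then obtain j where j: "0 < j" "j \<le> ?m" "v = r j" using pr uv by blast
        have "i \<noteq> j" using uv(3) i j adj_irrefl by auto
        then have "j = Suc i \<or> i = Suc j"
          using inner[of i j] inner[of j i] i j uv(3) vu by (metis linorder_neqE_nat)
        then have "odd i \<longleftrightarrow> even j" by auto
        then show ?thesis using i j k'r[of i] k'r[of j] pat_1[OF rs] by simp
      qed
    qed
  next
    fix e assume e: "e \<in> W \<union> set p" "k' e = 1"
    show "\<exists>u\<in>W \<union> set p. \<exists>v\<in>W \<union> set p. k' u = 0 \<and> k' v = 2 \<and> {w \<in> T. adj e w} = {u, v}"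
    proof (cases "e \<in> W")
      case True
      then have "k e = 1" using e k'W by simp
      then obtain u v where "u \<in> W" "v \<in> W" "k u = 0" "k v = 2" "{w \<in> T. adj e w} = {u, v}"
        using tricolD(3)[OF t True] by blast
      then show ?thesis using k'W by (intro bexI[of _ u] bexI[of _ v]) auto
    next
      case False
      then obtain j where j: "0 < j" "j \<le> ?m" "e = r j" using pr e by blast
      then have oj: "odd j" using e(2) k'r[of j] pat_1[OF rs] by simp
      obtain l where l: "j = Suc l" using j(1) gr0_conv_Suc by blast
      have el: "even l" using oj l by simp
      have a1: "adj e (r l)" using r_adj[of l] j l adj_sym by simp
      have a2: "adj e (r (Suc j))" using r_adj[of j] j by simp
      have ne: "r l \<noteq> r (Suc j)" using r_inj[of l "Suc j"] j l by auto
      have rT: "r i \<in> T" for i using r_in[of i] WT p(3) S(2) by blast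
      have "\<not> deg3 T e" using nd[of "j - 1"] j oj by (simp add: r_def)
      then have nb: "{w \<in> T. adj e w} = {r l, r (Suc j)}"
        using not_deg3_nbrs[OF _ rT rT ne a1 a2] by blast
      have "{k' (r l), k' (r (Suc j))} = {0, 2}"
        using pat_flip[OF rs el] k'r[of l] k'r[of "Suc j"] j l by simp
      then have "k' (r l) = 0 \<and> k' (r (Suc j)) = 2 \<or> k' (r l) = 2 \<and> k' (r (Suc j)) = 0"
        by (auto simp: doubleton_eq_iff)
      then show ?thesis
      proof (elim disjE conjE)
        assume "k' (r l) = 2" "k' (r (Suc j)) = 0"
        moreover have "{w \<in> T. adj e w} = {r (Suc j), r l}" using nb by (simp add: insert_commute)
        ultimately show ?thesis using r_in by blast
      qed (use nb r_in in blast)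
    qed
  next
    show "conn (W \<union> set p)"
      using reach_union_path[OF tricolD(4)[OF t] _ p(5,8)] e by (auto simp: ear_def)
  next
    fix v assume v: "v \<in> W \<union> set p"
    show "\<exists>a\<in>W \<union> set p. \<exists>b\<in>W \<union> set p. a \<noteq> b \<and> adj v a \<and> adj v b"
    proof (cases "v \<in> W")
      case True
      then show ?thesis using tricolD(5)[OF t True] by blast
    next
      case False
      then obtain j where j: "0 < j" "j \<le> ?m" "v = r j" using pr v by blast
      obtain l where l: "j = Suc l" using j(1) gr0_conv_Suc by blast
      have a1: "adj v (r l)" using r_adj[of l] j l adj_sym by simp
      have a2: "adj v (r (Suc j))" using r_adj[of j] j by simp
      have ne: "r l \<noteq> r (Suc j)" using r_inj[of l "Suc j"] j l by auto
      show ?thesis using a1 a2 ne r_in by blast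
    qed
  qed
  moreover have "W \<subset> W \<union> set p" using p(1,3) by (cases p) auto
  moreover have "W \<union> set p \<subseteq> S" using W p(3) by auto
  ultimately show ?thesis by blast
qed

text \<open>A maximal coloured subset of the block is all of it, since a proper one could be
  enlarged by an ear.\<close>

lemma triangle_free_block_subdiv_block:
  assumes hk: "hereditary_konig T" and S: "biconn S" "S \<subseteq> T" "3 \<le> card S" "triangle_free S"
  shows "subdiv_block T S"
proof -
  have fS: "finite S" using hk S(2) finite_subset unfolding hereditary_konig_def by blast
  let ?F = "{W. W \<subseteq> S \<and> (\<exists>k. tricol T k W)}"
  have "finite ?F" using fS by simp
  moreover have "?F \<noteq> {}" using tricol_start[OF hk S] by blast
  ultimately obtain W where W: "W \<in> ?F" "\<forall>W'\<in>?F. W \<subseteq> W' \<longrightarrow> W = W'"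
    using finite_has_maximal[of ?F] by blast
  then obtain k where k: "tricol T k W" "W \<subseteq> S" by blast
  have "W = S"
  proof (rule ccontr)
    assume "W \<noteq> S"
    then obtain k' W' where "W \<subset> W'" "W' \<subseteq> S" "tricol T k' W'"
      using tricol_grow[OF hk S(1,2,4) k] by blast
    then show False using W(2) by blast
  qed
  then show ?thesis using tricol_subdiv_block k by blast
qed

subsection \<open>Blocks with a triangle\<close>

text \<open>Closing the same path p by different lists L gives several conditions on the length of
  p, which are then played off against each other.\<close>

lemma hk_close:
  assumes hk: "hereditary_konig T" and p: "path T p" and L: "L \<noteq> []" "distinct L" "set L \<subseteq> T" "set L \<inter> set p = {}" "successively adj L"
    and ad: "adj (last p) (hd L)" "adj (last L) (hd p)" and len: "3 \<le> length p + length L"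
  shows "length p + length L = 3 \<or> 4 dvd (length p + length L)"
proof -
  have d: "p \<noteq> []" "distinct p" "set p \<subseteq> T" "successively adj p" using p by (auto simp: path_def)
  have "distinct (p @ L)" using d(2) L(2,4) by auto
  moreover have "successively adj (p @ L)" using d L(1,5) ad(1) by (simp add: successively_append_iff)
  ultimately have "cyc (p @ L)" using d(1) L(1) ad(2) len by (simp add: cyc_def)
  from hk_cyc[OF hk this] d(3) L(3) show ?thesis by simp
qed

lemma not_cyc_length_5: "n = 5 \<Longrightarrow> \<not> (n = (3::nat) \<or> 4 dvd n)"
  by presburger

lemma hk_no5:
  assumes "hereditary_konig T" "{a, b, c, d, e} \<subseteq> T" "distinct [a, b, c, d, e]"
    and "adj a b" "adj b c" "adj c d" "adj d e" "adj e a"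
  shows False
proof -
  have "cyc [a, b, c, d, e]" using assms(3-) by (simp add: cyc_def)
  moreover have "length [a, b, c, d, e] = 5" "set [a, b, c, d, e] \<subseteq> T" using assms(2) by simp_all
  ultimately show False using hk_cyc[OF assms(1)] not_cyc_length_5 by metis
qed

text \<open>Closing the ear by the edge between a and b, or by the detour over c, gives cycles with
  2 and with 3 more vertices than p. Each length is 3 or a multiple of four, which leaves only one
  vertex for p.\<close>

lemma triangle_ear:
  assumes hk: "hereditary_konig T" and p: "path T p" and tri: "{a, b, c} \<subseteq> T" "set p \<inter> {a, b, c} = {}" "adj a b" "adj b c" "adj c a"
    and ad: "adj a (hd p)" "adj (last p) b"
  shows "length p = 1"
proof -
  have m: "1 \<le> length p" using p by (cases p) (auto simp: path_def)
  have ne: "a \<noteq> b" "b \<noteq> c" "c \<noteq> a" using tri adj_irrefl by auto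
  have "length p + length [b, a] = 3 \<or> 4 dvd (length p + length [b, a])"
    by (rule hk_close[OF hk p]) (use tri ne m ad adj_sym in auto)
  moreover have "length p + length [b, c, a] = 3 \<or> 4 dvd (length p + length [b, c, a])"
    by (rule hk_close[OF hk p]) (use tri ne m ad in auto)
  ultimately have "length p + 2 = 3 \<or> 4 dvd (length p + 2)" "length p + 3 = 3 \<or> 4 dvd (length p + 3)"
    by (simp_all add: numeral_eq_Suc)
  then show ?thesis using m by presburger
qed

lemma path_single: "path A p \<Longrightarrow> length p = 1 \<Longrightarrow> \<exists>d\<in>A. p = [d]"
  by (cases p) (auto simp: path_def)

lemma out_distinct:
  assumes "max_biconn T S" "u \<in> S" "v \<in> S" "u \<noteq> v" "reach (T - S) u' v'" "adj u u'" "adj v v'"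
  shows False
  using max_biconn_no_ear[OF assms(1-3,5,6) adj_sym[OF assms(7)]] assms(4) by blast

text \<open>If neither a nor b could be the vertex whose outside neighbours are all pendant, there
  would be paths a a' a'' and b b' b'' leaving the block. Together with a triangle a b q these are
  seven vertices on which no single vertex hits all 4-paths.\<close>

lemma hk_T_block:
  assumes hk: "hereditary_konig T" and S: "max_biconn T S"
    and S4: "S = insert a (insert b Q)" "a \<notin> Q" "b \<notin> Q" "Q \<noteq> {}" "adj a b"
    "\<And>q. q \<in> Q \<Longrightarrow> adj a q" "\<And>q. q \<in> Q \<Longrightarrow> adj b q" "\<And>q r. q \<in> Q \<Longrightarrow> r \<in> Q \<Longrightarrow> \<not> adj q r"
    and at: "attach T S \<subseteq> {a, b}"
  shows "T_block T S"
proof (cases "\<forall>y\<in>T - S. adj b y \<longrightarrow> (\<forall>w\<in>T. adj y w \<longrightarrow> w = b)")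
  case True
  show ?thesis by (rule T_blockI[OF S4 at]) (use True in blast)+
next
  case b: False
  show ?thesis
  proof (cases "\<forall>y\<in>T - S. adj a y \<longrightarrow> (\<forall>w\<in>T. adj y w \<longrightarrow> w = a)")
    case True
    have "S = insert b (insert a Q)" "adj b a" "attach T S \<subseteq> {b, a}" using S4 at adj_sym by auto
    then show ?thesis by (intro T_blockI[OF _ S4(3,2,4) _ S4(7,6,8)]) (use True in blast)+
  next
    case False
    then obtain a' a'' where a': "a' \<in> T - S" "adj a a'" "a'' \<in> T" "adj a' a''" "a'' \<noteq> a" by blast
    obtain b' b'' where b': "b' \<in> T - S" "adj b b'" "b'' \<in> T" "adj b' b''" "b'' \<noteq> b" using b by blast
    obtain q where q: "q \<in> Q" using S4(4) by blast
    have ne: "a \<noteq> b" "a \<noteq> q" "b \<noteq> q" using S4 q by (auto simp: adj_irrefl)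
    have inS: "a \<in> S" "b \<in> S" "q \<in> S" using S4(1) q by auto
    have ST: "S \<subseteq> T" using S by (simp add: max_biconn_def)
    have a''S: "a'' \<in> T - S"
      using out_distinct[OF S inS(1) _ _ reach_refl[OF a'(1)] a'(2) adj_sym[OF a'(4)]] a'(3,5) by blast
    have b''S: "b'' \<in> T - S"
      using out_distinct[OF S inS(2) _ _ reach_refl[OF b'(1)] b'(2) adj_sym[OF b'(4)]] b'(3,5) by blast
    have ra: "reach (T - S) a' a'" "reach (T - S) a' a''" and rb: "reach (T - S) b' b'" "reach (T - S) b'' b'"
      using a' b' a''S b''S adj_sym by (auto intro: reach_refl reach_edge)
    have no: "\<not> reach (T - S) a' b'" using out_distinct[OF S inS(1,2) ne(1) _ a'(2) b'(2)] by blast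
    have ne2: "a' \<noteq> b'" "a' \<noteq> b''" "a'' \<noteq> b'" "a'' \<noteq> b''"
      using no ra rb reach_trans by blast+
    have ne3: "a' \<noteq> a''" "b' \<noteq> b''" using a' b' adj_irrefl by auto
    have o: "v \<notin> {a, b, q}" if "v \<in> T - S" for v using inS that by auto
    note o' = o[OF a'(1)] o[OF a''S] o[OF b'(1)] o[OF b''S]
    have ad: "adj a q" "adj b q" "adj b a" "adj a' a" "adj b' b" "adj a'' a'" "adj b'' b'" using S4 q a' b' adj_sym by auto
    have False
    proof (rule hk_bad[OF hk, of "[a, b, q, a', a'', b', b'']"])
      show "set [a, b, q, a', a'', b', b''] \<subseteq> T" using inS ST a' b' a''S b''S by auto
      show "p4 a'' a' a b" "p4 b'' b' b a" "p4 b'' b' b q" "p4 a'' a' a q"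
        unfolding p4_def using ad S4(5) ne o' by auto
      show "{a'', a', a, b} \<inter> {b'', b', b, a} \<inter> {b'', b', b, q} \<inter> {a'', a', a, q} = {}"
        using ne ne2 ne3 o' by auto
    qed auto
    then show ?thesis ..
  qed
qed

text \<open>An ear of the clique would have one vertex by \<open>triangle_ear\<close> and then lie
  on a cycle of length five with all of the clique. A clique with outside neighbours at two vertices
  is a six-vertex case of \<open>hk_bad\<close>.\<close>

lemma hk_K4:
  assumes hk: "hereditary_konig T" and S: "max_biconn T S" and abqr: "{a, b, q, r} \<subseteq> S" "distinct [a, b, q, r]"
    and cl: "adj a b" "adj a q" "adj a r" "adj b q" "adj b r" "adj q r"
  shows "K4_block T S"
proof -
  let ?W = "{a, b, q, r}"
  have bi: "biconn S" and ST: "S \<subseteq> T" using S by (auto simp: max_biconn_def)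
  have clq: "adj u v" if "u \<in> ?W" "v \<in> ?W" "u \<noteq> v" for u v
    using that cl adj_sym by auto
  have four: "\<exists>x y. ?W = {u, v, x, y} \<and> distinct [u, v, x, y]" if "u \<in> ?W" "v \<in> ?W" "u \<noteq> v" for u v
  proof -
    have "card (?W - {u, v}) = 2" using that abqr(2) by (subst card_Diff_subset) auto
    then obtain x y where xy: "?W - {u, v} = {x, y}" "x \<noteq> y" unfolding card_2_iff by blast
    then have "x \<notin> {u, v}" "y \<notin> {u, v}" by blast+
    moreover have "?W = {u, v} \<union> {x, y}" unfolding xy(1)[symmetric] using that by blast
    then have "?W = {u, v, x, y}" by (simp only: Un_insert_left Un_empty_left)
    ultimately show ?thesis using xy(2) that(3) by (intro exI[of _ x] exI[of _ y]) auto
  qed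
  have SW: "S = ?W"
  proof (rule ccontr)
    assume "S \<noteq> ?W"
    then obtain p s t where p: "path (S - ?W) p" "s \<in> ?W" "t \<in> ?W" "s \<noteq> t" "adj s (hd p)" "adj (last p) t"
      using ear_exists[OF bi abqr(1), of a b] abqr(2) by auto
    obtain x y where xy: "?W = {s, t, x, y}" "distinct [s, t, x, y]" using four[OF p(2-4)] by blast
    have pT: "path T p" "set p \<inter> {s, t, x, y} = {}" using p(1) ST unfolding path_def xy(1) by auto
    have sT: "{s, t, x, y} \<subseteq> T" using abqr(1) ST unfolding xy(1) by blast
    have a: "adj s t" "adj t x" "adj x s" "adj x y" "adj y s" using clq unfolding xy(1) using xy(2) by auto
    have "length p = 1" by (rule triangle_ear[OF hk pT(1), of s t x]) (use pT sT a p in auto)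
    moreover have "length p + length [t, x, y, s] = 3 \<or> 4 dvd (length p + length [t, x, y, s])"
      by (rule hk_close[OF hk pT(1)]) (use pT sT a p xy in auto)
    moreover from calculation have "length p + length [t, x, y, s] = 5" by simp
    ultimately show False using not_cyc_length_5 by blast
  qed
  have one: "u = v" if u: "u \<in> attach T S" and v: "v \<in> attach T S" for u v
  proof (rule ccontr)
    assume uv: "u \<noteq> v"
    obtain u' v' where u': "u \<in> S" "u' \<in> T - S" "adj u u'" and v': "v \<in> S" "v' \<in> T - S" "adj v v'"
      using u v unfolding attach_def by blast
    have ne: "u' \<noteq> v'" using out_distinct[OF S u'(1) v'(1) uv reach_refl[OF u'(2)] u'(3)] v'(3) by blast
    obtain x y where "?W = {u, v, x, y}" and xy2: "distinct [u, v, x, y]"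
      using four[OF u'(1)[unfolded SW] v'(1)[unfolded SW] uv] by blast
    then have xy: "S = {u, v, x, y}" "distinct [u, v, x, y]" using SW by (simp_all only:)
    have a: "adj u v" "adj v u" "adj v x" "adj u x" "adj x y" using clq unfolding SW[symmetric] xy(1) using xy(2) by auto
    have o: "u' \<notin> {u, v, x, y}" "v' \<notin> {u, v, x, y}" using u'(2) v'(2) unfolding xy(1) by auto
    show False
    proof (rule hk_bad[OF hk, of "[u, v, x, y, u', v']"])
      show "set [u, v, x, y, u', v'] \<subseteq> T" using ST u' v' unfolding xy(1) by auto
      \<comment> \<open>Three paths without a common vertex are enough here; the last is repeated to
        fill the fourth place of \<open>hk_bad\<close>.\<close>
      show "p4 v' v x y" "p4 u' u x y" "p4 u' u v v'" "p4 u' u v v'"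
        unfolding p4_def using a xy(2) o u' v' ne adj_sym by auto
      show "{v', v, x, y} \<inter> {u', u, x, y} \<inter> {u', u, v, v'} \<inter> {u', u, v, v'} = {}"
        using xy(2) o ne by auto
    qed auto
  qed
  show ?thesis
  proof (cases "attach T S = {}")
    case True
    then show ?thesis using clq abqr SW by (intro K4_blockI[of S a b q r]) auto
  next
    case False
    then obtain u where u: "u \<in> attach T S" by blast
    then have uW: "u \<in> ?W" using attach_sub SW by blast
    obtain v where v: "v \<in> ?W" "v \<noteq> u" using abqr(2) by auto
    obtain x y where xy: "?W = {u, v, x, y}" "distinct [u, v, x, y]" using four[OF uW v(1) v(2)[symmetric]] by blast
    have "attach T S \<subseteq> {u}" using one u by blast
    then show ?thesis using clq xy SW by (intro K4_blockI[of S u v x y]) auto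
  qed
qed

text \<open>The edge from a to b is chosen with as many common neighbours Q as possible. Unless Q
  contains an edge, which gives a K4, no ear can be added to a, b and Q, so the block is T(|Q|). The
  places of attachment then decide between the types.\<close>

lemma triangle_block:
  assumes hk: "hereditary_konig T" and S: "max_biconn T S" and tri: "a0 \<in> S" "b0 \<in> S" "c0 \<in> S" "adj a0 b0" "adj b0 c0" "adj c0 a0"
  shows "K4_block T S \<or> T2_block T S \<or> T_block T S"
proof -
  have bi: "biconn S" and ST: "S \<subseteq> T" using S by (auto simp: max_biconn_def)
  have fS: "finite S" using hk ST finite_subset unfolding hereditary_konig_def by blast
  define N where "N a b = {q \<in> S. adj a q \<and> adj b q}" for a b
  define base where "base ab \<longleftrightarrow> fst ab \<in> S \<and> snd ab \<in> S \<and> adj (fst ab) (snd ab) \<and> N (fst ab) (snd ab) \<noteq> {}" for ab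
  have "c0 \<in> N a0 b0" using tri adj_sym by (simp add: N_def)
  then have b0: "base (a0, b0)" using tri by (auto simp: base_def)
  have bound: "\<forall>ab. base ab \<longrightarrow> card (N (fst ab) (snd ab)) < Suc (card S)"
    using fS by (auto simp: N_def less_Suc_eq_le intro: card_mono)
  obtain ab where ab: "base ab" "\<forall>cd. base cd \<longrightarrow> card (N (fst cd) (snd cd)) \<le> card (N (fst ab) (snd ab))"
    using ex_has_greatest_nat[OF b0 bound] by (elim exE conjE) (rule that)
  define a b Q where "a = fst ab" and "b = snd ab" and "Q = N a b"
  have aS: "a \<in> S" "b \<in> S" "adj a b" "Q \<noteq> {}" using ab(1) by (auto simp: base_def a_def b_def Q_def)
  have maxQ: "card (N c d) \<le> card Q" if "c \<in> S" "d \<in> S" "adj c d" "N c d \<noteq> {}" for c d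
    using ab(2)[rule_format, of "(c, d)"] that by (simp add: base_def a_def b_def Q_def)
  have Q: "q \<in> S" "adj a q" "adj b q" "adj q a" "adj q b" "q \<noteq> a" "q \<noteq> b" if "q \<in> Q" for q
    using that adj_sym adj_irrefl by (auto simp: Q_def N_def)
  have QI: "q \<in> Q" if "q \<in> S" "adj a q" "adj b q" for q using that by (simp add: Q_def N_def)
  have anb: "a \<noteq> b" "adj b a" using aS adj_irrefl adj_sym by auto
  have nQ: "a \<notin> Q" "b \<notin> Q" using Q by blast+
  show ?thesis
  proof (cases "\<exists>q\<in>Q. \<exists>r\<in>Q. adj q r")
    case True
    then obtain q r where qr: "q \<in> Q" "r \<in> Q" "adj q r" by blast
    then have "q \<noteq> r" using adj_irrefl by auto
    then have "K4_block T S"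
      using hk_K4[OF hk S, of a b q r] aS Q[OF qr(1)] Q[OF qr(2)] qr(3) anb by auto
    then show ?thesis by blast
  next
    case False
    then have Qi: "\<not> adj q r" if "q \<in> Q" "r \<in> Q" for q r using that by blast
    let ?W = "insert a (insert b Q)"
    have WS: "?W \<subseteq> S" using aS Q by auto
    \<comment> \<open>An ear from z, one of a and b, to q in Q consists of one vertex d. If Q had
      another vertex r, then z d q z' r would be a cycle of length five. If not, the edge from z to
      q has the two common neighbours z' and d, against the choice of a and b.\<close>
    have mixed: False if p: "path (S - ?W) p" "adj z (hd p)" "adj (last p) q" and z: "z = a \<and> z' = b \<or> z = b \<and> z' = a"
      and q: "q \<in> Q" for p z z' q
    proof -
      have zz: "z \<in> S" "z' \<in> S" "adj z z'" "adj z' z" "z \<noteq> z'" "z \<notin> Q" "z' \<notin> Q" "z \<noteq> q" "z' \<noteq> q" "adj z q" "adj q z'" "adj q z"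
        using z aS anb nQ Q[OF q] by auto
      have Wz: "?W = insert z (insert z' Q)" using z by auto
      have pT: "path T p" "set p \<inter> {z, q, z'} = {}" using p(1) ST q unfolding Wz path_def by auto
      have "length p = 1"
        by (rule triangle_ear[OF hk pT(1), of z q z']) (use pT(2) zz ST Q[OF q] p in auto)
      then obtain d where d: "p = [d]" "d \<in> S - ?W" using path_single p(1) by blast
      have dd: "adj z d" "adj d q" "d \<in> S" "d \<notin> Q" "d \<noteq> z" "d \<noteq> z'" "d \<noteq> q" using p d q Wz by auto
      have "Q = {q}"
      proof (rule ccontr)
        assume "Q \<noteq> {q}"
        then obtain r where r: "r \<in> Q" "r \<noteq> q" using q by blast
        have rz: "adj z' r" "adj r z" "r \<noteq> z" "r \<noteq> z'" using z Q[OF r(1)] by auto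
        show False
          by (rule hk_no5[OF hk, of z d q z' r]) (use zz dd r rz Q[OF q] Q[OF r(1)] ST in auto)
      qed
      then have "card Q = 1" by simp
      moreover have "{z', d} \<subseteq> N z q" using zz dd adj_sym by (auto simp: N_def)
      then have "card {z', d} \<le> card (N z q)" using fS by (intro card_mono) (auto simp: N_def)
      then have "2 \<le> card (N z q)" using dd(6) by (simp add: card_insert_if split: if_splits)
      moreover have "card (N z q) \<le> card Q"
        using maxQ[of z q] zz Q[OF q] calculation by fastforce
      ultimately show False by simp
    qed
    have SW: "S = ?W"
    proof (rule ccontr)
      assume "S \<noteq> ?W"
      then obtain p s t where p: "path (S - ?W) p" "s \<in> ?W" "t \<in> ?W" "s \<noteq> t" "adj s (hd p)" "adj (last p) t"
        using ear_exists[OF bi WS, of a b] anb by auto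
      have p': "p \<noteq> []" "distinct p" "set p \<subseteq> S - ?W" "successively adj p" using p(1) by (auto simp: path_def)
      have rp: "path (S - ?W) (rev p)" "hd (rev p) = last p" "last (rev p) = hd p"
        using p' adj_sym by (auto simp: path_def successively_rev hd_rev last_rev successively_mono[of adj])
      have pT: "path T p" using p(1) ST by (auto simp: path_def)
      consider "s = a" "t = b" | "s = b" "t = a" | "s \<in> {a, b}" "t \<in> Q" | "s \<in> Q" "t \<in> {a, b}" | "s \<in> Q" "t \<in> Q"
        using p(2-4) by blast
      then show False
      proof cases
        case 1
        obtain q where q: "q \<in> Q" using aS(4) by blast
        have "length p = 1"
          by (rule triangle_ear[OF hk pT, of a b q]) (use p p' 1 q Q[OF q] aS ST in auto)
        then obtain d where d: "p = [d]" "d \<in> S - ?W" using path_single p(1) by blast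
        then show False using QI[of d] p 1 adj_sym by auto
      next
        case 2
        obtain q where q: "q \<in> Q" using aS(4) by blast
        have "length p = 1"
          by (rule triangle_ear[OF hk pT, of b a q]) (use p p' 2 q Q[OF q] aS anb ST in auto)
        then obtain d where d: "p = [d]" "d \<in> S - ?W" using path_single p(1) by blast
        then show False using QI[of d] p 2 adj_sym by auto
      next
        case 3
        then show False using mixed[OF p(1,5,6)] by blast
      next
        case 4
        have "adj t (hd (rev p))" "adj (last (rev p)) s" using p(5,6) adj_sym rp by auto
        then show False using mixed[OF rp(1)] 4 by blast
      next
        case 5
        have m: "1 \<le> length p" using p'(1) by (cases p) auto
        \<comment> \<open>Closing the ear over a alone or over a and b gives two consecutive cycle
          lengths, both larger than three.\<close>
        have "length p + length [t, a, s] = 3 \<or> 4 dvd (length p + length [t, a, s])"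
          by (rule hk_close[OF hk pT]) (use p p' 5 Q[OF 5(1)] Q[OF 5(2)] aS ST m in auto)
        moreover have "length p + length [t, a, b, s] = 3 \<or> 4 dvd (length p + length [t, a, b, s])"
          by (rule hk_close[OF hk pT]) (use p p' 5 Q[OF 5(1)] Q[OF 5(2)] aS anb ST m in auto)
        ultimately have "length p + 3 = 3 \<or> 4 dvd (length p + 3)" "length p + 4 = 3 \<or> 4 dvd (length p + 4)"
          by (simp_all add: numeral_eq_Suc)
        then show False using m by presburger
      qed
    qed
    have t4: "T_block T S" if "attach T S \<subseteq> {a, b}"
      by (rule hk_T_block[OF hk S SW nQ aS(4,3) Q(2,3) Qi that])
    have out: "\<exists>v'\<in>T - S. adj v v' \<and> adj v' v" if "v \<in> attach T S" for v
      using that adj_sym by (auto simp: attach_def)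
    have dist: "v' \<noteq> w'" if "v \<in> S" "w \<in> S" "v \<noteq> w" "v' \<in> T - S" "adj v v'" "adj w w'" for v w v' w'
      using out_distinct[OF S that(1-3) reach_refl[OF that(4)] that(5)] that(6) by blast
    have nS: "v' \<noteq> v" if "v' \<in> T - S" "v \<in> S" for v v' using that by blast
    show ?thesis
    proof (cases "attach T S \<subseteq> {a, b}")
      case True
      then show ?thesis using t4 by blast
    next
      case False
      then obtain q where q: "q \<in> Q" "q \<in> attach T S" using attach_sub[of T S] SW by blast
      note Qq = Q[OF q(1)]
      obtain q' where q': "q' \<in> T - S" "adj q q'" "adj q' q" using out[OF q(2)] by blast
      have q'S: "q' \<noteq> v" if "v \<in> S" for v using nS q'(1) that by blast
      show ?thesis
      proof (cases "Q = {q}")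
        case Q1: True
        have S3: "S = {a, b, q}" using SW Q1 by simp
        \<comment> \<open>Any two vertices of a triangle can be the base of T(1), so it suffices to
          exclude attachments at all three.\<close>
        have "\<not> (a \<in> attach T S \<and> b \<in> attach T S)"
        proof
          assume "a \<in> attach T S \<and> b \<in> attach T S"
          then obtain a' b' where a': "a' \<in> T - S" "adj a a'" "adj a' a" and b': "b' \<in> T - S" "adj b b'" "adj b' b"
            using out by metis
          have ne: "a' \<noteq> b'" "a' \<noteq> q'" "b' \<noteq> q'"
            using dist[OF aS(1,2) anb(1) a'(1,2) b'(2)] dist[OF aS(1) Qq(1) _ a'(1,2) q'(2)]
              dist[OF aS(2) Qq(1) _ b'(1,2) q'(2)] Qq(6,7) by auto
          note nn = nS[OF a'(1)] nS[OF b'(1)]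
          show False
          proof (rule hk_bad[OF hk, of "[a, b, q, a', b', q']"])
            show "set [a, b, q, a', b', q'] \<subseteq> T" using aS Qq a' b' q' ST by auto
            show "p4 b' b q q'" "p4 a' a q q'" "p4 a' a b b'" "p4 a' a b b'"
              unfolding p4_def using aS anb Qq a' b' q' ne q'S nn by auto
            show "{b', b, q, q'} \<inter> {a', a, q, q'} \<inter> {a', a, b, b'} \<inter> {a', a, b, b'} = {}"
              using anb Qq ne aS q'S nn by auto
          qed auto
        qed
        moreover have at: "attach T S \<subseteq> {a, b, q}" using attach_sub[of T S] S3 by simp
        ultimately have "attach T S \<subseteq> {a, q} \<or> attach T S \<subseteq> {b, q}" by blast
        then have "T_block T S"
        proof
          assume at: "attach T S \<subseteq> {a, q}"
          show ?thesis
            by (rule hk_T_block[OF hk S, of a q "{b}"]) (use S3 at aS anb Qq adj_irrefl in auto)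
        next
          assume at: "attach T S \<subseteq> {b, q}"
          show ?thesis
            by (rule hk_T_block[OF hk S, of b q "{a}"]) (use S3 at aS anb Qq adj_irrefl in auto)
        qed
        then show ?thesis by blast
      next
        case Q2: False
        then obtain r where r: "r \<in> Q" "r \<noteq> q" using q by blast
        note Qr = Q[OF r(1)]
        show ?thesis
        proof (cases "Q = {q, r}")
          case False
          then obtain r2 where r2: "r2 \<in> Q" "r2 \<noteq> q" "r2 \<noteq> r" using q r by blast
          note Qr2 = Q[OF r2(1)]
          \<comment> \<open>Three vertices in Q, one of them with an outside neighbour, already
            violate the Koenig property.\<close>
          have False
          proof (rule hk_bad[OF hk, of "[a, b, q, r, r2, q']"])
            show "set [a, b, q, r, r2, q'] \<subseteq> T" using aS Qq Qr Qr2 q' ST by auto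
            show "p4 q' q b r" "p4 r a r2 b" "p4 q' q a r2" "p4 q' q a r2"
              unfolding p4_def using aS anb Qq Qr Qr2 q' q'S r r2 by auto
            show "{q', q, b, r} \<inter> {r, a, r2, b} \<inter> {q', q, a, r2} \<inter> {q', q, a, r2} = {}"
              using anb Qq Qr Qr2 aS q'S r r2 by auto
          qed auto
          then show ?thesis ..
        next
          case Qqr: True
          have S4: "S = {a, b, q, r}" using SW Qqr by simp
          \<comment> \<open>For T(2) attached at q, a further attachment at a, b or r gives six
            vertices to which \<open>hk_bad\<close> applies.\<close>
          have "attach T S \<subseteq> {q}"
          proof
            fix z assume z: "z \<in> attach T S"
            show "z \<in> {q}"
            proof (rule ccontr)
              assume "z \<notin> {q}"
              then have zc: "z = a \<or> z = b \<or> z = r" using z attach_sub[of T S] S4 by auto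
              have zS: "z \<in> S" using zc aS Qr by auto
              obtain z' where z': "z' \<in> T - S" "adj z z'" "adj z' z" using out[OF z] by blast
              have ne: "z' \<noteq> q'" using dist[OF zS Qq(1) _ z'(1,2) q'(2)] \<open>z \<notin> {q}\<close> by auto
              note nn = nS[OF z'(1)]
              have L: "set [a, b, q, r, q', z'] \<subseteq> T" using aS Qq Qr q' z' ST by auto
              from zc show False
              proof (elim disjE)
                assume za: "z = a"
                show False
                proof (rule hk_bad[OF hk L])
                  show "p4 q' q b r" "p4 q' q a z'" "p4 z' a b r" "p4 z' a b r"
                    unfolding p4_def using aS anb Qq Qr q' q'S r z' za ne nn by auto
                  show "{q', q, b, r} \<inter> {q', q, a, z'} \<inter> {z', a, b, r} \<inter> {z', a, b, r} = {}"
                    using anb Qq Qr aS q'S r nn ne by auto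
                qed auto
              next
                assume zb: "z = b"
                show False
                proof (rule hk_bad[OF hk L])
                  show "p4 q' q a r" "p4 q' q b z'" "p4 z' b a r" "p4 z' b a r"
                    unfolding p4_def using aS anb Qq Qr q' q'S r z' zb ne nn by auto
                  show "{q', q, a, r} \<inter> {q', q, b, z'} \<inter> {z', b, a, r} \<inter> {z', b, a, r} = {}"
                    using anb Qq Qr aS q'S r nn ne by auto
                qed auto
              next
                assume zr: "z = r"
                show False
                proof (rule hk_bad[OF hk L])
                  show "p4 q' q b r" "p4 q' q a r" "p4 z' r a b" "p4 q' q a b"
                    unfolding p4_def using aS anb Qq Qr q' q'S r z' zr ne nn by auto
                  show "{q', q, b, r} \<inter> {q', q, a, r} \<inter> {z', r, a, b} \<inter> {q', q, a, b} = {}"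
                    using anb Qq Qr aS q'S r nn ne by auto
                qed auto
              qed
            qed
          qed
          then have "T2_block T S"
            using S4 anb Qq Qr r aS Qi[OF q(1) r(1)] by (intro T2_blockI[of S a b q r]) auto
          then show ?thesis by blast
        qed
      qed
    qed
  qed
qed

theorem hereditary_konig_admissible:
  assumes hk: "hereditary_konig T"
  shows "admissible T"
  unfolding admissible_def
proof (intro allI impI)
  fix S assume S: "max_biconn T S" "3 \<le> card S"
  show "subdiv_block T S \<or> K4_block T S \<or> T2_block T S \<or> T_block T S"
  proof (cases "triangle_free S")
    case True
    then show ?thesis using triangle_free_block_subdiv_block[OF hk] S by (auto simp: max_biconn_def)
  next
    case False
    then show ?thesis using triangle_block[OF hk S(1)] unfolding triangle_free_def by blast
  qed
qed

theorem hereditary_konig_iff: "finite T \<Longrightarrow> hereditary_konig T \<longleftrightarrow> admissible T"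
  using hereditary_konig_admissible admissible_konig admissible_mono finite_subset unfolding hereditary_konig_def by metis

section \<open>Separating vertices of a block and weak duality\<close>

lemma card_reach_classes:
  assumes V: "finite V" "x \<in> V"
  shows "card ((\<lambda>u. {v. reach V u v}) ` V) < card ((\<lambda>u. {v. reach (V - {x}) u v}) ` (V - {x})) \<longleftrightarrow>
    (\<exists>u\<in>V - {x}. \<exists>v\<in>V - {x}. reach V u v \<and> \<not> reach (V - {x}) u v)"
proof -
  define c where "c A u = {v. reach A u v}" for A u
  \<comment> \<open>Deleting x affects only its own class C: the other classes \<open>Out\<close>
    persist, and C is replaced by the classes \<open>In\<close> of C - {x}. The number of classes
    grows exactly if \<open>In\<close> has at least two members.\<close>
  define C where "C = c V x"
  define Out where "Out = c V ` (V - C)"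
  define In where "In = c (V - {x}) ` (C - {x})"
  have CV: "C \<subseteq> V" "x \<in> C" using V reach_in reach_refl by (auto simp: C_def c_def)
  have c_eq: "c V u = c V v" if "reach V u v" for u v
    using that reach_trans reach_sym unfolding c_def by blast
  have out: "c (V - {x}) u = c V u" if u: "u \<in> V - C" for u
  proof -
    have "reach (V - {x}) u v" if r: "reach V u v" for v
      using r
    proof (induction rule: reach.induct)
      case reach_refl
      then show ?case using u CV by (auto intro: reach.reach_refl)
    next
      case (reach_step v w)
      have "w \<noteq> x"
      proof
        assume "w = x"
        then have "reach V u x" using reach_step by (metis reach.reach_step)
        then have "u \<in> C" using reach_sym by (simp add: C_def c_def)
        with u show False by blast
      qed
      then show ?case using reach_step by (auto intro: reach.reach_step)
    qed
    then show ?thesis unfolding c_def using reach_mono[of "V - {x}" u _ V] by blast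
  qed
  have "c V ` V = insert C Out"
  proof -
    have "c V u = C" if "u \<in> C" for u using c_eq[of x u] that by (simp add: C_def c_def)
    then have "c V ` C = {C}" using CV(2) by auto
    moreover have "V = C \<union> (V - C)" using CV by blast
    then have "c V ` V = c V ` C \<union> Out" unfolding Out_def by (metis image_Un)
    ultimately show ?thesis by simp
  qed
  moreover have "C \<notin> Out"
  proof
    assume "C \<in> Out"
    then obtain u where "u \<in> V - C" "C = c V u" by (auto simp: Out_def)
    then show False using reach_refl[of u V] by (auto simp: c_def)
  qed
  ultimately have cV: "card (c V ` V) = Suc (card Out)" using V by (simp add: Out_def)
  have "V - {x} = (V - C) \<union> (C - {x})" using CV by blast
  then have "c (V - {x}) ` (V - {x}) = c (V - {x}) ` (V - C) \<union> In" unfolding In_def by (metis image_Un)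
  also have "c (V - {x}) ` (V - C) = Out" unfolding Out_def using out by (intro image_cong) auto
  finally have un: "c (V - {x}) ` (V - {x}) = Out \<union> In" .
  have "Out \<inter> In = {}"
  proof (rule ccontr)
    assume "Out \<inter> In \<noteq> {}"
    then obtain u w where u: "u \<in> V - C" "w \<in> C - {x}" "c V u = c (V - {x}) w" by (auto simp: Out_def In_def)
    then have "w \<in> c V u" using CV reach_refl[of w "V - {x}"] by (auto simp: c_def)
    then have "reach V x u" using u(2) reach_trans[of V w u x] reach_sym by (auto simp: C_def c_def)
    with u(1) show False by (simp add: C_def c_def)
  qed
  then have cV': "card (c (V - {x}) ` (V - {x})) = card Out + card In"
    unfolding un using V CV finite_subset[OF CV(1)] by (intro card_Un_disjoint) (auto simp: Out_def In_def)
  have finIn: "finite In" using V CV finite_subset[OF CV(1)] by (auto simp: In_def)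
  have "card In \<le> Suc 0 \<longleftrightarrow> (\<forall>p\<in>In. \<forall>q\<in>In. p = q)"
    by (rule card_le_Suc0_iff_eq[OF finIn])
  also have "\<dots> \<longleftrightarrow> (\<forall>u\<in>C - {x}. \<forall>v\<in>C - {x}. c (V - {x}) u = c (V - {x}) v)"
    unfolding In_def by (simp only: ball_simps)
  also have "\<dots> \<longleftrightarrow> (\<forall>u\<in>C - {x}. \<forall>v\<in>C - {x}. reach (V - {x}) u v)"
  proof (intro ball_cong refl)
    fix u v assume "u \<in> C - {x}" "v \<in> C - {x}"
    then have "v \<in> c (V - {x}) v" using CV by (auto simp: c_def intro: reach_refl)
    then show "c (V - {x}) u = c (V - {x}) v \<longleftrightarrow> reach (V - {x}) u v"
      unfolding c_def using reach_trans reach_sym by blast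
  qed
  also have "\<dots> \<longleftrightarrow> \<not> (\<exists>u\<in>V - {x}. \<exists>v\<in>V - {x}. reach V u v \<and> \<not> reach (V - {x}) u v)"
  proof -
    have "u \<in> C \<and> v \<in> C" if uv: "u \<in> V - {x}" "v \<in> V - {x}" "reach V u v" "\<not> reach (V - {x}) u v" for u v
    proof -
      have "u \<in> C"
      proof (rule ccontr)
        assume "u \<notin> C"
        then have "v \<in> c (V - {x}) u" using out[of u] uv by (simp add: c_def)
        with uv(4) show False by (simp add: c_def)
      qed
      then show ?thesis using uv(3) reach_trans unfolding C_def c_def by blast
    qed
    then have 1: "\<not> (\<forall>u\<in>C - {x}. \<forall>v\<in>C - {x}. reach (V - {x}) u v)"
      if "\<exists>u\<in>V - {x}. \<exists>v\<in>V - {x}. reach V u v \<and> \<not> reach (V - {x}) u v"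
      using that by (elim bexE conjE) (metis DiffD2 DiffI)
    have "reach V u v" if "u \<in> C" "v \<in> C" for u v
      using that reach_trans reach_sym unfolding C_def c_def by blast
    then have 2: "\<exists>u\<in>V - {x}. \<exists>v\<in>V - {x}. reach V u v \<and> \<not> reach (V - {x}) u v"
      if "u \<in> C - {x}" "v \<in> C - {x}" "\<not> reach (V - {x}) u v" for u v
      using that CV(1) by (intro bexI[of _ u] bexI[of _ v]) auto
    from 1 2 show ?thesis by metis
  qed
  finally show ?thesis using cV cV' unfolding c_def by linarith
qed

text \<open>If all neighbours of x lie in S, they are connected in S - {x}, and every walk through x
  can be rerouted. A neighbour outside S, on the other hand, is separated by x from the rest of S,
  since a path avoiding x would close an ear.\<close>

lemma max_biconn_cut:
  assumes S: "max_biconn V S" "finite V" and x: "x \<in> S" and card: "2 \<le> card S"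
  shows "(\<exists>u\<in>V - {x}. \<exists>v\<in>V - {x}. reach V u v \<and> \<not> reach (V - {x}) u v) \<longleftrightarrow> x \<in> attach V S"
proof
  have SV: "S \<subseteq> V" "biconn S" using S by (auto simp: max_biconn_def)
  assume "\<exists>u\<in>V - {x}. \<exists>v\<in>V - {x}. reach V u v \<and> \<not> reach (V - {x}) u v"
  then obtain u v where uv: "u \<in> V - {x}" "v \<in> V - {x}" "reach V u v" "\<not> reach (V - {x}) u v" by blast
  show "x \<in> attach V S"
  proof (rule ccontr)
    assume no: "x \<notin> attach V S"
    have nb: "w \<in> S - {x}" if "w \<in> V" "adj x w" for w
      using no that attachI[OF x] adj_irrefl by blast
    \<comment> \<open>The vertices reachable from u without x, and x itself if adjacent to one of
      them. This set is sealed in V, so v would belong to it.\<close>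
    define Z where "Z = {w. reach (V - {x}) u w} \<union> {w. w = x \<and> (\<exists>y. reach (V - {x}) u y \<and> adj x y)}"
    have "sealed V Z"
      unfolding sealed_def
    proof (intro ballI impI)
      fix w z assume w: "w \<in> Z" "z \<in> V" "adj w z"
      show "z \<in> Z"
      proof (cases "w = x")
        case True
        then obtain y where y: "reach (V - {x}) u y" "adj x y" using w(1) reach_in by (auto simp: Z_def)
        have "y \<in> S - {x}" "z \<in> S - {x}" using nb y w True reach_in by blast+
        then have "reach (S - {x}) y z"
          using biconn_minus[OF SV(2), of y x] unfolding conn_def by blast
        then have "reach (V - {x}) y z" by (rule reach_mono) (use SV in auto)
        then have "reach (V - {x}) u z" using y(1) by (rule reach_trans)
        then show ?thesis by (simp add: Z_def)
      next
        case False
        then have r: "reach (V - {x}) u w" using w(1) by (simp add: Z_def)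
        show ?thesis
        proof (cases "z = x")
          case True
          then show ?thesis using r w(3) adj_sym by (auto simp: Z_def)
        next
          case False
          then show ?thesis using r w reach_step[of "V - {x}" u w z] by (simp add: Z_def)
        qed
      qed
    qed
    moreover have "u \<in> Z" using uv by (auto simp: Z_def intro: reach_refl)
    ultimately have "v \<in> Z" using reach_sealed[OF uv(3)] by blast
    then show False using uv by (simp add: Z_def)
  qed
next
  have SV: "S \<subseteq> V" "biconn S" using S by (auto simp: max_biconn_def)
  assume "x \<in> attach V S"
  then obtain y where y: "y \<in> V - S" "adj x y" by (auto simp: attach_def)
  have "card (S - {x}) \<noteq> 0" using card x by simp
  then obtain s where s: "s \<in> S" "s \<noteq> x" by (metis card.empty ex_in_conv DiffE singletonI)
  have "reach S x s" using SV(2) x s by (auto simp: biconn_def conn_def)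
  then have "reach V x s" using SV(1) by (rule reach_mono)
  moreover have "reach V y x" using y x SV adj_sym by (intro reach_edge) auto
  ultimately have "reach V y s" using reach_trans by blast
  moreover have "\<not> reach (V - {x}) y s"
  proof
    assume "reach (V - {x}) y s"
    then obtain w t where w: "reach (V - {x} - S) y w" "adj w t" "t \<in> S" "t \<in> V - {x}"
      using reach_first_hit[of "V - {x}" y s S] y s by blast
    have "V - {x} - S = V - S" using x by blast
    then have "x = t" using max_biconn_no_ear[OF S(1) x w(3) _ y(2) w(2)] w(1) by simp
    with w(4) show False by blast
  qed
  ultimately show "\<exists>u\<in>V - {x}. \<exists>v\<in>V - {x}. reach V u v \<and> \<not> reach (V - {x}) u v"
    using y s x SV by blast
qed

lemma weak_duality:
  assumes P: "packing T P" and X: "hits T X"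
  shows "card P \<le> card X"
proof -
  have ex: "\<exists>x. x \<in> A \<and> x \<in> X" if A: "A \<in> P" for A
  proof -
    obtain a b c d where A4: "A = {a, b, c, d}" "p4 a b c d" using packingD(3)[OF P A] by blast
    then have "\<not> {a, b, c, d} \<inter> X = {}" using hitsD[OF X A4(2)] packingD(2)[OF P A] by (intro notI) simp
    then show ?thesis unfolding A4(1) by blast
  qed
  define h where "h A = (SOME x. x \<in> A \<and> x \<in> X)" for A
  have h: "h A \<in> A" "h A \<in> X" if "A \<in> P" for A
    using someI_ex[OF ex[OF that]] by (simp_all add: h_def)
  have "inj_on h P"
  proof (rule inj_onI)
    fix A B assume AB: "A \<in> P" "B \<in> P" "h A = h B"
    then have "A \<inter> B \<noteq> {}" using h(1)[of A] h(1)[of B] by auto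
    then show "A = B" using packingD(4)[OF P AB(1,2)] by blast
  qed
  moreover have "h ` P \<subseteq> X" using h by blast
  moreover have "finite X" using X by (simp add: hits_def)
  ultimately show ?thesis by (rule card_inj_on_le)
qed

end

subsection \<open>Graphs, blocks and cutvertices\<close>

lemma induced_simps [simp]:
  "verts (induced G S) = verts G \<inter> S"
  "{u, v} \<in> edges (induced G S) \<longleftrightarrow> {u, v} \<in> edges G \<and> u \<in> S \<and> v \<in> S"
  by (auto simp: induced_def)

lemma complete_graph_edge: "{i, j} \<in> edges (complete_graph n) \<longleftrightarrow> i < n \<and> j < n \<and> i \<noteq> j"
  unfolding complete_graph_def by (auto simp: doubleton_eq_iff)

lemma complete_graph_verts: "verts (complete_graph n) = {..<n}"
  by (simp add: complete_graph_def)

lemma T_graph_verts: "verts (T_graph p) = Inl ` {..<2} \<union> Inr ` {..<p}"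
  by (simp add: T_graph_def complete_bipartite_def Plus_def)

lemma T_graph_edge:
  "{Inl i, Inl j} \<in> edges (T_graph p) \<longleftrightarrow> {i, j} = {0, 1}"
  "{Inl i, Inr k} \<in> edges (T_graph p) \<longleftrightarrow> i < 2 \<and> k < p"
  "{Inr k, Inl i} \<in> edges (T_graph p) \<longleftrightarrow> i < 2 \<and> k < p"
  "{Inr k, Inr l} \<notin> edges (T_graph p)"
  "{Inl i} \<notin> edges (T_graph p)"
  unfolding T_graph_def complete_bipartite_def by (auto simp: doubleton_eq_iff)

lemma Sub2_verts: "verts (Sub 2 H) = Orig ` mverts H \<union> (\<lambda>e. Inner e 1) ` medges H"
proof -
  have "verts (Sub 2 H) = Orig ` mverts H \<union> {Inner e i | e i. e \<in> medges H \<and> 0 < i \<and> i < 2}"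
    by (simp add: Sub_def)
  also have "{Inner e i | e i. e \<in> medges H \<and> 0 < i \<and> i < 2} = (\<lambda>e. Inner e 1) ` medges H"
    by (auto simp: less_2_cases_iff)
  finally show ?thesis .
qed

lemma Sub2_edge:
  "{u, v} \<in> edges (Sub 2 H) \<longleftrightarrow> (\<exists>e\<in>medges H.
     (u = Inner e 1 \<and> v \<in> {Orig (fst (mends H e)), Orig (snd (mends H e))}) \<or>
     (v = Inner e 1 \<and> u \<in> {Orig (fst (mends H e)), Orig (snd (mends H e))}))"
proof -
  have "{u, v} \<in> edges (Sub 2 H) \<longleftrightarrow>
      (\<exists>e i. e \<in> medges H \<and> i < 2 \<and> {u, v} = {sub_pos 2 H e i, sub_pos 2 H e (Suc i)})"
    by (auto simp: Sub_def)
  also have "\<dots> \<longleftrightarrow> (\<exists>e\<in>medges H. {u, v} = {Orig (fst (mends H e)), Inner e 1} \<or>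
      {u, v} = {Inner e 1, Orig (snd (mends H e))})"
    by (auto simp: less_2_cases_iff sub_pos_def numeral_2_eq_2)
  also have "\<dots> \<longleftrightarrow> (\<exists>e\<in>medges H.
     (u = Inner e 1 \<and> v \<in> {Orig (fst (mends H e)), Orig (snd (mends H e))}) \<or>
     (v = Inner e 1 \<and> u \<in> {Orig (fst (mends H e)), Orig (snd (mends H e))}))"
    by (intro bex_cong refl) (auto simp: doubleton_eq_iff)
  finally show ?thesis .
qed

text \<open>Blocks and components are subgraphs with edge sets of their own, whereas the locale
  \<open>graph\<close> varies only the vertex set. A subgraph is therefore treated as a second
  instance of the locale, and transfer lemmas compare the two.\<close>

locale sgraph =
  fixes G :: "'a ugraph"
  assumes simple: "simple_graph G"
begin

lemma edge_in:
  assumes "{u, v} \<in> edges G"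
  shows "u \<in> verts G" "v \<in> verts G" "u \<noteq> v"
proof -
  obtain a b where "a \<in> verts G" "b \<in> verts G" "a \<noteq> b" "{u, v} = {a, b}"
    using simple assms unfolding simple_graph_def by blast
  then show "u \<in> verts G" "v \<in> verts G" "u \<noteq> v" by (auto simp: doubleton_eq_iff)
qed

sublocale graph "\<lambda>u v. {u, v} \<in> edges G"
proof
  show "{v, u} \<in> edges G" if "{u, v} \<in> edges G" for u v using that by (simp add: insert_commute)
  show "{u, u} \<notin> edges G" for u using edge_in(3) by blast
qed

lemma fin: "finite (verts G)"
  using simple by (simp add: simple_graph_def)

lemma simple_induced: "simple_graph (induced G S)"
  unfolding simple_graph_def
proof (intro conjI ballI)
  show "finite (verts (induced G S))" using fin by simp
  fix e assume e: "e \<in> edges (induced G S)"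
  then have "e \<in> edges G" "e \<subseteq> S" by (auto simp: induced_def)
  then obtain u v where "u \<in> verts G" "v \<in> verts G" "u \<noteq> v" "e = {u, v}"
    using simple unfolding simple_graph_def by blast
  then show "\<exists>u\<in>verts (induced G S). \<exists>v\<in>verts (induced G S). u \<noteq> v \<and> e = {u, v}"
    using \<open>e \<subseteq> S\<close> by auto
qed

lemma induced_sgraph: "sgraph (induced G S)"
  by unfold_locales (rule simple_induced)

lemma reach_rtrancl: "reach (verts G) u v \<longleftrightarrow> u \<in> verts G \<and> (u, v) \<in> {(x, y). {x, y} \<in> edges G}\<^sup>*"
proof
  assume "reach (verts G) u v"
  then show "u \<in> verts G \<and> (u, v) \<in> {(x, y). {x, y} \<in> edges G}\<^sup>*"
    by (induction rule: reach.induct) (auto intro: rtrancl_into_rtrancl)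
next
  assume "u \<in> verts G \<and> (u, v) \<in> {(x, y). {x, y} \<in> edges G}\<^sup>*"
  then have "(u, v) \<in> {(x, y). {x, y} \<in> edges G}\<^sup>*" "u \<in> verts G" by auto
  then show "reach (verts G) u v"
    by (induction rule: rtrancl_induct) (auto intro: reach_refl reach_step edge_in)
qed

lemma connected_conn: "connected_graph G \<longleftrightarrow> conn (verts G)"
  unfolding connected_graph_def conn_def reach_rtrancl by blast

lemma reach_subgraph:
  assumes D: "sgraph D" "edges D \<subseteq> edges G" "A \<subseteq> A'"
    and r: "graph.reach (\<lambda>u v. {u, v} \<in> edges D) A u v"
  shows "reach A' u v"
proof -
  interpret D: sgraph D by fact
  from r show ?thesis
    by (induction rule: D.reach.induct) (use D in \<open>auto intro: reach_refl reach_step\<close>)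
qed

lemma reach_induced:
  assumes "A \<subseteq> S"
  shows "graph.reach (\<lambda>u v. {u, v} \<in> edges (induced G S)) A = reach A"
proof (intro ext iffI)
  interpret D: sgraph "induced G S" by (rule induced_sgraph)
  have sub: "edges (induced G S) \<subseteq> edges G" by (auto simp: induced_def)
  fix u v
  {
    assume "D.reach A u v"
    then show "reach A u v" by (rule reach_subgraph[OF induced_sgraph sub order_refl])
  next
    assume "reach A u v"
    then show "D.reach A u v"
    proof (induction rule: reach.induct)
      case reach_refl
      then show ?case by (rule D.reach_refl)
    next
      case (reach_step v w)
      then have "v \<in> A" using reach_in by blast
      then show ?case using reach_step assms by (intro D.reach_step[OF reach_step.IH]) auto
    qed
  }
qed

lemma conn_induced:
  assumes "A \<subseteq> S"
  shows "graph.conn (\<lambda>u v. {u, v} \<in> edges (induced G S)) A \<longleftrightarrow> conn A"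
proof -
  interpret D: sgraph "induced G S" by (rule induced_sgraph)
  show ?thesis unfolding D.conn_def conn_def reach_induced[OF assms] ..
qed

lemma biconn_induced:
  assumes "A \<subseteq> S"
  shows "graph.biconn (\<lambda>u v. {u, v} \<in> edges (induced G S)) A \<longleftrightarrow> biconn A"
proof -
  interpret D: sgraph "induced G S" by (rule induced_sgraph)
  have "A - {x} \<subseteq> S" for x using assms by blast
  note c = conn_induced[OF this]
  show ?thesis unfolding D.biconn_def biconn_def conn_induced[OF assms] c ..
qed

lemma biconn_subgraph:
  assumes D: "sgraph D" "edges D \<subseteq> edges G" and b: "graph.biconn (\<lambda>u v. {u, v} \<in> edges D) A"
  shows "biconn A"
proof -
  interpret D: sgraph D by fact
  have c: "conn A'" if "D.conn A'" for A'
    using that reach_subgraph[OF D order_refl] unfolding D.conn_def conn_def by blast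
  show ?thesis using b c unfolding D.biconn_def biconn_def by blast
qed

lemma subgraph_sgraph: "subgraph D G \<Longrightarrow> sgraph D \<and> edges D \<subseteq> edges G \<and> verts D \<subseteq> verts G"
  by (simp add: subgraph_def sgraph_def)

lemma subgraph_antisym: "subgraph (C :: 'a ugraph) D \<Longrightarrow> subgraph D C \<Longrightarrow> C = D"
  unfolding subgraph_def by (intro ugraph.equality) auto

lemma subgraph_induced:
  assumes "subgraph D G" "verts D \<subseteq> A"
  shows "subgraph D (induced G A)"
proof -
  have "e \<subseteq> A" if "e \<in> edges D" for e
  proof -
    obtain u v where "u \<in> verts D" "v \<in> verts D" "e = {u, v}"
      using assms(1) \<open>e \<in> edges D\<close> unfolding subgraph_def simple_graph_def by blast
    then show ?thesis using assms(2) by auto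
  qed
  then show ?thesis using assms unfolding subgraph_def induced_def by auto
qed

lemma induced_subgraph': "subgraph (induced G A) G"
  using simple_induced by (auto simp: subgraph_def induced_def)

lemma reach_class_conn:
  assumes "u \<in> verts G"
  shows "conn {v. reach (verts G) u v}"
proof -
  let ?A = "{v. reach (verts G) u v}"
  have "reach ?A u v" if "reach (verts G) u v" for v
    using that
  proof (induction rule: reach.induct)
    case reach_refl
    then show ?case by (intro reach.reach_refl) (auto intro: reach.reach_refl)
  next
    case (reach_step v w)
    then have "w \<in> ?A" using reach.reach_step by blast
    then show ?case using reach_step by (intro reach.reach_step[OF reach_step.IH])
  qed
  then have "reach ?A v w" if "v \<in> ?A" "w \<in> ?A" for v w
    using that reach_sym reach_trans by blast
  moreover have "u \<in> ?A" using assms by (auto intro: reach_refl)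
  ultimately show ?thesis unfolding conn_def by blast
qed

text \<open>A connected subgraph containing u lies in the subgraph induced by the vertices reachable
  from u, which is itself connected. So these induced subgraphs are the maximal ones.\<close>

lemma components_eq:
  "components G = induced G ` (\<lambda>u. {v. reach (verts G) u v}) ` verts G"
proof -
  let ?A = "\<lambda>u. {v. reach (verts G) u v}"
  have AV: "?A u \<subseteq> verts G" for u using reach_in by blast
  have vA: "verts (induced G (?A u)) = ?A u" for u using AV[of u] by auto
  have conn: "connected_graph (induced G (?A u))" if "u \<in> verts G" for u
  proof -
    interpret D: sgraph "induced G (?A u)" by (rule induced_sgraph)
    show ?thesis unfolding D.connected_conn vA conn_induced[OF order_refl] by (rule reach_class_conn[OF that])
  qed
  have sub: "subgraph D (induced G (?A u))" if D: "subgraph D G" "connected_graph D" "u \<in> verts D" for D u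
  proof -
    interpret D: sgraph D using subgraph_sgraph[OF D(1)] by blast
    have "D.conn (verts D)" using D(2) D.connected_conn by blast
    then have "D.reach (verts D) u v" if "v \<in> verts D" for v using D(3) that by (simp add: D.conn_def)
    then have "verts D \<subseteq> ?A u"
      using reach_subgraph[OF D.sgraph_axioms _ _] subgraph_sgraph[OF D(1)] by blast
    then show ?thesis by (rule subgraph_induced[OF D(1)])
  qed
  show ?thesis
  proof
    show "components G \<subseteq> induced G ` ?A ` verts G"
    proof
      fix C assume C: "C \<in> components G"
      then have c: "subgraph C G" "connected_graph C" by (auto simp: components_def)
      then obtain u where u: "u \<in> verts C" by (auto simp: connected_graph_def)
      then have "u \<in> verts G" using subgraph_sgraph[OF c(1)] by blast
      moreover from this have "induced G (?A u) = C"
        using C sub[OF c u] conn induced_subgraph' unfolding components_def by blast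
      ultimately show "C \<in> induced G ` ?A ` verts G" by blast
    qed
    show "induced G ` ?A ` verts G \<subseteq> components G"
    proof
      fix C assume "C \<in> induced G ` ?A ` verts G"
      then obtain u where u: "u \<in> verts G" "C = induced G (?A u)" by blast
      have "D = C" if D: "subgraph D G" "connected_graph D" "subgraph C D" for D
      proof -
        have "u \<in> verts C" unfolding u(2) vA using u(1) by (auto intro: reach_refl)
        then have "u \<in> verts D" using D(3) by (auto simp: subgraph_def)
        then have "subgraph D C" using sub[OF D(1,2)] u(2) by blast
        then show ?thesis using D(3) subgraph_antisym by blast
      qed
      then show "C \<in> components G"
        unfolding components_def using u conn induced_subgraph' by blast
    qed
  qed
qed

lemma card_components: "card (components G) = card ((\<lambda>u. {v. reach (verts G) u v}) ` verts G)"
proof -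
  have "inj_on (induced G) ((\<lambda>u. {v. reach (verts G) u v}) ` verts G)"
  proof (rule inj_onI)
    fix A B assume "A \<in> (\<lambda>u. {v. reach (verts G) u v}) ` verts G" "B \<in> (\<lambda>u. {v. reach (verts G) u v}) ` verts G"
      and eq: "induced G A = induced G B"
    then have "A \<subseteq> verts G" "B \<subseteq> verts G" using reach_in by auto
    moreover have "verts G \<inter> A = verts G \<inter> B" using arg_cong[OF eq, of verts] by simp
    ultimately show "A = B" by blast
  qed
  then show ?thesis unfolding components_eq by (rule card_image)
qed

lemma cutvertex_iff:
  "cutvertex G x \<longleftrightarrow> x \<in> verts G \<and>
     (\<exists>u\<in>verts G - {x}. \<exists>v\<in>verts G - {x}. reach (verts G) u v \<and> \<not> reach (verts G - {x}) u v)"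
proof -
  let ?D = "induced G (verts G - {x})"
  interpret D: sgraph ?D by (rule induced_sgraph)
  have v: "verts ?D = verts G - {x}" by auto
  have "card (components ?D) = card ((\<lambda>u. {v. reach (verts G - {x}) u v}) ` (verts G - {x}))"
    unfolding D.card_components v reach_induced[OF order_refl] ..
  then show ?thesis
    unfolding cutvertex_def card_components using card_reach_classes[OF fin, of x] by auto
qed

lemma no_cutvertex_biconn: "connected_graph G \<and> (\<nexists>x. cutvertex G x) \<longleftrightarrow> biconn (verts G)"
  unfolding cutvertex_iff connected_conn biconn_def conn_def by blast

lemma biconn_induced_graph:
  assumes "A \<subseteq> verts G"
  shows "connected_graph (induced G A) \<and> (\<nexists>x. cutvertex (induced G A) x) \<longleftrightarrow> biconn A"
proof -
  interpret D: sgraph "induced G A" by (rule induced_sgraph)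
  have v: "verts (induced G A) = A" using assms by auto
  show ?thesis unfolding D.no_cutvertex_biconn v biconn_induced[OF order_refl] ..
qed

text \<open>Adding edges of G between its vertices keeps a subgraph connected and free of
  cutvertices. A block is therefore induced, and maximality among subgraphs becomes maximality of
  the vertex set.\<close>

lemma block_iff: "block G B \<longleftrightarrow> (\<exists>S. max_biconn (verts G) S \<and> B = induced G S)"
proof
  assume B: "block G B"
  then have B1: "subgraph B G" "connected_graph B \<and> (\<nexists>x. cutvertex B x)"
    and B2: "\<And>D. subgraph D G \<Longrightarrow> connected_graph D \<and> (\<nexists>x. cutvertex D x) \<Longrightarrow> subgraph B D \<Longrightarrow> D = B"
    unfolding block_def by blast+
  interpret B: sgraph B using subgraph_sgraph[OF B1(1)] by blast
  have BG: "edges B \<subseteq> edges G" "verts B \<subseteq> verts G" using subgraph_sgraph[OF B1(1)] by auto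
  have "B.biconn (verts B)" using B1(2) B.no_cutvertex_biconn by blast
  then have bi: "biconn (verts B)" using biconn_subgraph[OF B.sgraph_axioms BG(1)] by blast
  have max: "induced G S = B" if S: "verts B \<subseteq> S" "S \<subseteq> verts G" "biconn S" for S
  proof (rule B2)
    show "subgraph (induced G S) G" by (rule induced_subgraph')
    show "connected_graph (induced G S) \<and> (\<nexists>x. cutvertex (induced G S) x)"
      using S biconn_induced_graph by blast
    show "subgraph B (induced G S)" by (rule subgraph_induced[OF B1(1) S(1)])
  qed
  have eq: "induced G (verts B) = B" by (rule max) (use bi BG in auto)
  have "max_biconn (verts G) (verts B)"
    unfolding max_biconn_def
  proof (intro conjI allI impI)
    fix S' assume S': "verts B \<subseteq> S' \<and> S' \<subseteq> verts G \<and> biconn S'"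
    then have "induced G S' = B" using max by blast
    then have "verts B = verts G \<inter> S'" by (metis induced_simps(1))
    with S' show "S' = verts B" by blast
  qed (use BG bi in auto)
  with eq show "\<exists>S. max_biconn (verts G) S \<and> B = induced G S" by metis
next
  assume "\<exists>S. max_biconn (verts G) S \<and> B = induced G S"
  then obtain S where S: "max_biconn (verts G) S" and B: "B = induced G S" by blast
  have SV: "S \<subseteq> verts G" "biconn S" using S by (auto simp: max_biconn_def)
  have vB: "verts B = S" using B SV by auto
  have "D = B" if D: "subgraph D G" "connected_graph D \<and> (\<nexists>x. cutvertex D x)" "subgraph B D" for D
  proof -
    interpret D: sgraph D using subgraph_sgraph[OF D(1)] by blast
    have "D.biconn (verts D)" using D(2) D.no_cutvertex_biconn by blast
    then have "biconn (verts D)" using biconn_subgraph[OF D.sgraph_axioms] subgraph_sgraph[OF D(1)] by blast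
    moreover have "S \<subseteq> verts D" "verts D \<subseteq> verts G" using D(1,3) vB by (auto simp: subgraph_def)
    ultimately have "verts D = S" using max_biconnD(3)[OF S] by blast
    then have "subgraph D B" unfolding B by (intro subgraph_induced[OF D(1)]) simp
    then show ?thesis using subgraph_antisym D(3) by blast
  qed
  then show "block G B"
    unfolding block_def using B induced_subgraph' biconn_induced_graph[OF SV(1)] SV(2) by blast
qed

lemma cutvertices_in_eq:
  assumes S: "max_biconn (verts G) S" and card: "2 \<le> card S"
  shows "cutvertices_in G (induced G S) = attach (verts G) S"
proof -
  have SV: "S \<subseteq> verts G" using S by (simp add: max_biconn_def)
  have "cutvertex G x \<longleftrightarrow> x \<in> attach (verts G) S" if x: "x \<in> S" for x
    using max_biconn_cut[OF S fin x card] SV x unfolding cutvertex_iff by blast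
  then show ?thesis using SV attach_sub[of "verts G" S] unfolding cutvertices_in_def by auto
qed

section \<open>Packing and transversal numbers in terms of vertex sets\<close>

lemma kpath4_iff:
  assumes "S \<subseteq> verts G"
  shows "kpath 4 (induced G S) xs \<longleftrightarrow> (\<exists>a b c d. xs = [a, b, c, d] \<and> p4 a b c d \<and> {a, b, c, d} \<subseteq> S)"
proof
  assume k: "kpath 4 (induced G S) xs"
  then have "length xs = Suc (Suc (Suc (Suc 0)))" by (simp add: kpath_def)
  then obtain a b c d where xs: "xs = [a, b, c, d]" by (auto simp: length_Suc_conv)
  then have "p4 a b c d \<and> {a, b, c, d} \<subseteq> S" using k by (auto simp: kpath_def p4_def)
  with xs show "\<exists>a b c d. xs = [a, b, c, d] \<and> p4 a b c d \<and> {a, b, c, d} \<subseteq> S" by blast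
next
  assume "\<exists>a b c d. xs = [a, b, c, d] \<and> p4 a b c d \<and> {a, b, c, d} \<subseteq> S"
  then obtain a b c d where xs: "xs = [a, b, c, d]" and p: "p4 a b c d" "{a, b, c, d} \<subseteq> S" by blast
  have "a \<noteq> b" "b \<noteq> c" "c \<noteq> d" using p(1) edge_in(3) unfolding p4_def by blast+
  then show "kpath 4 (induced G S) xs" using xs p assms by (auto simp: kpath_def p4_def)
qed

text \<open>Disjoint non-empty paths have different vertex sets, so forgetting the order keeps the
  size of a packing; conversely an order is chosen for each vertex set.\<close>

lemma card_packings:
  assumes S: "S \<subseteq> verts G"
  shows "{card P | P. path_packing 4 (induced G S) P} = {card P | P. packing S P}"
proof -
  let ?F = "induced G S"
  have 1: "packing S (set ` P) \<and> card (set ` P) = card P" if P: "path_packing 4 ?F P" for P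
  proof -
    have k: "\<exists>a b c d. xs = [a, b, c, d] \<and> p4 a b c d \<and> {a, b, c, d} \<subseteq> S" if "xs \<in> P" for xs
      using P that kpath4_iff[OF S] unfolding path_packing_def by blast
    have "P \<subseteq> {xs. set xs \<subseteq> S \<and> length xs = 4}"
    proof
      fix xs assume "xs \<in> P"
      from k[OF this] show "xs \<in> {xs. set xs \<subseteq> S \<and> length xs = 4}" by auto
    qed
    moreover have "finite S" using S fin by (rule finite_subset)
    ultimately have finP: "finite P" using finite_lists_length_eq[of S 4] finite_subset by blast
    have dj: "set xs \<inter> set ys = {}" if "xs \<in> P" "ys \<in> P" "xs \<noteq> ys" for xs ys
      using P that unfolding path_packing_def pairwise_def disjnt_def by blast
    show ?thesis
    proof (rule packing_image[OF finP])
      fix xs assume "xs \<in> P"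
      then obtain a b c d where "xs = [a, b, c, d]" "p4 a b c d" "{a, b, c, d} \<subseteq> S" using k by blast
      then show "set xs \<subseteq> S \<and> (\<exists>a b c d. set xs = {a, b, c, d} \<and> p4 a b c d)"
        by (intro conjI exI[of _ a] exI[of _ b] exI[of _ c] exI[of _ d]) simp_all
    qed (rule dj)
  qed
  have 2: "\<exists>P. path_packing 4 ?F P \<and> card P = card P'" if P': "packing S P'" for P'
  proof -
    have ex: "\<exists>xs. kpath 4 ?F xs \<and> set xs = A" if A: "A \<in> P'" for A
    proof -
      obtain a b c d where abcd: "A = {a, b, c, d}" "p4 a b c d" using packingD(3)[OF P' A] by blast
      then have "kpath 4 ?F [a, b, c, d]" unfolding kpath4_iff[OF S] using packingD(2)[OF P' A] by blast
      then show ?thesis using abcd(1) by (intro exI[of _ "[a, b, c, d]"]) simp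
    qed
    define l where "l A = (SOME xs. kpath 4 ?F xs \<and> set xs = A)" for A
    have l: "kpath 4 ?F (l A)" "set (l A) = A" if "A \<in> P'" for A
      using someI_ex[OF ex[OF that]] by (simp_all add: l_def)
    have "inj_on l P'" using l(2) by (metis inj_onI)
    moreover have "path_packing 4 ?F (l ` P')"
      unfolding path_packing_def pairwise_def disjnt_def
    proof (intro conjI ballI impI)
      fix p q assume "p \<in> l ` P'" "q \<in> l ` P'" "p \<noteq> q"
      then obtain A B where "A \<in> P'" "B \<in> P'" "p = l A" "q = l B" "A \<noteq> B" by blast
      then show "set p \<inter> set q = {}" using l(2) packingD(4)[OF P'] by simp
    qed (use l(1) in blast)
    ultimately show ?thesis by (metis card_image)
  qed
  show ?thesis
  proof
    show "{card P | P. path_packing 4 ?F P} \<subseteq> {card P | P. packing S P}"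
    proof
      fix n assume "n \<in> {card P | P. path_packing 4 ?F P}"
      then obtain P where "path_packing 4 ?F P" "n = card P" by blast
      with 1[of P] show "n \<in> {card P | P. packing S P}" by (intro CollectI exI[of _ "set ` P"]) simp
    qed
    show "{card P | P. packing S P} \<subseteq> {card P | P. path_packing 4 ?F P}"
    proof
      fix n assume "n \<in> {card P | P. packing S P}"
      then obtain P' where P': "packing S P'" "n = card P'"
        unfolding mem_Collect_eq by (elim exE conjE) (rule that)
      from 2[OF P'(1)] obtain P where "path_packing 4 ?F P \<and> card P = card P'" by (elim exE)
      then show "n \<in> {card P | P. path_packing 4 ?F P}"
        using P'(2) by (intro CollectI exI[of _ P]) simp
    qed
  qed
qed

lemma transversal_iff:
  assumes S: "S \<subseteq> verts G"
  shows "path_transversal 4 (induced G S) X \<longleftrightarrow> X \<subseteq> S \<and> hits S X"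
proof
  assume t: "path_transversal 4 (induced G S) X"
  then have XS: "X \<subseteq> S" by (auto simp: path_transversal_def)
  have "finite X" using finite_subset[OF XS finite_subset[OF S fin]] .
  then have "hits S X"
  proof (rule hitsI)
    fix a b c d assume p: "p4 a b c d" "{a, b, c, d} \<subseteq> S" "{a, b, c, d} \<inter> X = {}"
    then have "kpath 4 (induced G S) [a, b, c, d]" unfolding kpath4_iff[OF S] by blast
    then have "set [a, b, c, d] \<inter> X \<noteq> {}" using t unfolding path_transversal_def by blast
    with p(3) show False by simp
  qed
  with XS show "X \<subseteq> S \<and> hits S X" ..
next
  assume X: "X \<subseteq> S \<and> hits S X"
  have "set xs \<inter> X \<noteq> {}" if "kpath 4 (induced G S) xs" for xs
  proof -
    obtain a b c d where "xs = [a, b, c, d]" "p4 a b c d" "{a, b, c, d} \<subseteq> S"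
      using \<open>kpath 4 (induced G S) xs\<close> unfolding kpath4_iff[OF S] by blast
    then show ?thesis using X hitsD[of S X a b c d] by auto
  qed
  moreover have "X \<subseteq> verts (induced G S)" using X S by auto
  ultimately show "path_transversal 4 (induced G S) X" unfolding path_transversal_def by blast
qed

text \<open>Weak duality turns the inequality in \<open>konig\<close> into equality of the extremal
  values. A set that satisfies \<open>hits\<close> may contain vertices outside S and is first cut
  down to S.\<close>

lemma nu_tau_konig:
  assumes S: "S \<subseteq> verts G"
  shows "path_nu 4 (induced G S) = path_tau 4 (induced G S) \<longleftrightarrow> konig S"
proof -
  let ?N = "{card P | P. packing S P}" and ?M = "{card X | X. X \<subseteq> S \<and> hits S X}"
  have nu: "path_nu 4 (induced G S) = Max ?N" unfolding path_nu_def card_packings[OF S] ..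
  have tau: "path_tau 4 (induced G S) = Min ?M" unfolding path_tau_def transversal_iff[OF S] ..
  have fS: "finite S" using S fin by (rule finite_subset)
  have SS: "hits S S" using fS by (rule hitsI) auto
  have "?N \<subseteq> {..card S}" using weak_duality[OF _ SS] by auto
  then have fN: "finite ?N" using finite_subset by blast
  have "packing S {}" by (rule packingI) auto
  then have neN: "?N \<noteq> {}" by blast
  have "?M \<subseteq> {..card S}" using fS card_mono by blast
  then have fM: "finite ?M" using finite_subset by blast
  have neM: "?M \<noteq> {}" using SS by blast
  have "Max ?N \<in> ?N" using fN neN by (rule Max_in)
  then obtain P where P: "packing S P" "Max ?N = card P" by blast
  have "Min ?M \<in> ?M" using fM neM by (rule Min_in)
  then obtain X where X: "X \<subseteq> S" "hits S X" "Min ?M = card X" by blast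
  show ?thesis
  proof
    assume "path_nu 4 (induced G S) = path_tau 4 (induced G S)"
    then have "card X \<le> card P" using nu tau P X by simp
    then show "konig S" unfolding konig_def using P X by blast
  next
    assume "konig S"
    then obtain P' X' where P': "packing S P'" "hits S X'" "card X' \<le> card P'" unfolding konig_def by blast
    have "hits S (X' \<inter> S)" using P'(2) unfolding hits_def by auto
    moreover have "card (X' \<inter> S) \<le> card X'" using P'(2) by (intro card_mono) (auto simp: hits_def)
    moreover from calculation have "Min ?M \<le> card (X' \<inter> S)"
      by (intro Min_le[OF fM] CollectI exI[of _ "X' \<inter> S"]) auto
    ultimately have "Min ?M \<le> card X'" by simp
    moreover have "card P' \<le> Max ?N" using P'(1) by (intro Max_ge[OF fN]) auto
    moreover have "Max ?N \<le> Min ?M" using weak_duality[OF P(1) X(2)] P(2) X(3) by simp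
    ultimately show "path_nu 4 (induced G S) = path_tau 4 (induced G S)" using nu tau P'(3) by simp
  qed
qed

lemma G4_iff: "G \<in> G4 \<longleftrightarrow> hereditary_konig (verts G)"
proof -
  have "G \<in> G4 \<longleftrightarrow> (\<forall>S\<subseteq>verts G. path_nu 4 (induced G S) = path_tau 4 (induced G S))"
    unfolding G4_def induced_subgraph_def using simple by blast
  also have "\<dots> \<longleftrightarrow> hereditary_konig (verts G)" unfolding hereditary_konig_def using nu_tau_konig fin by simp
  finally show ?thesis .
qed

text \<open>A copy of T(p) in G with p read off as |Q|. Here Q may be empty; its being non-empty is
  added where p \<ge> 1 is meant.\<close>

definition T_shape :: "'a set \<Rightarrow> 'a \<Rightarrow> 'a \<Rightarrow> 'a set \<Rightarrow> bool" where
  "T_shape S a b Q \<longleftrightarrow> S = insert a (insert b Q) \<and> a \<notin> Q \<and> b \<notin> Q \<and> {a, b} \<in> edges G \<and>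
     (\<forall>q\<in>Q. {a, q} \<in> edges G \<and> {b, q} \<in> edges G) \<and> (\<forall>q\<in>Q. \<forall>r\<in>Q. {q, r} \<notin> edges G)"

lemma T_shape_of_iso:
  assumes S: "S \<subseteq> verts G" and iso: "isomorphic (induced G S) (T_graph p)"
  shows "\<exists>a b Q. T_shape S a b Q \<and> card Q = p"
proof -
  obtain f where f: "iso_via f (induced G S) (T_graph p)" using iso by (auto simp: isomorphic_def)
  have vS: "verts (induced G S) = S" using S by auto
  have bij: "bij_betw f S (Inl ` {..<2} \<union> Inr ` {..<p})" using f vS by (simp add: iso_via_def T_graph_verts)
  have ed: "{u, v} \<in> edges G \<longleftrightarrow> {f u, f v} \<in> edges (T_graph p)" if "u \<in> S" "v \<in> S" for u v
    using f that vS unfolding iso_via_def by simp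
  define g where "g = inv_into S f"
  have g: "g y \<in> S" "f (g y) = y" if "y \<in> Inl ` {..<2} \<union> Inr ` {..<p}" for y
    using that bij unfolding g_def bij_betw_def by (auto intro: inv_into_into f_inv_into_f)
  have gS: "bij_betw g (Inl ` {..<2} \<union> Inr ` {..<p}) S" unfolding g_def by (rule bij_betw_inv_into[OF bij])
  let ?a = "g (Inl 0)" and ?b = "g (Inl 1)" and ?Q = "g ` Inr ` {..<p}"
  have inj: "inj_on g (Inl ` {..<2} \<union> Inr ` {..<p})" using gS by (simp add: bij_betw_def)
  have two: "{..<2::nat} = {0, 1}" by auto
  have "S = g ` (Inl ` {..<2} \<union> Inr ` {..<p})" using gS by (simp add: bij_betw_def)
  then have 1: "S = insert ?a (insert ?b ?Q)" unfolding two by (simp add: image_Un)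
  have ne: "g x \<noteq> g y" if "x \<in> Inl ` {..<2} \<union> Inr ` {..<p}" "y \<in> Inl ` {..<2} \<union> Inr ` {..<p}" "x \<noteq> y" for x y
    using inj that by (auto dest: inj_onD)
  have 2: "?a \<notin> ?Q" "?b \<notin> ?Q" using ne by auto
  have e: "{g x, g y} \<in> edges G \<longleftrightarrow> {x, y} \<in> edges (T_graph p)"
    if "x \<in> Inl ` {..<2} \<union> Inr ` {..<p}" "y \<in> Inl ` {..<2} \<union> Inr ` {..<p}" for x y
    using ed[OF g(1)[OF that(1)] g(1)[OF that(2)]] g(2)[OF that(1)] g(2)[OF that(2)] by simp
  have "card ?Q = card (Inr ` {..<p} :: (nat + nat) set)"
    by (rule card_image) (rule inj_on_subset[OF inj], auto)
  also have "\<dots> = p" by (simp add: card_image)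
  finally have "card ?Q = p" .
  moreover have "T_shape S ?a ?b ?Q"
    unfolding T_shape_def using 1 2 e by (auto simp: T_graph_edge)
  ultimately show ?thesis by blast
qed

lemma T_shape_iso:
  assumes S: "S \<subseteq> verts G" and T: "T_shape S a b Q"
  shows "isomorphic (induced G S) (T_graph (card Q))"
proof -
  have t: "S = insert a (insert b Q)" "a \<notin> Q" "b \<notin> Q" "{a, b} \<in> edges G"
    "\<And>q. q \<in> Q \<Longrightarrow> {a, q} \<in> edges G" "\<And>q. q \<in> Q \<Longrightarrow> {b, q} \<in> edges G" "\<And>q r. q \<in> Q \<Longrightarrow> r \<in> Q \<Longrightarrow> {q, r} \<notin> edges G"
    using T unfolding T_shape_def by auto
  have "finite Q" using S t(1) fin finite_subset by (metis finite_insert)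
  then obtain h where h: "bij_betw h Q {..<card Q}" by (metis ex_bij_betw_finite_nat atLeast0LessThan)
  have ne: "a \<noteq> b" using edge_in(3) t(4) by blast
  define f where "f v = (if v = a then Inl 0 else if v = b then Inl 1 else Inr (h v) :: nat + nat)" for v
  have fa: "f a = Inl 0" "f b = Inl 1" using ne by (auto simp: f_def)
  have fq: "f q = Inr (h q)" if "q \<in> Q" for q using that t(2,3) by (auto simp: f_def)
  have hq: "h q < card Q" if "q \<in> Q" for q using h that by (auto simp: bij_betw_def)
  have "inj_on f S"
    unfolding t(1) using h fa fq by (auto simp: inj_on_def bij_betw_def)
  moreover have "f ` S = Inl ` {..<2} \<union> Inr ` {..<card Q}"
  proof -
    have "f ` Q = Inr ` h ` Q" using fq by (auto simp: image_image)
    moreover have "{..<2::nat} = {0, 1}" by auto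
    ultimately show ?thesis unfolding t(1) using fa h by (simp add: bij_betw_def)
  qed
  moreover have vS: "verts (induced G S) = S" using S by auto
  ultimately have "bij_betw f (verts (induced G S)) (verts (T_graph (card Q)))"
    by (simp add: bij_betw_def T_graph_verts)
  moreover have "{u, v} \<in> edges (induced G S) \<longleftrightarrow> {f u, f v} \<in> edges (T_graph (card Q))" if "u \<in> S" "v \<in> S" for u v
  proof -
    have uv: "u = a \<or> u = b \<or> u \<in> Q" "v = a \<or> v = b \<or> v \<in> Q" using that t(1) by auto
    have e': "{b, a} \<in> edges G" "\<And>q. q \<in> Q \<Longrightarrow> {q, a} \<in> edges G" "\<And>q. q \<in> Q \<Longrightarrow> {q, b} \<in> edges G"
      using t(4-6) adj_sym by blast+
    have "{u, v} \<in> edges G \<longleftrightarrow> {f u, f v} \<in> edges (T_graph (card Q))"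
      using uv t(4-7) e' fa fq hq adj_irrefl by (elim disjE) (auto simp: T_graph_edge)
    then show ?thesis using that by simp
  qed
  ultimately show ?thesis unfolding isomorphic_def iso_via_def vS by blast
qed

lemma T_shape_deg:
  assumes S: "S \<subseteq> verts G" and T: "T_shape S a b Q"
  shows "deg (induced G S) a = card Q + 1" "deg (induced G S) b = card Q + 1"
    "q \<in> Q \<Longrightarrow> deg (induced G S) q = 2"
proof -
  have t: "S = insert a (insert b Q)" "a \<notin> Q" "b \<notin> Q" "{a, b} \<in> edges G"
    "\<And>q. q \<in> Q \<Longrightarrow> {a, q} \<in> edges G" "\<And>q. q \<in> Q \<Longrightarrow> {b, q} \<in> edges G" "\<And>q r. q \<in> Q \<Longrightarrow> r \<in> Q \<Longrightarrow> {q, r} \<notin> edges G"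
    using T unfolding T_shape_def by auto
  have e': "{b, a} \<in> edges G" "\<And>q. q \<in> Q \<Longrightarrow> {q, a} \<in> edges G" "\<And>q. q \<in> Q \<Longrightarrow> {q, b} \<in> edges G"
    using t(4-6) adj_sym by blast+
  have ne: "a \<noteq> b" using edge_in(3) t(4) by blast
  have fQ: "finite Q" using S t(1) fin finite_subset by (metis finite_insert)
  have "neighbors (induced G S) a = insert b Q"
    using t e' adj_irrefl[of a] unfolding neighbors_def by auto
  then show "deg (induced G S) a = card Q + 1" using fQ t by (simp add: deg_def)
  have "neighbors (induced G S) b = insert a Q"
    using t e' adj_irrefl[of b] unfolding neighbors_def by auto
  then show "deg (induced G S) b = card Q + 1" using fQ t by (simp add: deg_def)
  assume q: "q \<in> Q"
  have "neighbors (induced G S) q = {a, b}"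
    using t e' q unfolding neighbors_def by auto
  then show "deg (induced G S) q = 2" using ne by (simp add: deg_def)
qed

lemma deg_1_iff:
  assumes "{x, y} \<in> edges G"
  shows "deg G y = 1 \<longleftrightarrow> (\<forall>w\<in>verts G. {y, w} \<in> edges G \<longrightarrow> w = x)"
proof -
  have x: "x \<in> neighbors G y" using adj_sym[OF assms] by (simp add: neighbors_def)
  have "deg G y = 1 \<longleftrightarrow> neighbors G y = {x}"
    unfolding deg_def One_nat_def card_1_singleton_iff using x by auto
  also have "\<dots> \<longleftrightarrow> (\<forall>w\<in>verts G. {y, w} \<in> edges G \<longrightarrow> w = x)"
    using x edge_in(2) unfolding neighbors_def by blast
  finally show ?thesis .
qed

text \<open>One side speaks of isomorphisms, degrees and cutvertices, the other of neighbourhoods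
  and attachment vertices. The link is \<open>cutvertices_in_eq\<close>; the rest is a choice of
  labels.\<close>

lemma block_types:
  assumes S: "max_biconn (verts G) S" and card: "3 \<le> card S"
  defines "B \<equiv> induced G S"
  shows "block_type_i G B \<longleftrightarrow> subdiv_block (verts G) S"
    and "block_type_ii G B \<longleftrightarrow> K4_block (verts G) S"
    and "block_type_iii G B \<longleftrightarrow> T2_block (verts G) S"
    and "block_type_iv G B \<longleftrightarrow> T_block (verts G) S"
proof -
  have SV: "S \<subseteq> verts G" using S by (simp add: max_biconn_def)
  have fS: "finite S" using SV fin by (rule finite_subset)
  have vB: "verts B = S" using SV by (auto simp: B_def)
  have cut: "cutvertices_in G B = attach (verts G) S"
    unfolding B_def using cutvertices_in_eq[OF S] card by simp
  have eB: "{u, v} \<in> edges B \<longleftrightarrow> {u, v} \<in> edges G" if "u \<in> S" "v \<in> S" for u v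
    using that by (simp add: B_def)
  have att: "attach (verts G) S \<subseteq> S" by (rule attach_sub)
  have fatt: "finite (attach (verts G) S)" using att fS by (rule finite_subset)
  have blk: "block G B" unfolding block_iff B_def using S by blast

  show "block_type_i G B \<longleftrightarrow> subdiv_block (verts G) S"
  proof
    assume "block_type_i G B"
    then obtain H :: "(nat, nat) multigraph" and f where H: "bipartite_multigraph H"
      and iso: "iso_via f (Sub 2 H) B" and ct: "attach (verts G) S \<subseteq> f ` Orig ` mverts H"
      unfolding block_type_i_def cut by blast
    obtain X Y where XY: "X \<union> Y = mverts H" "X \<inter> Y = {}"
      and me: "\<And>e. e \<in> medges H \<Longrightarrow> mends H e \<in> X \<times> Y \<union> Y \<times> X"
      using H unfolding bipartite_multigraph_def by blast
    let ?I = "\<lambda>e. Inner e 1 :: (nat, nat) sub_vertex"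
    have bij: "bij_betw f (Orig ` mverts H \<union> ?I ` medges H) S"
      using iso vB unfolding iso_via_def Sub2_verts by blast
    have inj: "inj_on f (Orig ` mverts H \<union> ?I ` medges H)" and im: "f ` (Orig ` mverts H \<union> ?I ` medges H) = S"
      using bij by (auto simp: bij_betw_def)
    have ed: "{f u, f v} \<in> edges G \<longleftrightarrow> {u, v} \<in> edges (Sub 2 H)"
      if "u \<in> Orig ` mverts H \<union> ?I ` medges H" "v \<in> Orig ` mverts H \<union> ?I ` medges H" for u v
    proof -
      have "f u \<in> S" "f v \<in> S" using im that by blast+
      then show ?thesis using iso that eB unfolding iso_via_def Sub2_verts by simp
    qed
    let ?X = "f ` Orig ` X" and ?Y = "f ` Orig ` Y" and ?E = "f ` ?I ` medges H"
    have feq: "f u = f v \<longleftrightarrow> u = v"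
      if "u \<in> Orig ` mverts H \<union> ?I ` medges H" "v \<in> Orig ` mverts H \<union> ?I ` medges H" for u v
      using inj that by (auto dest: inj_onD)
    have XH: "X \<subseteq> mverts H" "Y \<subseteq> mverts H" using XY by auto
    have dis: "?X \<inter> ?Y = {}" "?X \<inter> ?E = {}" "?Y \<inter> ?E = {}"
    proof -
      have "f ` A \<inter> f ` A' = f ` (A \<inter> A')"
        if "A \<subseteq> Orig ` mverts H \<union> ?I ` medges H" "A' \<subseteq> Orig ` mverts H \<union> ?I ` medges H" for A A'
        using inj_on_image_Int[OF inj that] by simp
      moreover have "Orig ` X \<subseteq> Orig ` mverts H \<union> ?I ` medges H" "Orig ` Y \<subseteq> Orig ` mverts H \<union> ?I ` medges H"
        "?I ` medges H \<subseteq> Orig ` mverts H \<union> ?I ` medges H" using XH by auto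
      moreover have "Orig ` X \<inter> Orig ` Y = ({} :: (nat, nat) sub_vertex set)" using XY(2) by auto
      moreover have "Orig ` X \<inter> ?I ` medges H = {}" "Orig ` Y \<inter> ?I ` medges H = {}" by auto
      ultimately show "?X \<inter> ?Y = {}" "?X \<inter> ?E = {}" "?Y \<inter> ?E = {}" by simp_all
    qed
    show "subdiv_block (verts G) S"
    proof (rule subdiv_blockI[OF _ dis])
      show "S = ?X \<union> ?Y \<union> ?E" unfolding im[symmetric] XY(1)[symmetric] image_Un ..
    next
      fix u v assume uv: "u \<in> S" "v \<in> S" "{u, v} \<in> edges G"
      then obtain u' v' where u': "u' \<in> Orig ` mverts H \<union> ?I ` medges H" "u = f u'"
        and v': "v' \<in> Orig ` mverts H \<union> ?I ` medges H" "v = f v'" using im by blast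
      have E_iff: "f z \<in> ?E \<longleftrightarrow> z \<in> ?I ` medges H" if "z \<in> Orig ` mverts H \<union> ?I ` medges H" for z
        using feq[OF that] by (auto simp: image_iff)
      have "{u', v'} \<in> edges (Sub 2 H)" using ed u' v' uv(3) by simp
      then have "u' \<in> ?I ` medges H \<longleftrightarrow> v' \<notin> ?I ` medges H" unfolding Sub2_edge by auto
      then show "u \<in> ?E \<longleftrightarrow> v \<notin> ?E" using E_iff u' v' by simp
    next
      fix z assume "z \<in> ?E"
      then obtain e where e: "e \<in> medges H" "z = f (?I e)" by blast
      have zS: "z \<in> S" using e im by blast
      have "f ` Orig ` mverts H = ?X \<union> ?Y" unfolding XY(1)[symmetric] image_Un ..
      with ct have ct': "attach (verts G) S \<subseteq> ?X \<union> ?Y" by (rule subset_trans[OF _ equalityD1])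
      \<comment> \<open>A subdivision vertex is no cutvertex, so its neighbours in G all lie in the
        block and are the two ends of its edge.\<close>
      have "z \<notin> attach (verts G) S"
      proof
        assume "z \<in> attach (verts G) S"
        with ct' have "z \<in> ?X \<union> ?Y" by (rule subsetD)
        then show False
        proof
          assume "z \<in> ?X"
          then have "z \<in> ?X \<inter> ?E" using \<open>z \<in> ?E\<close> by (rule IntI)
          then show False unfolding dis(2) by (rule emptyE)
        next
          assume "z \<in> ?Y"
          then have "z \<in> ?Y \<inter> ?E" using \<open>z \<in> ?E\<close> by (rule IntI)
          then show False unfolding dis(3) by (rule emptyE)
        qed
      qed
      then have nS: "w \<in> S" if "w \<in> verts G" "{z, w} \<in> edges G" for w using attachI[OF zS, of w "verts G"] that by blast
      let ?p = "f (Orig (fst (mends H e)))" and ?q = "f (Orig (snd (mends H e)))"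
      have ends: "fst (mends H e) \<in> mverts H" "snd (mends H e) \<in> mverts H" using me[OF e(1)] XH by auto
      have nb: "{w \<in> verts G. {z, w} \<in> edges G} = {?p, ?q}"
      proof
        show "{w \<in> verts G. {z, w} \<in> edges G} \<subseteq> {?p, ?q}"
        proof
          fix w assume "w \<in> {w \<in> verts G. {z, w} \<in> edges G}"
          then have w: "w \<in> S" "{z, w} \<in> edges G" using nS by auto
          then obtain w' where w': "w' \<in> Orig ` mverts H \<union> ?I ` medges H" "w = f w'" using im by blast
          then have "{?I e, w'} \<in> edges (Sub 2 H)" using ed[of "?I e" w'] w e by simp
          then show "w \<in> {?p, ?q}" using w'(2) unfolding Sub2_edge by auto
        qed
        have "{z, ?p} \<in> edges G" "{z, ?q} \<in> edges G"
          using ed[of "?I e" "Orig (fst (mends H e))"] ed[of "?I e" "Orig (snd (mends H e))"] e ends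
          unfolding Sub2_edge by auto
        then show "{?p, ?q} \<subseteq> {w \<in> verts G. {z, w} \<in> edges G}" using edge_in(2) by auto
      qed
      show "\<exists>u\<in>?X. \<exists>v\<in>?Y. {w \<in> verts G. {z, w} \<in> edges G} = {u, v}"
      proof (cases "mends H e \<in> X \<times> Y")
        case True
        then have "?p \<in> ?X" "?q \<in> ?Y" by auto
        with nb show ?thesis by blast
      next
        case False
        then have "mends H e \<in> Y \<times> X" using me[OF e(1)] by blast
        then have "?q \<in> ?X" "?p \<in> ?Y" by auto
        moreover have "{w \<in> verts G. {z, w} \<in> edges G} = {?q, ?p}" using nb by (simp add: insert_commute)
        ultimately show ?thesis by blast
      qed
    qed
  next
    assume "subdiv_block (verts G) S"
    then obtain X Y E where S_eq: "S = X \<union> Y \<union> E" and d: "X \<inter> Y = {}" "X \<inter> E = {}" "Y \<inter> E = {}"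
      and ed: "\<And>u v. u \<in> S \<Longrightarrow> v \<in> S \<Longrightarrow> {u, v} \<in> edges G \<Longrightarrow> u \<in> E \<longleftrightarrow> v \<notin> E"
      and E: "\<And>e. e \<in> E \<Longrightarrow> \<exists>u\<in>X. \<exists>v\<in>Y. {w \<in> verts G. {e, w} \<in> edges G} = {u, v}"
      by (rule subdiv_blockE) (rule that)
    \<comment> \<open>H has to live on natural numbers, so the vertices of the block are numbered.
      An edge of H gets the number of its subdivision vertex, which keeps parallel edges
      apart.\<close>
    obtain h :: "'a \<Rightarrow> nat" where h: "inj_on h S" using fS finite_imp_inj_to_nat_seg by metis
    define g where "g = inv_into S h"
    have g: "g (h v) = v" if "v \<in> S" for v using h that by (simp add: g_def)
    have "\<forall>e\<in>E. \<exists>u v. u \<in> X \<and> v \<in> Y \<and> {w \<in> verts G. {e, w} \<in> edges G} = {u, v}" using E by blast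
    from bchoice[OF this] obtain xe where
      "\<forall>e\<in>E. \<exists>v. xe e \<in> X \<and> v \<in> Y \<and> {w \<in> verts G. {e, w} \<in> edges G} = {xe e, v}" by (elim exE)
    from bchoice[OF this] obtain ye where
      "\<forall>e\<in>E. xe e \<in> X \<and> ye e \<in> Y \<and> {w \<in> verts G. {e, w} \<in> edges G} = {xe e, ye e}" by (elim exE)
    then have xy: "xe e \<in> X \<and> ye e \<in> Y \<and> {w \<in> verts G. {e, w} \<in> edges G} = {xe e, ye e}" if "e \<in> E" for e
      using that by (rule bspec)
    define H :: "(nat, nat) multigraph" where
      "H = \<lparr>mverts = h ` (X \<union> Y), medges = h ` E, mends = \<lambda>n. (h (xe (g n)), h (ye (g n)))\<rparr>"
    have Hs: "mverts H = h ` (X \<union> Y)" "medges H = h ` E" "mends H n = (h (xe (g n)), h (ye (g n)))" for n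
      by (simp_all add: H_def)
    have sub: "X \<subseteq> S" "Y \<subseteq> S" "E \<subseteq> S" using S_eq by auto
    have "bipartite_multigraph H"
      unfolding bipartite_multigraph_def finite_multigraph_def
    proof (intro conjI exI ballI)
      show "finite (mverts H)" "finite (medges H)" 
        using finite_subset[OF sub(1) fS] finite_subset[OF sub(2) fS] finite_subset[OF sub(3) fS] Hs by simp_all
      show "h ` X \<union> h ` Y = mverts H" using Hs by (simp add: image_Un)
      show "h ` X \<inter> h ` Y = {}" using inj_on_image_Int[OF h sub(1,2)] d(1) by simp
      fix e assume "e \<in> medges H"
      then obtain v where v: "v \<in> E" "e = h v" using Hs by auto
      then have "g e = v" using g sub by auto
      then have "mends H e = (h (xe v), h (ye v))" using Hs by simp
      then show "mends H e \<in> h ` X \<times> h ` Y \<union> h ` Y \<times> h ` X" "mends H e \<in> mverts H \<times> mverts H"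
        using xy[OF v(1)] Hs by auto
    qed
    moreover define f where "f z = (case z of Orig n \<Rightarrow> g n | Inner n i \<Rightarrow> g n)" for z :: "(nat, nat) sub_vertex"
    let ?D = "Orig ` h ` (X \<union> Y) \<union> (\<lambda>e. Inner e 1) ` h ` E :: (nat, nat) sub_vertex set"
    have fO: "f (Orig (h v)) = v" if "v \<in> X \<union> Y" for v
    proof -
      have "v \<in> S" using sub that by blast
      then show ?thesis using g by (simp add: f_def)
    qed
    have fI: "f (Inner (h v) i) = v" if "v \<in> E" for v i
    proof -
      have "v \<in> S" using sub that by blast
      then show ?thesis using g by (simp add: f_def)
    qed
    have "(\<lambda>v. f (Orig (h v))) ` (X \<union> Y) = (\<lambda>v. v) ` (X \<union> Y)" using fO by (intro image_cong refl)
    then have fOm: "f ` Orig ` mverts H = X \<union> Y" unfolding Hs image_image by (simp only: image_ident)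
    moreover have "f ` (\<lambda>e. Inner e 1) ` h ` E = E" unfolding image_image using fI by (simp cong: image_cong)
    ultimately have fD: "f ` ?D = S" using S_eq unfolding Hs image_Un by simp
    have inj: "inj_on f ?D"
    proof (rule inj_onI)
      fix p q assume p: "p \<in> ?D" and q: "q \<in> ?D" and eq: "f p = f q"
      have cases: "(\<exists>v\<in>X \<union> Y. r = Orig (h v) \<and> f r = v) \<or> (\<exists>v\<in>E. r = Inner (h v) 1 \<and> f r = v)" if "r \<in> ?D" for r
        using that
      proof
        assume "r \<in> Orig ` h ` (X \<union> Y)"
        then obtain v where "v \<in> X \<union> Y" "r = Orig (h v)" by blast
        then show ?thesis using fO by blast
      next
        assume "r \<in> (\<lambda>e. Inner e 1) ` h ` E"
        then obtain v where "v \<in> E" "r = Inner (h v) 1" by blast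
        then show ?thesis using fI by blast
      qed
      have "(X \<union> Y) \<inter> E = {}" using d by blast
      then show "p = q" using cases[OF p] cases[OF q] eq by auto
    qed
    have "bij_betw f (verts (Sub 2 H)) (verts B)"
      unfolding Sub2_verts vB Hs bij_betw_def using inj fD by simp
    moreover have "{p, q} \<in> edges (Sub 2 H) \<longleftrightarrow> {f p, f q} \<in> edges B"
      if p: "p \<in> verts (Sub 2 H)" and q: "q \<in> verts (Sub 2 H)" for p q
    proof -
      have pq: "p \<in> ?D" "q \<in> ?D" using p q unfolding Sub2_verts Hs by auto
      then have fpq: "f p \<in> S" "f q \<in> S" using fD by blast+
      have half: "{Inner (h e) 1, r} \<in> edges (Sub 2 H) \<longleftrightarrow> {e, f r} \<in> edges G" if e: "e \<in> E" and r: "r \<in> ?D" for e r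
      proof -
        have ge: "g (h e) = e" using g sub e by auto
        have fr: "f r \<in> S" using fD r by blast
        have hxy: "Orig (h (xe e)) \<in> ?D" "Orig (h (ye e)) \<in> ?D" using xy[OF e] by auto
        have "{Inner (h e) 1, r} \<in> edges (Sub 2 H) \<longleftrightarrow> r = Orig (h (xe e)) \<or> r = Orig (h (ye e))"
          unfolding Sub2_edge Hs using e ge by auto
        also have "\<dots> \<longleftrightarrow> f r = xe e \<or> f r = ye e"
          using inj_on_eq_iff[OF inj r hxy(1)] inj_on_eq_iff[OF inj r hxy(2)] fO xy[OF e] by auto
        also have "\<dots> \<longleftrightarrow> f r \<in> {w \<in> verts G. {e, w} \<in> edges G}" using xy[OF e] by auto
        also have "\<dots> \<longleftrightarrow> {e, f r} \<in> edges G" using fr SV by auto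
        finally show ?thesis .
      qed
      consider e where "e \<in> E" "p = Inner (h e) 1" | e where "e \<in> E" "q = Inner (h e) 1"
        | "p \<in> Orig ` h ` (X \<union> Y)" "q \<in> Orig ` h ` (X \<union> Y)" using pq by blast
      then show ?thesis
      proof cases
        case 1
        then show ?thesis using half[OF 1(1) pq(2)] fI eB[OF fpq] by simp
      next
        case 2
        then show ?thesis using half[OF 2(1) pq(1)] fI eB[OF fpq] by (simp add: insert_commute)
      next
        case 3
        then have "f p \<in> X \<union> Y" "f q \<in> X \<union> Y" using fO by auto
        then have "f p \<notin> E" "f q \<notin> E" using d by auto
        then have "{f p, f q} \<notin> edges G" using ed[OF fpq] by blast
        moreover have "{p, q} \<notin> edges (Sub 2 H)" using 3 unfolding Sub2_edge by auto
        ultimately show ?thesis using eB[OF fpq] by simp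
      qed
    qed
    ultimately have iso: "iso_via f (Sub 2 H) B" unfolding iso_via_def by blast
    have "attach (verts G) S \<subseteq> X \<union> Y"
    proof
      fix z assume z: "z \<in> attach (verts G) S"
      then obtain w where w: "z \<in> S" "w \<in> verts G" "w \<notin> S" "{z, w} \<in> edges G" unfolding attach_def by blast
      have "z \<notin> E"
      proof
        assume "z \<in> E"
        then have "w \<in> {xe z, ye z}" using xy[of z] w by auto
        then show False using xy[OF \<open>z \<in> E\<close>] sub w(3) by auto
      qed
      then show "z \<in> X \<union> Y" using w(1) S_eq by blast
    qed
    then show "block_type_i G B" unfolding block_type_i_def cut using \<open>bipartite_multigraph H\<close> iso fOm by blast
  qed

  have end_iff: "endblock G B \<longleftrightarrow> card (attach (verts G) S) \<le> 1" unfolding endblock_def cut using blk by simp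
  have single: "card (attach (verts G) S) \<le> 1" if "attach (verts G) S \<subseteq> {z}" for z
    using card_mono[OF _ that] by simp
  have single': "\<exists>z\<in>S. attach (verts G) S \<subseteq> {z}" if "card (attach (verts G) S) \<le> 1"
  proof (cases "attach (verts G) S = {}")
    case True
    moreover obtain z where "z \<in> S" using card by fastforce
    ultimately show ?thesis by blast
  next
    case False
    then obtain z where z: "z \<in> attach (verts G) S" by blast
    have "card (attach (verts G) S) \<le> Suc 0" using that by simp
    then have "attach (verts G) S \<subseteq> {z}" using z card_le_Suc0_iff_eq[OF fatt] by blast
    then show ?thesis using z att by blast
  qed

  show "block_type_ii G B \<longleftrightarrow> K4_block (verts G) S"
  proof
    assume ii: "block_type_ii G B"
    then obtain f where f: "bij_betw f S {..<4::nat}"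
      and ed: "\<And>u v. u \<in> S \<Longrightarrow> v \<in> S \<Longrightarrow> {u, v} \<in> edges B \<longleftrightarrow> {f u, f v} \<in> edges (complete_graph 4)"
      unfolding block_type_ii_def isomorphic_def iso_via_def vB complete_graph_verts by blast
    have cl: "{u, v} \<in> edges G" if "u \<in> S" "v \<in> S" "u \<noteq> v" for u v
    proof -
      have "f u \<noteq> f v" "f u < 4" "f v < 4" using f that by (auto simp: bij_betw_def dest: inj_onD)
      then show ?thesis using ed[OF that(1,2)] eB[OF that(1,2)] by (simp add: complete_graph_edge)
    qed
    have c4: "card S = 4" using bij_betw_same_card[OF f] by simp
    obtain a where a: "a \<in> S" "attach (verts G) S \<subseteq> {a}"
      using single' ii end_iff unfolding block_type_ii_def by blast
    have "card (S - {a}) = 3" using a c4 fS by simp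
    then obtain b c d where bcd: "S - {a} = {b, c, d}" "b \<noteq> c" "b \<noteq> d" "c \<noteq> d" unfolding card_3_iff by blast
    then have "S = {a, b, c, d}" "distinct [a, b, c, d]" using a by auto
    then show "K4_block (verts G) S" using cl a(2) by (intro K4_blockI)
  next
    assume "K4_block (verts G) S"
    then obtain a b c d where S4: "S = {a, b, c, d}" "distinct [a, b, c, d]"
      and cl: "\<And>u v. u \<in> S \<Longrightarrow> v \<in> S \<Longrightarrow> u \<noteq> v \<Longrightarrow> {u, v} \<in> edges G" and at: "attach (verts G) S \<subseteq> {a}"
      by (rule K4_blockE) (rule that)
    have "card S = 4" using S4 by simp
    then obtain f where f: "bij_betw f S {..<4::nat}" using ex_bij_betw_finite_nat[OF fS] by (auto simp: atLeast0LessThan)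
    have "{u, v} \<in> edges B \<longleftrightarrow> {f u, f v} \<in> edges (complete_graph 4)" if uv: "u \<in> S" "v \<in> S" for u v
    proof -
      have "f u = f v \<longleftrightarrow> u = v" "f u < 4" "f v < 4" using f uv by (auto simp: bij_betw_def dest: inj_onD)
      moreover have "{u, v} \<in> edges G \<longleftrightarrow> u \<noteq> v" using cl[OF uv] edge_in(3) by blast
      ultimately show ?thesis using eB[OF uv] by (simp add: complete_graph_edge)
    qed
    then have "isomorphic B (complete_graph 4)"
      unfolding isomorphic_def iso_via_def vB complete_graph_verts using f by blast
    then show "block_type_ii G B" unfolding block_type_ii_def end_iff using single[OF at] by simp
  qed

  show "block_type_iii G B \<longleftrightarrow> T2_block (verts G) S"
  proof
    assume iii: "block_type_iii G B"
    then obtain a b Q where T: "T_shape S a b Q" and Q2: "card Q = 2"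
      using T_shape_of_iso[OF SV] unfolding block_type_iii_def B_def by blast
    have t: "S = insert a (insert b Q)" "a \<notin> Q" "b \<notin> Q" "{a, b} \<in> edges G"
      "\<And>q. q \<in> Q \<Longrightarrow> {a, q} \<in> edges G" "\<And>q. q \<in> Q \<Longrightarrow> {b, q} \<in> edges G" "\<And>q r. q \<in> Q \<Longrightarrow> r \<in> Q \<Longrightarrow> {q, r} \<notin> edges G"
      using T unfolding T_shape_def by auto
    have ne: "a \<noteq> b" using edge_in(3) t(4) by blast
    have "deg B x = 2" if "x \<in> attach (verts G) S" for x using iii that unfolding block_type_iii_def cut by blast
    \<comment> \<open>The base vertices a and b have degree three, so a cutvertex, having degree
      two, lies in Q.\<close>
    moreover have "deg B a = 3" "deg B b = 3" using T_shape_deg(1,2)[OF SV T] Q2 unfolding B_def by simp_all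
    ultimately have "a \<notin> attach (verts G) S" "b \<notin> attach (verts G) S" by fastforce+
    then have aQ: "attach (verts G) S \<subseteq> Q" using att t(1) by blast
    have "\<exists>q\<in>Q. attach (verts G) S \<subseteq> {q}"
    proof (cases "attach (verts G) S = {}")
      case True
      moreover have "Q \<noteq> {}" using Q2 by auto
      ultimately show ?thesis by blast
    next
      case False
      then show ?thesis using single' iii aQ unfolding block_type_iii_def end_iff by blast
    qed
    then obtain q where q: "q \<in> Q" "attach (verts G) S \<subseteq> {q}" by blast
    have "card (Q - {q}) = 1" using q Q2 by (simp add: card_Diff_singleton)
    then obtain r where "Q - {q} = {r}" by (auto simp: card_1_singleton_iff)
    then have Qqr: "Q = {q, r}" "q \<noteq> r" using q(1) by auto
    show "T2_block (verts G) S"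
      by (rule T2_blockI[of S a b q r]) (use t ne Qqr q(2) in auto)
  next
    assume "T2_block (verts G) S"
    then obtain a b q r where S4: "S = {a, b, q, r}" "distinct [a, b, q, r]"
      and e: "{a, b} \<in> edges G" "{a, q} \<in> edges G" "{a, r} \<in> edges G" "{b, q} \<in> edges G" "{b, r} \<in> edges G" "{q, r} \<notin> edges G"
      and at: "attach (verts G) S \<subseteq> {q}"
      by (rule T2_blockE) (rule that)
    have "{r, q} \<notin> edges G" using e(6) by (simp add: insert_commute)
    then have T: "T_shape S a b {q, r}" unfolding T_shape_def using S4 e adj_irrefl by auto
    have "card {q, r} = 2" using S4(2) by simp
    then have "isomorphic B (T_graph 2)" using T_shape_iso[OF SV T] unfolding B_def by metis
    moreover have "deg B q = 2" using T_shape_deg(3)[OF SV T] unfolding B_def by simp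
    ultimately show "block_type_iii G B"
      unfolding block_type_iii_def end_iff cut using single[OF at] at by blast
  qed

  have pend: "(\<forall>y\<in>neighbors G x - verts B. deg G y = 1) \<longleftrightarrow>
      (\<forall>y\<in>verts G - S. {x, y} \<in> edges G \<longrightarrow> (\<forall>w\<in>verts G. {y, w} \<in> edges G \<longrightarrow> w = x))" for x
    using deg_1_iff edge_in(2) unfolding neighbors_def vB by blast

  show "block_type_iv G B \<longleftrightarrow> T_block (verts G) S"
  proof
    assume "block_type_iv G B"
    then obtain p where p: "p \<ge> 1" "isomorphic B (T_graph p)" and c2: "card (attach (verts G) S) \<le> 2"
      and dg: "\<And>x. x \<in> attach (verts G) S \<Longrightarrow> deg B x = p + 1"
      and pd: "card (attach (verts G) S) = 2 \<Longrightarrow> \<exists>x\<in>attach (verts G) S. \<forall>y\<in>verts G - S. {x, y} \<in> edges G \<longrightarrow>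
         (\<forall>w\<in>verts G. {y, w} \<in> edges G \<longrightarrow> w = x)"
      unfolding block_type_iv_def cut pend by blast
    obtain a b Q where T: "T_shape S a b Q" and Qp: "card Q = p"
      using T_shape_of_iso[OF SV] p(2) unfolding B_def by blast
    \<comment> \<open>\<open>T_block\<close> singles out b as the vertex whose outside neighbours
      are pendant, so a and b are exchanged if a has this property. If one of a and b is not a
      cutvertex, it has no outside neighbours and qualifies trivially.\<close>
    have concl: "T_block (verts G) S" if T: "T_shape S a b Q" and Q: "Q \<noteq> {}" and at: "attach (verts G) S \<subseteq> {a, b}" for a b Q
    proof -
      have t: "S = insert a (insert b Q)" "a \<notin> Q" "b \<notin> Q" "{a, b} \<in> edges G"
        "\<And>q. q \<in> Q \<Longrightarrow> {a, q} \<in> edges G" "\<And>q. q \<in> Q \<Longrightarrow> {b, q} \<in> edges G" "\<And>q r. q \<in> Q \<Longrightarrow> r \<in> Q \<Longrightarrow> {q, r} \<notin> edges G"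
        using T unfolding T_shape_def by auto
      have ne: "a \<noteq> b" using edge_in(3) t(4) by blast
      define ok where "ok x \<longleftrightarrow> (\<forall>y\<in>verts G - S. {x, y} \<in> edges G \<longrightarrow> (\<forall>w\<in>verts G. {y, w} \<in> edges G \<longrightarrow> w = x))" for x
      have ok: "ok x" if "x \<in> S" "x \<notin> attach (verts G) S" for x
        using attachI[OF that(1), of _ "verts G"] that(2) unfolding ok_def by blast
      have "ok a \<or> ok b"
      proof (cases "a \<in> attach (verts G) S \<and> b \<in> attach (verts G) S")
        case True
        then have "attach (verts G) S = {a, b}" using at by blast
        then show ?thesis using pd ne unfolding ok_def by auto
      next
        case False
        then show ?thesis using ok[of a] ok[of b] t(1) by auto
      qed
      then show ?thesis
      proof
        assume "ok b"
        then show ?thesis unfolding ok_def by (intro T_blockI[OF t(1-3) Q t(4-7) at]) blast+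
      next
        assume "ok a"
        moreover have "S = insert b (insert a Q)" "{b, a} \<in> edges G" "attach (verts G) S \<subseteq> {b, a}"
          using t(1,4) at by (auto simp: insert_commute)
        ultimately show ?thesis unfolding ok_def by (intro T_blockI[OF _ t(3,2) Q _ t(6,5,7)]) blast+
      qed
    qed
    have t: "S = insert a (insert b Q)" "a \<notin> Q" "b \<notin> Q" "{a, b} \<in> edges G"
      "\<And>q. q \<in> Q \<Longrightarrow> {a, q} \<in> edges G" "\<And>q. q \<in> Q \<Longrightarrow> {b, q} \<in> edges G" "\<And>q r. q \<in> Q \<Longrightarrow> r \<in> Q \<Longrightarrow> {q, r} \<notin> edges G"
      using T unfolding T_shape_def by auto
    show "T_block (verts G) S"
    proof (cases "p = 1")
      case False
      \<comment> \<open>The members of Q have degree 2, which differs from p + 1 here, so they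
        cannot be cutvertices.\<close>
      have "q \<notin> attach (verts G) S" if q: "q \<in> Q" for q
      proof
        assume "q \<in> attach (verts G) S"
        then have "deg B q = p + 1" by (rule dg)
        then show False using T_shape_deg(3)[OF SV T q] False unfolding B_def by simp
      qed
      then have "attach (verts G) S \<subseteq> {a, b}" using att t(1) by blast
      moreover have "Q \<noteq> {}" using Qp p(1) by auto
      ultimately show ?thesis by (intro concl[OF T])
    next
      case True
      \<comment> \<open>In a triangle all degrees are p + 1 = 2, so the degree condition does not
        locate the cutvertices. Instead the triangle is relabelled so that a vertex which is no
        cutvertex becomes the member of Q.\<close>
      then obtain q where q: "Q = {q}" using Qp by (auto simp: card_1_singleton_iff)
      have cl: "{u, v} \<in> edges G" if "u \<in> S" "v \<in> S" "u \<noteq> v" for u v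
        using that t q by (auto simp: insert_commute)
      have "card S = 3" using t q edge_in(3) by auto
      then have "attach (verts G) S \<noteq> S" using c2 by auto
      then obtain z where z: "z \<in> S" "z \<notin> attach (verts G) S" using att by blast
      have "card (S - {z}) = 2" using \<open>card S = 3\<close> z by simp
      then obtain u v where uv: "S - {z} = {u, v}" "u \<noteq> v" unfolding card_2_iff by blast
      then have S3: "S = insert u (insert v {z})" "u \<noteq> z" "v \<noteq> z" using z by auto
      have "T_shape S u v {z}"
        unfolding T_shape_def using S3 uv(2) cl adj_irrefl by simp
      moreover have "attach (verts G) S \<subseteq> {u, v}" using att z(2) S3(1) by blast
      ultimately show ?thesis by (rule concl[OF _ insert_not_empty])
    qed
  next
    assume "T_block (verts G) S"
    then obtain a b Q where t: "S = insert a (insert b Q)" "a \<notin> Q" "b \<notin> Q" "Q \<noteq> {}" "{a, b} \<in> edges G"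
      "\<And>q. q \<in> Q \<Longrightarrow> {a, q} \<in> edges G" "\<And>q. q \<in> Q \<Longrightarrow> {b, q} \<in> edges G"
      "\<And>q r. q \<in> Q \<Longrightarrow> r \<in> Q \<Longrightarrow> {q, r} \<notin> edges G" and at: "attach (verts G) S \<subseteq> {a, b}"
      and pe: "\<And>y w. y \<in> verts G - S \<Longrightarrow> {b, y} \<in> edges G \<Longrightarrow> w \<in> verts G \<Longrightarrow> {y, w} \<in> edges G \<Longrightarrow> w = b"
      by (rule T_blockE) (rule that)
    have T: "T_shape S a b Q" unfolding T_shape_def using t by auto
    have fQ: "finite Q" using fS t(1) by simp
    have "1 \<le> card Q" using t(4) fQ by (simp add: Suc_le_eq card_gt_0_iff)
    moreover have "isomorphic B (T_graph (card Q))" using T_shape_iso[OF SV T] by (simp add: B_def)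
    moreover have "card {a, b} \<le> 2" by (simp add: card_insert_if)
    then have "card (attach (verts G) S) \<le> 2" using card_mono[OF _ at] by simp
    moreover have "deg B x = card Q + 1" if "x \<in> attach (verts G) S" for x
      using that at T_shape_deg(1,2)[OF SV T] unfolding B_def by auto
    moreover have "b \<in> attach (verts G) S" if "card (attach (verts G) S) = 2"
    proof (rule ccontr)
      assume "b \<notin> attach (verts G) S"
      then have "attach (verts G) S \<subseteq> {a}" using at by blast
      then show False using card_mono[of "{a}" "attach (verts G) S"] that by simp
    qed
    moreover have "\<forall>y\<in>neighbors G b - verts B. deg G y = 1" unfolding pend using pe by blast
    ultimately show "block_type_iv G B" unfolding block_type_iv_def cut by blast
  qed
qed

lemma trivial_block_iff:
  assumes S: "max_biconn (verts G) S"
  shows "trivial_graph (induced G S) \<longleftrightarrow> card S \<le> 2"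
proof -
  have SV: "S \<subseteq> verts G" and bi: "biconn S" using S by (auto simp: max_biconn_def)
  have fS: "finite S" using SV fin by (rule finite_subset)
  have vS: "verts (induced G S) = S" using SV by auto
  have iso: "isomorphic (induced G S) (complete_graph n) \<longleftrightarrow> card S = n \<and> (\<forall>u\<in>S. \<forall>v\<in>S. u \<noteq> v \<longrightarrow> {u, v} \<in> edges G)" for n
  proof
    assume "isomorphic (induced G S) (complete_graph n)"
    then obtain f where f: "bij_betw f S {..<n}"
      and ed: "\<And>u v. u \<in> S \<Longrightarrow> v \<in> S \<Longrightarrow> {u, v} \<in> edges (induced G S) \<longleftrightarrow> {f u, f v} \<in> edges (complete_graph n)"
      unfolding isomorphic_def iso_via_def vS complete_graph_verts by blast
    have "{u, v} \<in> edges G" if uv: "u \<in> S" "v \<in> S" "u \<noteq> v" for u v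
    proof -
      have "f u \<noteq> f v" "f u < n" "f v < n" using f uv by (auto simp: bij_betw_def dest: inj_onD)
      then show ?thesis using ed[OF uv(1,2)] by (simp add: complete_graph_edge)
    qed
    then show "card S = n \<and> (\<forall>u\<in>S. \<forall>v\<in>S. u \<noteq> v \<longrightarrow> {u, v} \<in> edges G)" using bij_betw_same_card[OF f] by simp
  next
    assume a: "card S = n \<and> (\<forall>u\<in>S. \<forall>v\<in>S. u \<noteq> v \<longrightarrow> {u, v} \<in> edges G)"
    then obtain f where f: "bij_betw f S {..<n}" using ex_bij_betw_finite_nat[OF fS] by (auto simp: atLeast0LessThan)
    have "{u, v} \<in> edges (induced G S) \<longleftrightarrow> {f u, f v} \<in> edges (complete_graph n)" if uv: "u \<in> S" "v \<in> S" for u v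
    proof -
      have "f u = f v \<longleftrightarrow> u = v" "f u < n" "f v < n" using f uv by (auto simp: bij_betw_def dest: inj_onD)
      moreover have "{u, v} \<in> edges G \<longleftrightarrow> u \<noteq> v" using a uv edge_in(3) by blast
      ultimately show ?thesis using uv by (simp add: complete_graph_edge)
    qed
    then show "isomorphic (induced G S) (complete_graph n)"
      unfolding isomorphic_def iso_via_def vS complete_graph_verts using f by blast
  qed
  show ?thesis
  proof
    assume "trivial_graph (induced G S)"
    then show "card S \<le> 2" unfolding trivial_graph_def iso by auto
  next
    assume c: "card S \<le> 2"
    have "card S \<noteq> 0" using bi fS by (auto simp: biconn_def conn_def)
    then consider "card S = 1" | "card S = 2" using c by linarith
    then show "trivial_graph (induced G S)"
    proof cases
      case 1
      then obtain u where "S = {u}" by (auto simp: card_1_singleton_iff)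
      then show ?thesis unfolding trivial_graph_def iso by simp
    next
      case 2
      then obtain u v where uv: "S = {u, v}" "u \<noteq> v" unfolding card_2_iff by blast
      have "reach S u v" using bi uv by (simp add: biconn_def conn_def)
      then have "{u, v} \<in> edges G"
      proof cases
        case (reach_step w)
        then have "w \<in> S" using reach_in by blast
        then show ?thesis using reach_step uv adj_irrefl by auto
      qed (use uv in simp)
      moreover from this have "{v, u} \<in> edges G" by (rule adj_sym)
      ultimately show ?thesis unfolding trivial_graph_def iso using 2 uv by auto
    qed
  qed
qed

lemma H4_iff: "G \<in> H4 \<longleftrightarrow> admissible (verts G)"
proof -
  have "G \<in> H4 \<longleftrightarrow> (\<forall>S. max_biconn (verts G) S \<longrightarrow> \<not> trivial_graph (induced G S) \<longrightarrow>
      block_type_i G (induced G S) \<or> block_type_ii G (induced G S) \<or>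
      block_type_iii G (induced G S) \<or> block_type_iv G (induced G S))"
  proof -
    have "(\<forall>B. block G B \<and> \<not> trivial_graph B \<longrightarrow> P B) \<longleftrightarrow>
        (\<forall>S. max_biconn (verts G) S \<longrightarrow> \<not> trivial_graph (induced G S) \<longrightarrow> P (induced G S))" for P
      unfolding block_iff by blast
    then show ?thesis unfolding H4_def mem_Collect_eq using simple by simp
  qed
  also have "\<dots> \<longleftrightarrow> admissible (verts G)"
    unfolding admissible_def
  proof (intro all_cong1 imp_cong refl)
    fix S assume S: "max_biconn (verts G) S"
    show "\<not> trivial_graph (induced G S) \<longleftrightarrow> 3 \<le> card S" using trivial_block_iff[OF S] by linarith
    assume "3 \<le> card S"
    note b = block_types[OF S this]
    show "(block_type_i G (induced G S) \<or> block_type_ii G (induced G S) \<or>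
        block_type_iii G (induced G S) \<or> block_type_iv G (induced G S)) \<longleftrightarrow>
        (subdiv_block (verts G) S \<or> K4_block (verts G) S \<or> T2_block (verts G) S \<or> T_block (verts G) S)"
      unfolding b ..
  qed
  finally show ?thesis .
qed

end

theorem theorem6:
  shows "(G4 :: 'a ugraph set) = H4"
proof -
  have "G \<in> G4 \<longleftrightarrow> G \<in> H4" if "simple_graph G" for G :: "'a ugraph"
  proof -
    interpret sgraph G by unfold_locales fact
    show ?thesis unfolding G4_iff H4_iff by (rule hereditary_konig_iff[OF fin])
  qed
  then show ?thesis unfolding set_eq_iff by (auto simp: G4_def H4_def)
qed

end
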